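(* Let $0<\beta<1$, let $X$ be the one-dimensional super-Brownian motion with $(1+\beta)$-stable branching mechanism started from $\delta_0$ (law $\mathbb P_{\delta_0}$), let $(L^x)_{x\in\mathbb R}$ be its total local time, and let $\mathsf L<0<\mathsf R$ be the finite random variables such that $\{x\in\mathbb R:L^x>0\}=(\mathsf L,\mathsf R)$ $\mathbb P_{\delta_0}$-a.s. If $0<\gamma<1+2/\beta$, then, $\mathbb P_{\delta_0}$-almost surely, the map $x\mapsto L^x$ satisfies the pointwise $\gamma$-Hölder condition at both $\mathsf L$ and $\mathsf R$.
   Context: Fix $0<\beta<1$. $M_F$ is the space of finite measures on $\mathbb R$ with the weak topology, and $\mu(f)=\int f\,d\mu$. The super-Brownian motion $X=(X_t)_{t\ge0}$ with $(1+\beta)$-stable branching started from $X_0\in M_F$ (law $\mathbb P_{X_0}$, expectation $\mathbb E_{X_0}$) is the $M_F$-valued (càdlàg) strong Markov process with $$\mathbb E_{X_0}\Big[\exp\Big\{-X_t(\phi)-\int_0^tX_s(f)\,ds\Big\}\Big]=\exp\{-X_0(V_t)\}$$ for nonnegative bounded Borel $\phi,f$, where $V_t$ is the unique nonnegative solution of $V_t=P_t\phi+\int_0^tP_s(f-V_{t-s}^{1+\beta})\,ds$ (the mild form of $\partial_tV=\frac12\Delta V-V^{1+\beta}+f$, $V_0=\phi$), and $(P_t)$ is the Brownian semigroup (generator $\frac12\Delta$). The occupation measure $\int_0^tX_s(\cdot)\,ds$ has a density $L_t^x$, the local time, i.e. $\int_0^tX_s(\phi)\,ds=\int_{\mathbb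 R}\phi(x)L_t^x\,dx$ for all nonnegative measurable $\phi$; one uses its jointly continuous version in $(t,x)$. The extinction time $\zeta=\inf\{t\ge0:X_t(1)=0\}$ is a.s. finite, and the total local time is $L^x=L^x_\infty=L^x_\zeta$. It is known that $\{x:L^x>0\}$ is a.s. a bounded open interval $(\mathsf L,\mathsf R)$ containing $0$. Pointwise Hölder condition: for $\gamma>0$, a function $f:\mathbb R\to\mathbb R$ satisfies the pointwise $\gamma$-Hölder condition at $x$ if there are constants $\delta,c>0$ such that $|f(y)-f(x)|\le c|y-x|^\gamma$ whenever $|y-x|<\delta$ (for $\gamma>1$ no polynomial is subtracted). *)

theory Defs
  imports "HOL-Probability.Probability"
begin

section \<open>The space of finite measures\<close>

text \<open>The space \<open>M\<^sub>F\<close> of finite Borel measures on the line, with the \<open>\<sigma>\<close>-algebra generated by the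
  evaluations \<open>\<mu> \<mapsto> \<mu>(A)\<close> (compare \<^const>\<open>subprob_algebra\<close>); this is the Borel \<open>\<sigma>\<close>-algebra of the
  weak topology.\<close>

definition finite_measures :: "real measure measure" where
  "finite_measures =
    (SUP A \<in> sets borel. vimage_algebra {\<mu>. finite_measure \<mu> \<and> sets \<mu> = sets borel}
      (\<lambda>\<mu>. emeasure \<mu> A) borel)"

lemma space_finite_measures:
  "space finite_measures = {\<mu>. finite_measure \<mu> \<and> sets \<mu> = sets borel}"
  by (auto simp: finite_measures_def space_Sup_eq_UN)

definition weakly_tendsto :: "('b \<Rightarrow> real measure) \<Rightarrow> real measure \<Rightarrow> 'b filter \<Rightarrow> bool" where
  "weakly_tendsto m \<mu> F \<longleftrightarrow>
    (\<forall>\<phi> :: real \<Rightarrow> real. continuous_on UNIV \<phi> \<and> bounded (range \<phi>) \<longrightarrow>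
      ((\<lambda>i. \<integral>x. \<phi> x \<partial>m i) \<longlongrightarrow> (\<integral>x. \<phi> x \<partial>\<mu>)) F)"

definition cadlag :: "(real \<Rightarrow> real measure) \<Rightarrow> bool" where
  "cadlag m \<longleftrightarrow>
    (\<forall>t\<ge>0. weakly_tendsto m (m t) (at_right t)) \<and>
    (\<forall>t>0. \<exists>\<nu>\<in>space finite_measures. weakly_tendsto m \<nu> (at_left t))"


section \<open>The log-Laplace equation\<close>

definition heat_semigroup :: "real \<Rightarrow> (real \<Rightarrow> real) \<Rightarrow> real \<Rightarrow> real" where
  "heat_semigroup t g x =
    (if t = 0 then g x else \<integral>y. normal_density x (sqrt t) y * g y \<partial>lborel)"

definition bounded_borel_nonneg :: "(real \<Rightarrow> real) \<Rightarrow> bool" where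
  "bounded_borel_nonneg g \<longleftrightarrow> g \<in> borel_measurable borel \<and> bounded (range g) \<and> (\<forall>x. 0 \<le> g x)"

text \<open>Nonnegative solutions of
  \<open>V\<^sub>t = P\<^sub>t \<phi> + \<integral>\<^sub>0\<^sup>t P\<^sub>s (f - V\<^sub>t\<^sub>-\<^sub>s\<^bsup>1+\<beta>\<^esup>) ds\<close>.  Measurability and local boundedness in time make
  all the integrals meaningful, since the Bochner integral of a non-integrable function is \<open>0\<close>;
  they exclude no genuine solution, as a nonnegative solution is bounded by
  \<open>sup \<phi> + t sup f\<close>.\<close>

definition mild_solution ::
  "real \<Rightarrow> (real \<Rightarrow> real) \<Rightarrow> (real \<Rightarrow> real) \<Rightarrow> (real \<Rightarrow> real \<Rightarrow> real) \<Rightarrow> bool" where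
  "mild_solution \<beta> \<phi> f V \<longleftrightarrow>
    set_borel_measurable borel ({0..} \<times> UNIV) (\<lambda>(t, x). V t x) \<and>
    (\<forall>t\<ge>0. \<forall>x. 0 \<le> V t x) \<and>
    (\<forall>T. \<exists>K. \<forall>t\<in>{0..T}. \<forall>x. V t x \<le> K) \<and>
    (\<forall>t\<ge>0. \<forall>x. V t x = heat_semigroup t \<phi> x +
       (LBINT s:{0..t}. heat_semigroup s (\<lambda>y. f y - V (t - s) y powr (1 + \<beta>)) x))"


section \<open>Super-Brownian motion\<close>

definition natural_filtration ::
  "'w measure \<Rightarrow> (real \<Rightarrow> 'w \<Rightarrow> real measure) \<Rightarrow> real \<Rightarrow> 'w measure" where
  "natural_filtration \<Omega> X t =
    sigma (space \<Omega>)
      {X s -` A \<inter> space \<Omega> | s A. 0 \<le> s \<and> s \<le> t \<and> A \<in> sets finite_measures}"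

text \<open>A Markov process is the family of its laws \<open>P \<mu>\<close>, indexed by the starting point \<open>\<mu>\<close>, on a common
  measurable space \<open>\<Omega>\<close>; negative times carry no information.  It suffices to state the strong Markov
  property for finite stopping times \<open>T\<close>, by considering the truncations of \<open>T\<close>.\<close>

definition strong_markov ::
  "'w measure \<Rightarrow> (real \<Rightarrow> 'w \<Rightarrow> real measure) \<Rightarrow> (real measure \<Rightarrow> 'w measure) \<Rightarrow> bool" where
  "strong_markov \<Omega> X P \<longleftrightarrow>
    (\<forall>\<mu>\<in>space finite_measures. \<forall>T. \<forall>t\<ge>0. \<forall>g :: real measure \<Rightarrow> real.
      stopping_time (natural_filtration \<Omega> X) T \<and> (\<forall>\<omega>\<in>space \<Omega>. 0 \<le> T \<omega>) \<and>
      g \<in> borel_measurable finite_measures \<and> bounded (range g) \<longrightarrow>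
      (AE \<omega> in P \<mu>.
        real_cond_exp (P \<mu>)
          (filtration.pre_sigma (space \<Omega>) (natural_filtration \<Omega> X) T)
          (\<lambda>\<omega>'. g (X (T \<omega>' + t) \<omega>')) \<omega>
        = (\<integral>\<omega>'. g (X t \<omega>') \<partial>P (X (T \<omega>) \<omega>))))"

text \<open>In the last clause \<open>V\<close> is the unique solution of the log-Laplace equation.\<close>

definition super_brownian_motion ::
  "real \<Rightarrow> 'w measure \<Rightarrow> (real \<Rightarrow> 'w \<Rightarrow> real measure) \<Rightarrow> (real measure \<Rightarrow> 'w measure) \<Rightarrow> bool" where
  "super_brownian_motion \<beta> \<Omega> X P \<longleftrightarrow>
    (\<forall>\<mu>\<in>space finite_measures.
       prob_space (P \<mu>) \<and> sets (P \<mu>) = sets \<Omega> \<and> (AE \<omega> in P \<mu>. X 0 \<omega> = \<mu>)) \<and>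
    (\<forall>t\<ge>0. X t \<in> measurable \<Omega> finite_measures) \<and>
    (\<forall>\<omega>\<in>space \<Omega>. cadlag (\<lambda>t. X t \<omega>)) \<and>
    strong_markov \<Omega> X P \<and>
    (\<forall>\<mu>\<in>space finite_measures. \<forall>t\<ge>0. \<forall>\<phi> f V.
       bounded_borel_nonneg \<phi> \<and> bounded_borel_nonneg f \<and> mild_solution \<beta> \<phi> f V \<longrightarrow>
       (\<integral>\<omega>. exp (- (\<integral>x. \<phi> x \<partial>X t \<omega>) - (LBINT s:{0..t}. \<integral>x. f x \<partial>X s \<omega>)) \<partial>P \<mu>)
       = exp (- (\<integral>x. V t x \<partial>\<mu>)))"


section \<open>Local time\<close>

definition local_time ::
  "'w measure \<Rightarrow> (real \<Rightarrow> 'w \<Rightarrow> real measure) \<Rightarrow> (real \<Rightarrow> real \<Rightarrow> 'w \<Rightarrow> real) \<Rightarrow> bool" where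
  "local_time M X L \<longleftrightarrow>
    (\<forall>t\<ge>0. \<forall>x. L t x \<in> borel_measurable M) \<and>
    (AE \<omega> in M.
      continuous_on ({0..} \<times> UNIV) (\<lambda>(t, x). L t x \<omega>) \<and>
      (\<forall>t\<ge>0. \<forall>x. 0 \<le> L t x \<omega>) \<and>
      (\<forall>t\<ge>0. \<forall>\<phi> \<in> borel_measurable borel.
        (\<integral>\<^sup>+s\<in>{0..t}. (\<integral>\<^sup>+x. \<phi> x \<partial>X s \<omega>) \<partial>lborel) =
        (\<integral>\<^sup>+x. \<phi> x * ennreal (L t x \<omega>) \<partial>lborel)))"

definition extinction_time :: "(real \<Rightarrow> 'w \<Rightarrow> real measure) \<Rightarrow> 'w \<Rightarrow> real" where
  "extinction_time X \<omega> = Inf {t. 0 \<le> t \<and> measure (X t \<omega>) UNIV = 0}"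

definition total_local_time ::
  "(real \<Rightarrow> 'w \<Rightarrow> real measure) \<Rightarrow> (real \<Rightarrow> real \<Rightarrow> 'w \<Rightarrow> real) \<Rightarrow> 'w \<Rightarrow> real \<Rightarrow> real" where
  "total_local_time X L \<omega> x = L (extinction_time X \<omega>) x \<omega>"


section \<open>Pointwise Hoelder condition\<close>

definition pointwise_holder :: "real \<Rightarrow> (real \<Rightarrow> real) \<Rightarrow> real \<Rightarrow> bool" where
  "pointwise_holder \<gamma> f x \<longleftrightarrow>
    (\<exists>\<delta>>0. \<exists>c>0. \<forall>y. \<bar>y - x\<bar> < \<delta> \<longrightarrow> \<bar>f y - f x\<bar> \<le> c * \<bar>y - x\<bar> powr \<gamma>)"

end

theory Submission
  imports Defs "HOL-Real_Asymp.Real_Asymp"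
begin

text \<open>Let \<open>U \<ge> 0\<close> be bounded and \<open>C\<^sup>1\<close> with a bounded piecewise second derivative, and suppose that
  \<open>f = U\<^bsup>1+\<beta>\<^esup> - U'' / 2\<close> is nonnegative.  Then \<open>U\<close> is a stationary solution of the log-Laplace equation
  with initial value \<open>U\<close>, and since the process dies out, \<open>t \<rightarrow> \<infinity>\<close> gives
  \<open>E exp (- \<integral> f(x) L\<^sup>x dx) = exp (- U(0))\<close>.  So the Laplace functional is known exactly for many \<open>f\<close>,
  without solving an equation.

  Write \<open>p = 2 / \<beta>\<close>.  The power \<open>U = A (B - y)\<^bsup>-p\<^esup>\<close> has \<open>f = 0\<close>; cut off concavely to the right of a
  point \<open>g < B\<close>, it yields the law of the right end point \<open>R\<close>.  First order perturbations of \<open>U\<close> give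
  \<open>E (\<integral> L\<^sup>x dx; R \<le> b) = O(\<epsilon>\<^bsup>p+3\<^esup>)\<close> for the integral over \<open>(b - \<epsilon>, b]\<close>, and second order ones bound the mean
  total variation of \<open>L\<close> over that interval on \<open>b - \<epsilon> < R \<le> b\<close> by \<open>\<epsilon>\<^bsup>p+2\<^esup>\<close>, up to a small loss in the
  exponent.  As \<open>L\<close> vanishes at \<open>R\<close>, its supremum there is at most its variation, and Borel-Cantelli over a
  grid of points \<open>b\<close> and dyadic \<open>\<epsilon>\<close> gives \<open>L\<^sup>x \<le> (R - x)\<^bsup>\<gamma>\<^esup>\<close> up to a constant.  Reflection handles the left end point.\<close>

section \<open>The heat semigroup and mild solutions\<close>

text \<open>The exponents reflect scaling: at distance e from R one expects L to be of order
  e^(p+1), so a window of length e that ends near R carries mass of order e^(p+2), and R falls into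
  a given window with probability of order e. The obstacle is that branching of index 1 + \<beta> <
  2 has infinite variance. Second moments are therefore taken under a weight exp(- occ m), with a
  potential m that vanishes left of the barrier point g. On the event \<open>near\<close> this
  weight is bounded below: the window carries mass at most r^(p+2) there, while m is of order
  r^(-p-2). Two scales e \<le> r occur because the mass must stay below r^(p+2) outside a summable
  family of events. With r = e the bound is of order e per window, too large for about 1/e windows
  at every dyadic scale. Taking r = e^(1-s) repairs this at a cost in the variation, which is what
  the strict inequality \<gamma> < p + 1 pays for. Variation is the right quantity because the bound
  of order h^2 for two adjacent intervals of length h, summed over e/h pairs and divided by h, no
  longer depends on h.\<close>

lemma integral_derivative_eq_0:
  fixes F F' :: "real \<Rightarrow> real"
  assumes "finite S" "continuous_on UNIV F"
    and "\<And>x. x \<notin> S \<Longrightarrow> (F has_real_derivative F' x) (at x)"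
    and int: "integrable lborel F'"
    and lim: "(F \<longlongrightarrow> 0) at_top" "(F \<longlongrightarrow> 0) at_bot"
  shows "(\<integral>x. F' x \<partial>lborel) = 0"
proof -
  have 1: "(\<integral>x. indicator {- real n..real n} x * F' x \<partial>lborel) = F (real n) - F (- real n)" for n
  proof -
    have "(F' has_integral (F (real n) - F (- real n))) {- real n..real n}"
      using assms
      by (intro fundamental_theorem_of_calculus_interior_strong[OF \<open>finite S\<close>])
        (auto intro: continuous_on_subset simp: has_real_derivative_iff_has_vector_derivative)
    moreover have "set_integrable lborel {- real n..real n} F'"
      using int unfolding set_integrable_def by (intro integrable_mult_indicator) auto
    ultimately show ?thesis
      using set_borel_integral_eq_integral(2)[of "{- real n..real n}" F']
      by (simp add: set_lebesgue_integral_def integral_unique)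
  qed
  have "(\<lambda>n. \<integral>x. indicator {- real n..real n} x * F' x \<partial>lborel) \<longlonglongrightarrow> (\<integral>x. F' x \<partial>lborel)"
  proof (rule integral_dominated_convergence[where w="\<lambda>x. norm (F' x)"])
    show "AE x in lborel. (\<lambda>i. indicator {- real i..real i} x * F' x) \<longlonglongrightarrow> F' x"
    proof (rule AE_I2)
      fix x
      have "eventually (\<lambda>i. indicator {- real i..real i} x * F' x = F' x) sequentially"
        using eventually_ge_at_top[of "nat \<lceil>\<bar>x\<bar>\<rceil>"]
        by eventually_elim (auto simp: indicator_def)
      then show "(\<lambda>i. indicator {- real i..real i} x * F' x) \<longlonglongrightarrow> F' x"
        by (rule tendsto_eventually)
    qed
  qed (use int in \<open>auto simp: indicator_def split: split_indicator\<close>)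
  moreover have "(\<lambda>n. F (real n) - F (- real n)) \<longlonglongrightarrow> 0 - 0"
    by (intro tendsto_diff filterlim_compose[OF lim(1)] filterlim_compose[OF lim(2)]
        filterlim_real_sequentially filterlim_compose[OF filterlim_uminus_at_bot_at_top])
  ultimately show ?thesis
    unfolding 1 by (simp add: LIMSEQ_unique)
qed

lemma integrable_std_normal_abs: "integrable lborel (\<lambda>z. std_normal_density z * \<bar>z\<bar>)"
proof -
  have "integrable lborel (\<lambda>z. std_normal_density z * \<bar>z\<bar> ^ 1)"
    by (rule integrable_std_normal_moment_abs)
  then show ?thesis by simp
qed

lemma integrable_std_normal_bounded:
  fixes g :: "real \<Rightarrow> real"
  assumes [measurable]: "g \<in> borel_measurable borel" and "\<And>x. \<bar>g x\<bar> \<le> K"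
  shows "integrable lborel (\<lambda>z. std_normal_density z * g z)"
    "integrable lborel (\<lambda>z. std_normal_density z * (z * g z))"
proof -
  have "0 \<le> K" using assms(2)[of 0] by linarith
  show "integrable lborel (\<lambda>z. std_normal_density z * g z)"
  proof (rule Bochner_Integration.integrable_bound)
    show "integrable lborel (\<lambda>z. K * std_normal_density z)"
      using integrable_std_normal_moment[of 0] by simp
  qed (use assms(2) \<open>0 \<le> K\<close> in \<open>auto simp: abs_mult mult.commute[of _ "std_normal_density _"] intro!: mult_left_mono AE_I2\<close>)
  show "integrable lborel (\<lambda>z. std_normal_density z * (z * g z))"
  proof (rule Bochner_Integration.integrable_bound)
    show "integrable lborel (\<lambda>z. K * (std_normal_density z * \<bar>z\<bar>))"
      using integrable_std_normal_abs by simp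
  qed (use assms(2) \<open>0 \<le> K\<close> in \<open>auto simp: abs_mult mult.assoc mult.left_commute[of K] mult.commute[of K] intro!: mult_left_mono AE_I2\<close>)
qed

text \<open>Integration by parts: the difference of the two integrands is the derivative of -
  \<phi>(z) u(x + \<sigma> z), with \<phi> the Gaussian density, and this vanishes at both ends. The
  exceptional set \<open>S\<close> is carried along because the identity is applied to first
  derivatives of glued functions, whose own derivatives jump at the junctions.\<close>

lemma stein_identity:
  fixes u u' :: "real \<Rightarrow> real"
  assumes "finite S" and cont: "continuous_on UNIV u"
    and der: "\<And>y. y \<notin> S \<Longrightarrow> (u has_real_derivative u' y) (at y)"
    and [measurable]: "u' \<in> borel_measurable borel"
    and bd: "\<And>y. \<bar>u y\<bar> \<le> K" "\<And>y. \<bar>u' y\<bar> \<le> K"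
    and "0 < \<sigma>"
  shows "(\<integral>z. std_normal_density z * (z * u (x + \<sigma> * z)) \<partial>lborel) =
    \<sigma> * (\<integral>z. std_normal_density z * u' (x + \<sigma> * z) \<partial>lborel)"
proof -
  have [measurable]: "u \<in> borel_measurable borel"
    using cont by (rule borel_measurable_continuous_onI)
  have i: "integrable lborel (\<lambda>z. std_normal_density z * (z * u (x + \<sigma> * z)))"
     "integrable lborel (\<lambda>z. std_normal_density z * u' (x + \<sigma> * z))"
    by (intro integrable_std_normal_bounded[where K=K] bd; measurable)+
  have b: "\<bar>- std_normal_density z * u (x + \<sigma> * z)\<bar> \<le> K * std_normal_density z" for z
    using bd(1)[of "x + \<sigma> * z"] by (auto simp: abs_mult mult.commute[of K] intro!: mult_left_mono)
  have t: "((\<lambda>z. K * std_normal_density z) \<longlongrightarrow> 0) at_top" "((\<lambda>z. K * std_normal_density z) \<longlongrightarrow> 0) at_bot"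
  proof -
    have "((\<lambda>z::real. K * (1 / sqrt (2 * pi) * exp (- z\<^sup>2 / 2))) \<longlongrightarrow> 0) at_top"
      "((\<lambda>z::real. K * (1 / sqrt (2 * pi) * exp (- z\<^sup>2 / 2))) \<longlongrightarrow> 0) at_bot"
      by real_asymp+
    then show "((\<lambda>z. K * std_normal_density z) \<longlongrightarrow> 0) at_top"
      "((\<lambda>z. K * std_normal_density z) \<longlongrightarrow> 0) at_bot"
      by (auto simp: std_normal_density_def)
  qed
  have "(\<integral>z. (std_normal_density z * (z * u (x + \<sigma> * z))
      - \<sigma> * (std_normal_density z * u' (x + \<sigma> * z))) \<partial>lborel) = 0"
  proof (rule integral_derivative_eq_0[where F="\<lambda>z. - std_normal_density z * u (x + \<sigma> * z)"
        and S="(\<lambda>y. (y - x) / \<sigma>) ` S"])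
    show "continuous_on UNIV (\<lambda>z. - std_normal_density z * u (x + \<sigma> * z))"
      unfolding std_normal_density_def
      by (intro continuous_intros continuous_on_compose2[OF cont]) auto
    fix z assume z: "z \<notin> (\<lambda>y. (y - x) / \<sigma>) ` S"
    have "x + \<sigma> * z \<notin> S"
    proof
      assume "x + \<sigma> * z \<in> S"
      then have "(x + \<sigma> * z - x) / \<sigma> \<in> (\<lambda>y. (y - x) / \<sigma>) ` S" by (rule imageI)
      with z \<open>0 < \<sigma>\<close> show False by simp
    qed
    have *: "((\<lambda>z. u (x + \<sigma> * z)) has_real_derivative (u' (x + \<sigma> * z) * \<sigma>)) (at z)"
      by (rule DERIV_chain2[where g="\<lambda>z. x + \<sigma> * z" and f=u, OF der]) (use \<open>x + \<sigma> * z \<notin> S\<close> in \<open>auto intro!: derivative_eq_intros\<close>)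
    have **: "(std_normal_density has_real_derivative (- z * std_normal_density z)) (at z)"
      unfolding std_normal_density_def by (auto intro!: derivative_eq_intros simp: field_simps)
    show "((\<lambda>z. - std_normal_density z * u (x + \<sigma> * z)) has_real_derivative
       (std_normal_density z * (z * u (x + \<sigma> * z)) - \<sigma> * (std_normal_density z * u' (x + \<sigma> * z)))) (at z)"
      using DERIV_mult[OF DERIV_minus[OF **] *] by (simp add: algebra_simps)
  next
    show "((\<lambda>z. - std_normal_density z * u (x + \<sigma> * z)) \<longlongrightarrow> 0) at_top"
      by (rule Lim_null_comparison[OF _ t(1)]) (use b in auto)
    show "((\<lambda>z. - std_normal_density z * u (x + \<sigma> * z)) \<longlongrightarrow> 0) at_bot"
      by (rule Lim_null_comparison[OF _ t(2)]) (use b in auto)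
  qed (use \<open>finite S\<close> i in auto)
  then show ?thesis using i by simp
qed

lemma heat_semigroup_std_normal:
  assumes "0 \<le> s"
  shows "heat_semigroup s g x = (\<integral>z. std_normal_density z * g (x + sqrt s * z) \<partial>lborel)"
proof (cases "s = 0")
  case True
  then show ?thesis by (simp add: heat_semigroup_def)
next
  case False
  with assms have "0 < s" by simp
  have "(\<integral>y. normal_density x (sqrt s) y * g y \<partial>lborel) =
    \<bar>sqrt s\<bar> * (\<integral>z. normal_density x (sqrt s) (x + sqrt s * z) * g (x + sqrt s * z) \<partial>lborel)"
    using lborel_integral_real_affine[of "sqrt s" "\<lambda>y. normal_density x (sqrt s) y * g y" x] \<open>0 < s\<close>
    by simp
  also have "\<dots> = (\<integral>z. \<bar>sqrt s\<bar> * (normal_density x (sqrt s) (x + sqrt s * z) * g (x + sqrt s * z)) \<partial>lborel)"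
    by simp
  also have "\<dots> = (\<integral>z. std_normal_density z * g (x + sqrt s * z) \<partial>lborel)"
    using \<open>0 < s\<close> by (intro Bochner_Integration.integral_cong refl)
      (simp add: normal_density_def real_sqrt_mult power_mult_distrib)
  finally show ?thesis using False by (simp add: heat_semigroup_def)
qed

lemma integrable_inverse_sqrt:
  assumes "0 \<le> t"
  shows "integrable lborel (\<lambda>s::real. indicator {0..t} s * (1 / (2 * sqrt s)))"
proof -
  have "((\<lambda>s. 1 / (2 * sqrt s)) has_integral (sqrt t - sqrt 0)) {0..t}"
    using assms
    by (intro fundamental_theorem_of_calculus_interior)
      (auto intro!: continuous_intros derivative_eq_intros
        simp: has_real_derivative_iff_has_vector_derivative[symmetric] field_simps)
  then have "(\<lambda>s. 1 / (2 * sqrt s)) absolutely_integrable_on {0..t}"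
    by (intro nonnegative_absolutely_integrable_1) auto
  then have "set_integrable lborel {0..t} (\<lambda>s. 1 / (2 * sqrt s))"
    by (simp add: set_integrable_def integrable_completion)
  then show ?thesis by (simp add: set_integrable_def)
qed

lemma sqrt_increment_integral:
  fixes U U1 :: "real \<Rightarrow> real"
  assumes der: "\<And>y. (U has_real_derivative U1 y) (at y)"
    and [measurable]: "U1 \<in> borel_measurable borel"
    and bd: "\<And>y. \<bar>U1 y\<bar> \<le> K" and "0 \<le> t"
  shows "(\<integral>s. indicator {0..t} s * (U1 (x + sqrt s * z) * (z / (2 * sqrt s))) \<partial>lborel)
    = U (x + sqrt t * z) - U x"
proof -
  have cU: "continuous_on UNIV U"
    using der by (auto intro: continuous_at_imp_continuous_on DERIV_isCont)
  have "((\<lambda>s. U1 (x + sqrt s * z) * (z / (2 * sqrt s))) has_integral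
      (U (x + sqrt t * z) - U (x + sqrt 0 * z))) {0..t}"
  proof (rule fundamental_theorem_of_calculus_interior[OF \<open>0 \<le> t\<close>])
    show "continuous_on {0..t} (\<lambda>s. U (x + sqrt s * z))"
      by (intro continuous_on_compose2[OF cU] continuous_intros) auto
    fix s assume "s \<in> {0<..<t}"
    then have "((\<lambda>s. x + sqrt s * z) has_real_derivative (z / (2 * sqrt s))) (at s)"
      by (auto intro!: derivative_eq_intros simp: field_simps)
    from DERIV_chain2[where f=U and g="\<lambda>s. x + sqrt s * z", OF der this]
    show "((\<lambda>s. U (x + sqrt s * z)) has_vector_derivative U1 (x + sqrt s * z) * (z / (2 * sqrt s))) (at s)"
      by (simp add: has_real_derivative_iff_has_vector_derivative)
  qed
  moreover have "set_integrable lborel {0..t} (\<lambda>s. U1 (x + sqrt s * z) * (z / (2 * sqrt s)))"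
    unfolding set_integrable_def
  proof (rule Bochner_Integration.integrable_bound)
    show "integrable lborel (\<lambda>s. (K * \<bar>z\<bar>) * (indicator {0..t} s * (1 / (2 * sqrt s))))"
      using integrable_inverse_sqrt[OF \<open>0 \<le> t\<close>] by (rule integrable_mult_right)
    show "AE s in lborel. norm (indicator {0..t} s *\<^sub>R (U1 (x + sqrt s * z) * (z / (2 * sqrt s))))
      \<le> norm ((K * \<bar>z\<bar>) * (indicator {0..t} s * (1 / (2 * sqrt s))))"
    proof (rule AE_I2)
      fix s
      have "\<bar>U1 (x + sqrt s * z)\<bar> * (\<bar>z\<bar> / (2 * \<bar>sqrt s\<bar>)) \<le> \<bar>K\<bar> * (\<bar>z\<bar> / (2 * \<bar>sqrt s\<bar>))"
        using bd[of "x + sqrt s * z"] by (intro mult_right_mono) auto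
      then show "norm (indicator {0..t} s *\<^sub>R (U1 (x + sqrt s * z) * (z / (2 * sqrt s))))
      \<le> norm ((K * \<bar>z\<bar>) * (indicator {0..t} s * (1 / (2 * sqrt s))))"
        by (auto simp: indicator_def abs_mult)
    qed
  qed measurable
  ultimately show ?thesis
    using set_borel_integral_eq_integral(2)[of "{0..t}" "\<lambda>s. U1 (x + sqrt s * z) * (z / (2 * sqrt s))"]
    by (simp add: set_lebesgue_integral_def integral_unique)
qed

text \<open>Dynkin's formula, obtained by writing the increment of \<open>s \<mapsto> U (x + sqrt s * Z)\<close>, with \<open>Z\<close>
  standard normal, as an integral and applying Stein's identity under the integral.\<close>

lemma heat_semigroup_dynkin:
  fixes U U1 U2 :: "real \<Rightarrow> real"
  assumes "finite S" and der: "\<And>y. (U has_real_derivative U1 y) (at y)"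
    and der2: "\<And>y. y \<notin> S \<Longrightarrow> (U1 has_real_derivative U2 y) (at y)"
    and cU1: "continuous_on UNIV U1"
    and [measurable]: "U2 \<in> borel_measurable borel"
    and bd: "\<And>y. \<bar>U y\<bar> \<le> K" "\<And>y. \<bar>U1 y\<bar> \<le> K" "\<And>y. \<bar>U2 y\<bar> \<le> K"
    and "0 \<le> t"
  shows "heat_semigroup t U x = U x + (LBINT s:{0..t}. heat_semigroup s (\<lambda>y. U2 y / 2) x)"
proof -
  have cU: "continuous_on UNIV U"
    using der by (auto intro: continuous_at_imp_continuous_on DERIV_isCont)
  have [measurable]: "U \<in> borel_measurable borel" "U1 \<in> borel_measurable borel"
    using cU cU1 by (auto intro: borel_measurable_continuous_onI)
  have "0 \<le> K" using bd(1)[of 0] by linarith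
  let ?\<phi> = std_normal_density
  let ?h = "\<lambda>z s. ?\<phi> z * (indicator {0..t} s * (U1 (x + sqrt s * z) * (z / (2 * sqrt s))))"
  \<comment> \<open>The factor z / (2 sqrt s) is singular at s = 0 but integrable there; this
    justifies exchanging the two integrals.\<close>
  have int: "integrable (lborel \<Otimes>\<^sub>M lborel) (\<lambda>(z, s). ?h z s)"
  proof (rule Bochner_Integration.integrable_bound)
    show "integrable (lborel \<Otimes>\<^sub>M lborel)
      (\<lambda>(z, s). K * (?\<phi> z * \<bar>z\<bar>) * (indicator {0..t} s * (1 / (2 * sqrt s))))"
    proof (rule lborel_pair.Fubini_integrable)
      show "integrable lborel (\<lambda>z. LINT s|lborel. norm (case (z, s) of (z, s) \<Rightarrow>
          K * (?\<phi> z * \<bar>z\<bar>) * (indicator {0..t} s * (1 / (2 * sqrt s)))))"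
      proof -
        have "(LINT s|lborel. norm (K * (?\<phi> z * \<bar>z\<bar>) * (indicator {0..t} s * (1 / (2 * sqrt s)))))
          = \<bar>K\<bar> * (?\<phi> z * \<bar>z\<bar>) * (LINT s|lborel. norm (indicator {0..t} s * (1 / (2 * sqrt s))))" for z
          unfolding norm_mult[of "K * (?\<phi> z * \<bar>z\<bar>)"] Bochner_Integration.integral_mult_right_zero by (simp add: abs_mult)
        then show ?thesis using integrable_std_normal_abs by simp
      qed
      show "AE z in lborel. integrable lborel (\<lambda>s. case (z, s) of (z, s) \<Rightarrow>
          K * (?\<phi> z * \<bar>z\<bar>) * (indicator {0..t} s * (1 / (2 * sqrt s))))"
        using integrable_inverse_sqrt[OF \<open>0 \<le> t\<close>]
        by (intro AE_I2) (simp only: prod.case integrable_mult_right)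
    qed measurable
    show "AE p in lborel \<Otimes>\<^sub>M lborel. norm (case p of (z, s) \<Rightarrow> ?h z s) \<le>
      norm (case p of (z, s) \<Rightarrow> K * (?\<phi> z * \<bar>z\<bar>) * (indicator {0..t} s * (1 / (2 * sqrt s))))"
    proof (rule AE_I2, clarify)
      fix z s :: real
      have "\<bar>U1 (x + sqrt s * z)\<bar> * (?\<phi> z * (\<bar>z\<bar> / (2 * \<bar>sqrt s\<bar>))) \<le> K * (?\<phi> z * (\<bar>z\<bar> / (2 * \<bar>sqrt s\<bar>)))"
        using bd(2) by (intro mult_right_mono) auto
      then show "norm (?h z s) \<le> norm (K * (?\<phi> z * \<bar>z\<bar>) * (indicator {0..t} s * (1 / (2 * sqrt s))))"
        using \<open>0 \<le> K\<close> by (auto simp: indicator_def abs_mult ac_simps)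
    qed
  qed measurable
  have "heat_semigroup t U x - U x = (\<integral>z. ?\<phi> z * (U (x + sqrt t * z) - U x) \<partial>lborel)"
  proof -
    have "integrable lborel (\<lambda>z. ?\<phi> z * U (x + sqrt t * z))" "integrable lborel (\<lambda>z. ?\<phi> z * U x)"
      by (intro integrable_std_normal_bounded[where K=K] bd; measurable)+
    moreover have "integral\<^sup>L lborel ?\<phi> = 1"
      by (simp add: integral_normal_density)
    ultimately show ?thesis
      using \<open>0 \<le> t\<close> by (simp add: heat_semigroup_std_normal right_diff_distrib)
  qed
  also have "\<dots> = (\<integral>z. (\<integral>s. ?h z s \<partial>lborel) \<partial>lborel)"
    by (simp only: Bochner_Integration.integral_mult_right_zero
        sqrt_increment_integral[OF der \<open>U1 \<in> borel_measurable borel\<close> bd(2) \<open>0 \<le> t\<close>])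
  also have "\<dots> = (\<integral>s. (\<integral>z. ?h z s \<partial>lborel) \<partial>lborel)"
    using lborel_pair.Fubini_integral[OF int] by simp
  also have "\<dots> = (\<integral>s. indicator {0..t} s * heat_semigroup s (\<lambda>y. U2 y / 2) x \<partial>lborel)"
  proof (rule integral_cong_AE)
    show "(\<lambda>s. \<integral>z. ?h z s \<partial>lborel) \<in> borel_measurable lborel" by measurable
    have "(\<lambda>s. indicator {0..t} s * (\<integral>z. ?\<phi> z * (U2 (x + sqrt s * z) / 2) \<partial>lborel)) \<in> borel_measurable lborel"
      by measurable
    also have "(\<lambda>s. indicator {0..t} s * (\<integral>z. ?\<phi> z * (U2 (x + sqrt s * z) / 2) \<partial>lborel))
      = (\<lambda>s. indicator {0..t} s * heat_semigroup s (\<lambda>y. U2 y / 2) x)"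
      by (auto simp: fun_eq_iff heat_semigroup_std_normal indicator_def)
    finally show "(\<lambda>s. indicator {0..t} s * heat_semigroup s (\<lambda>y. U2 y / 2) x) \<in> borel_measurable lborel" .
    \<comment> \<open>Stein's identity requires a positive standard deviation sqrt s; the remaining
      point s = 0 is Lebesgue null.\<close>
    have "(\<integral>z. ?h z s \<partial>lborel) = indicator {0..t} s * heat_semigroup s (\<lambda>y. U2 y / 2) x"
      if "s \<noteq> 0" for s
    proof (cases "s \<in> {0..t}")
      case True
      with that have "0 < s" by simp
      have "(\<integral>z. ?h z s \<partial>lborel) = (\<integral>z. (1 / (2 * sqrt s)) * (?\<phi> z * (z * U1 (x + sqrt s * z))) \<partial>lborel)"
        using True by (intro Bochner_Integration.integral_cong refl) (simp add: mult.commute)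
      also have "\<dots> = (1 / (2 * sqrt s)) * (sqrt s * (\<integral>z. ?\<phi> z * U2 (x + sqrt s * z) \<partial>lborel))"
        using stein_identity[OF \<open>finite S\<close> cU1 der2 _ bd(2,3), of "sqrt s" x] \<open>0 < s\<close> by simp
      also have "\<dots> = heat_semigroup s (\<lambda>y. U2 y / 2) x"
        using \<open>0 < s\<close> by (simp add: heat_semigroup_std_normal)
      finally show ?thesis using True by simp
    qed simp
    then show "AE s in lborel. (\<integral>z. ?h z s \<partial>lborel) = indicator {0..t} s * heat_semigroup s (\<lambda>y. U2 y / 2) x"
      using AE_lborel_singleton[of 0] by auto
  qed
  finally show ?thesis by (simp add: set_lebesgue_integral_def)
qed

section \<open>Stationary and spatially constant solutions of the log-Laplace equation\<close>

lemma heat_semigroup_const: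
  assumes "0 \<le> t"
  shows "heat_semigroup t (\<lambda>_. c) x = c"
proof -
  have "integral\<^sup>L lborel std_normal_density = 1"
    by (simp add: integral_normal_density)
  then show ?thesis using assms by (simp add: heat_semigroup_std_normal)
qed

lemma heat_semigroup_uminus: "heat_semigroup t (\<lambda>y. - g y) x = - heat_semigroup t g x"
  by (simp add: heat_semigroup_def)

lemma set_borel_measurable_half_plane:
  fixes g :: "real \<times> real \<Rightarrow> real"
  assumes "g \<in> borel_measurable (borel \<Otimes>\<^sub>M borel)"
  shows "set_borel_measurable borel ({0..} \<times> UNIV) g"
proof -
  have "{0..} \<times> UNIV \<in> sets (borel :: (real \<times> real) measure)"
    by (intro borel_closed closed_Times) auto
  with assms show ?thesis
    by (auto simp: set_borel_measurable_def borel_prod)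
qed

text \<open>With this source the integrand f - U^(1+\<beta>) collapses to - U2 / 2, and the mild
  equation for a function constant in time becomes Dynkin's formula.\<close>

lemma mild_solution_stationary:
  fixes U U1 U2 :: "real \<Rightarrow> real"
  assumes "finite S" and der: "\<And>y. (U has_real_derivative U1 y) (at y)"
    and der2: "\<And>y. y \<notin> S \<Longrightarrow> (U1 has_real_derivative U2 y) (at y)"
    and cU1: "continuous_on UNIV U1"
    and "U2 \<in> borel_measurable borel"
    and bd: "\<And>y. \<bar>U y\<bar> \<le> K" "\<And>y. \<bar>U1 y\<bar> \<le> K" "\<And>y. \<bar>U2 y\<bar> \<le> K"
    and nonneg: "\<And>y. 0 \<le> U y"
  shows "mild_solution \<beta> U (\<lambda>y. U y powr (1 + \<beta>) - U2 y / 2) (\<lambda>t. U)"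
proof -
  have cU: "continuous_on UNIV U"
    using der by (auto intro: continuous_at_imp_continuous_on DERIV_isCont)
  then have [measurable]: "U \<in> borel_measurable borel"
    by (auto intro: borel_measurable_continuous_onI)
  have "set_borel_measurable borel ({0..} \<times> UNIV) (\<lambda>(t::real, x). U x)"
    by (rule set_borel_measurable_half_plane) measurable
  moreover have "U x = heat_semigroup t U x +
       (LBINT s:{0..t}. heat_semigroup s (\<lambda>y. U y powr (1 + \<beta>) - U2 y / 2 - U y powr (1 + \<beta>)) x)"
    if "0 \<le> t" for t x
    using heat_semigroup_dynkin[OF assms(1-8) that, of x]
    by (simp add: heat_semigroup_uminus set_lebesgue_integral_def)
  ultimately show ?thesis
    using nonneg abs_le_D1[OF bd(1)] unfolding mild_solution_def by blast
qed

text \<open>The formula is the solution of \<open>v' = - v\<^bsup>1+\<beta>\<^esup>\<close> with \<open>v 0 = \<theta>\<close>.\<close>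

lemma mild_solution_const:
  assumes "0 < \<beta>" "0 < \<theta>"
  shows "mild_solution \<beta> (\<lambda>_. \<theta>) (\<lambda>_. 0) (\<lambda>t _. (\<theta> powr (- \<beta>) + \<beta> * t) powr (- 1 / \<beta>))"
proof -
  define v where "v t = (\<theta> powr (- \<beta>) + \<beta> * t) powr (- 1 / \<beta>)" for t
  have pos: "0 < \<theta> powr (- \<beta>) + \<beta> * t" if "0 \<le> t" for t
    using assms that by (auto intro!: add_pos_nonneg)
  have v0: "v 0 = \<theta>" using assms by (simp add: v_def powr_powr)
  have vle: "v t \<le> \<theta>" if "0 \<le> t" for t
  proof -
    have "v t \<le> v 0"
      unfolding v_def using assms that pos[OF that] by (intro powr_mono2') auto
    then show ?thesis by (simp add: v0)
  qed
  have dv: "(v has_real_derivative - (v t powr (1 + \<beta>))) (at t)" if "0 \<le> t" for t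
  proof -
    have "(v has_real_derivative ((- 1 / \<beta>) * (\<theta> powr (- \<beta>) + \<beta> * t) powr (- 1 / \<beta> - 1) * \<beta>)) (at t)"
      unfolding v_def using pos[OF that] assms
      by (auto intro!: derivative_eq_intros)
    moreover have "- 1 / \<beta> * (1 + \<beta>) = - 1 / \<beta> - 1" using assms by (simp add: field_simps)
    ultimately show ?thesis using assms by (simp add: v_def powr_powr)
  qed
  have vnn: "0 \<le> v t" for t by (simp add: v_def)
  have vm[measurable]: "v \<in> borel_measurable borel" unfolding v_def by measurable
  have "set_borel_measurable borel ({0..} \<times> UNIV) (\<lambda>(t::real, x::real). v t)"
    by (rule set_borel_measurable_half_plane) measurable
  moreover have "v t = heat_semigroup t (\<lambda>_. \<theta>) x +
       (LBINT s:{0..t}. heat_semigroup s (\<lambda>y. 0 - v (t - s) powr (1 + \<beta>)) x)" if "0 \<le> t" for t x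
  proof -
    have "(LBINT s:{0..t}. heat_semigroup s (\<lambda>y. 0 - v (t - s) powr (1 + \<beta>)) x)
      = (LBINT s:{0..t}. - (v (t - s) powr (1 + \<beta>)))"
      by (intro set_lebesgue_integral_cong) (auto simp: heat_semigroup_const)
    also have "\<dots> = v t - v 0"
    proof -
      have hi: "((\<lambda>s. - (v (t - s) powr (1 + \<beta>))) has_integral ((- v (t - t)) - (- v (t - 0)))) {0..t}"
      proof (rule fundamental_theorem_of_calculus[OF that])
        fix s assume "s \<in> {0..t}"
        then have "(v has_real_derivative - (v (t - s) powr (1 + \<beta>))) (at (t - s))"
          by (intro dv) auto
        then have "((\<lambda>s. v (t - s)) has_real_derivative - (v (t - s) powr (1 + \<beta>)) * -1) (at s)"
          by (rule DERIV_chain2[where f=v and g="\<lambda>s. t - s"]) (auto intro!: derivative_eq_intros)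
        from DERIV_minus[OF this]
        have "((\<lambda>s. - v (t - s)) has_real_derivative - (v (t - s) powr (1 + \<beta>))) (at s within {0..t})"
          by (rule has_field_derivative_at_within[OF DERIV_cong]) simp
        then show "((\<lambda>s. - v (t - s)) has_vector_derivative - (v (t - s) powr (1 + \<beta>))) (at s within {0..t})"
          by (simp add: has_real_derivative_iff_has_vector_derivative)
      qed
      have si: "set_integrable lborel {0..t} (\<lambda>s. - (v (t - s) powr (1 + \<beta>)))"
      proof (rule set_integrable_bound[where f="\<lambda>_. \<theta> powr (1 + \<beta>)"])
        show "AE s in lborel. s \<in> {0..t} \<longrightarrow> norm (- (v (t - s) powr (1 + \<beta>))) \<le> norm (\<theta> powr (1 + \<beta>))"
          using assms vle by (auto intro!: AE_I2 powr_mono2 simp: v_def)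
        have "integrable lborel (indicator {0..t} :: real \<Rightarrow> real)"
          by (intro integrable_real_indicator) (auto simp: emeasure_lborel_Icc_eq)
        then show "set_integrable lborel {0..t} (\<lambda>_. \<theta> powr (1 + \<beta>))"
          by (simp add: set_integrable_def)
      qed (simp add: set_borel_measurable_def)
      show ?thesis
        using set_borel_integral_eq_integral(2)[OF si] integral_unique[OF hi] by simp
    qed
    finally show ?thesis using that v0 by (simp add: heat_semigroup_const)
  qed
  ultimately show ?thesis
    using vle vnn unfolding mild_solution_def v_def[symmetric] by (meson atLeastAtMost_iff)
qed

section \<open>Extinction, absorption and the total local time\<close>

lemma AE_lborel_eq_continuous:
  fixes f g :: "real \<Rightarrow> real"
  assumes "continuous_on UNIV f" "continuous_on UNIV g" and ae: "AE x in lborel. f x = g x"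
  shows "f = g"
proof (rule ccontr)
  assume "f \<noteq> g"
  then obtain x0 where "f x0 \<noteq> g x0" by auto
  have "open {x. f x \<noteq> g x}"
    using assms by (intro open_Collect_neq) auto
  then obtain d where d: "d > 0" "ball x0 d \<subseteq> {x. f x \<noteq> g x}"
    using \<open>f x0 \<noteq> g x0\<close> by (elim openE) auto
  have "AE x in lborel. x \<notin> {x0 - d<..<x0 + d}"
    using ae by eventually_elim (use d in \<open>auto simp: ball_def dist_real_def subset_eq\<close>)
  then have "emeasure lborel {x0 - d<..<x0 + d} = 0"
    by (subst (asm) AE_iff_measurable[where N="{x0 - d<..<x0 + d}"]) auto
  then show False using d by simp
qed

lemma borel_measurable_right_continuous:
  fixes h :: "real \<Rightarrow> real"
  assumes "\<And>t. (h \<longlongrightarrow> h t) (at_right t)"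
  shows "h \<in> borel_measurable borel"
proof (rule borel_measurable_LIMSEQ_real)
  \<comment> \<open>Adding 1 after the floor keeps the grid point strictly to the right of t, as
    \<open>at_right\<close> demands.\<close>
  show "(\<lambda>k. h ((real_of_int \<lfloor>real (Suc k) * t\<rfloor> + 1) / real (Suc k))) \<longlonglongrightarrow> h t" for t
  proof (rule filterlim_compose[OF assms])
    have *: "t < (real_of_int \<lfloor>real (Suc k) * t\<rfloor> + 1) / real (Suc k)"
      "(real_of_int \<lfloor>real (Suc k) * t\<rfloor> + 1) / real (Suc k) \<le> t + 1 / real (Suc k)" for k
    proof -
      have "real (Suc k) * t < real_of_int \<lfloor>real (Suc k) * t\<rfloor> + 1" by linarith
      then show "t < (real_of_int \<lfloor>real (Suc k) * t\<rfloor> + 1) / real (Suc k)"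
        by (simp add: pos_less_divide_eq mult.commute del: of_nat_Suc)
      have "real_of_int \<lfloor>real (Suc k) * t\<rfloor> + 1 \<le> real (Suc k) * t + 1" by linarith
      then have "(real_of_int \<lfloor>real (Suc k) * t\<rfloor> + 1) / real (Suc k) \<le> (real (Suc k) * t + 1) / real (Suc k)"
        by (intro divide_right_mono) auto
      then show "(real_of_int \<lfloor>real (Suc k) * t\<rfloor> + 1) / real (Suc k) \<le> t + 1 / real (Suc k)"
        by (simp add: add_divide_distrib del: of_nat_Suc)
    qed
    have "(\<lambda>k. (real_of_int \<lfloor>real (Suc k) * t\<rfloor> + 1) / real (Suc k)) \<longlonglongrightarrow> t"
    proof (rule real_tendsto_sandwich[OF _ _ tendsto_const])
      show "(\<lambda>k. t + 1 / real (Suc k)) \<longlonglongrightarrow> t"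
        using tendsto_add[OF tendsto_const LIMSEQ_Suc[OF lim_1_over_n[where 'a=real]], of t] by simp
    qed (use *(1)[THEN less_imp_le] *(2) in \<open>auto intro!: always_eventually simp del: of_nat_Suc\<close>)
    moreover have "(real_of_int \<lfloor>real (Suc k) * t\<rfloor> + 1) / real (Suc k) \<noteq> t" for k
      using *(1)[of k] by linarith
    ultimately show "filterlim (\<lambda>k. (real_of_int \<lfloor>real (Suc k) * t\<rfloor> + 1) / real (Suc k)) (at_right t) sequentially"
      by (auto simp: filterlim_at *(1) simp del: of_nat_Suc intro!: always_eventually)
  qed
  show "(\<lambda>t. h ((real_of_int \<lfloor>real (Suc k) * t\<rfloor> + 1) / real (Suc k))) \<in> borel_measurable borel" for k
    by measurable
qed

text \<open>Below, \<open>max 0 t\<close> makes the path total in time.\<close>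

lemma cadlag_emeasure_measurable:
  assumes cad: "cadlag m" and m: "\<And>t. 0 \<le> t \<Longrightarrow> m t \<in> space finite_measures"
    and A: "A \<in> sets borel"
  shows "(\<lambda>t. emeasure (m (max 0 t)) A) \<in> borel_measurable borel"
proof -
  define n where "n t = m (max 0 t)" for t
  have fin: "finite_measure (n t)" and sets_n[measurable_cong]: "sets (n t) = sets borel" for t
    using m[of "max 0 t"] by (auto simp: n_def space_finite_measures)
  have space_n: "space (n t) = UNIV" for t using sets_eq_imp_space_eq[OF sets_n] by simp
  have cont: "(\<lambda>t. \<integral>x. \<phi> x \<partial>n t) \<in> borel_measurable borel"
    if \<phi>: "continuous_on UNIV \<phi>" "bounded (range \<phi>)" for \<phi> :: "real \<Rightarrow> real"
  proof (rule borel_measurable_right_continuous)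
    fix t :: real
    show "((\<lambda>t. \<integral>x. \<phi> x \<partial>n t) \<longlongrightarrow> (\<integral>x. \<phi> x \<partial>n t)) (at_right t)"
    proof (cases "0 \<le> t")
      case True
      then have "((\<lambda>t. \<integral>x. \<phi> x \<partial>m t) \<longlongrightarrow> (\<integral>x. \<phi> x \<partial>n t)) (at_right t)"
        using cad \<phi> by (auto simp: cadlag_def weakly_tendsto_def n_def)
      then show ?thesis
        by (rule Lim_transform_eventually)
          (use True in \<open>auto simp: n_def eventually_at_filter intro!: always_eventually\<close>)
    next
      case False
      have "eventually (\<lambda>s. s < 0) (at_right t)"
        using False by (intro order_tendstoD(2)[OF tendsto_ident_at]) auto
      then have "eventually (\<lambda>s. (\<integral>x. \<phi> x \<partial>n s) = (\<integral>x. \<phi> x \<partial>n t)) (at_right t)"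
        by eventually_elim (use False in \<open>auto simp: n_def\<close>)
      then show ?thesis by (rule tendsto_eventually)
    qed
  qed
  have atMost: "(\<lambda>t. measure (n t) {..a}) \<in> borel_measurable borel" for a
  proof (rule borel_measurable_LIMSEQ_real)
    \<comment> \<open>Weak convergence only tests continuous functions, so the indicator of a closed
      half line is approached from above by piecewise linear ones. Half lines form an
      intersection-stable generator, which gives all Borel sets below.\<close>
    define \<phi> where "\<phi> k x = max 0 (min 1 (1 - real k * (x - a)))" for k :: nat and x :: real
    show "(\<lambda>k. \<integral>x. \<phi> k x \<partial>n t) \<longlonglongrightarrow> measure (n t) {..a}" for t
    proof -
      interpret finite_measure "n t" by (rule fin)
      have "(\<lambda>k. \<integral>x. \<phi> k x \<partial>n t) \<longlonglongrightarrow> (\<integral>x. indicator {..a} x \<partial>n t)"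
      proof (rule integral_dominated_convergence[where w="\<lambda>_. 1"])
        show "AE x in n t. (\<lambda>k. \<phi> k x) \<longlonglongrightarrow> indicator {..a} x"
        proof (rule AE_I2)
          fix x
          show "(\<lambda>k. \<phi> k x) \<longlonglongrightarrow> indicator {..a} x"
          proof (cases "x \<le> a")
            case True
            then have "\<phi> k x = 1" for k
              by (auto simp: \<phi>_def mult_nonneg_nonpos min_def max_def)
            with True show ?thesis by simp
          next
            case False
            have "eventually (\<lambda>k. \<phi> k x = 0) sequentially"
              using eventually_ge_at_top[of "nat \<lceil>1 / (x - a)\<rceil>"]
            proof eventually_elim
              case (elim k)
              then have "1 / (x - a) \<le> real k" by linarith
              with False have "1 \<le> real k * (x - a)" by (simp add: field_simps)
              then show ?case by (simp add: \<phi>_def)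
            qed
            with False show ?thesis by (auto intro: tendsto_eventually)
          qed
        qed
      qed (auto simp: \<phi>_def)
      then show ?thesis by (simp add: space_n)
    qed
    show "(\<lambda>t. \<integral>x. \<phi> k x \<partial>n t) \<in> borel_measurable borel" for k
    proof (rule cont)
      show "continuous_on UNIV (\<phi> k)" unfolding \<phi>_def by (intro continuous_intros)
      show "bounded (range (\<phi> k))" by (auto simp: bounded_iff \<phi>_def intro!: exI[of _ 1])
    qed
  qed
  have "(\<lambda>t. measure (n t) B) \<in> borel_measurable borel" if "B \<in> sigma_sets UNIV (range atMost)" for B :: "real set"
  proof -
    have "Int_stable (range atMost :: real set set)"
      by (auto simp: Int_stable_def)
    moreover have "range atMost \<subseteq> Pow (UNIV :: real set)" by simp
    ultimately show ?thesis
      using that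
      proof (induction rule: sigma_sets_induct_disjoint)
        case (basic A)
        then show ?case using atMost by auto
      next
        case (compl A)
        then have A: "A \<in> sets borel" by (simp add: borel_eq_atMost)
        have "measure (n t) (UNIV - A) = measure (n t) UNIV - measure (n t) A" for t
          using finite_measure.finite_measure_compl[OF fin, of A t] A by (simp add: sets_n space_n)
        moreover have "(\<lambda>t. measure (n t) UNIV) \<in> borel_measurable borel"
          using cont[of "\<lambda>_. 1"] by (simp add: space_n)
        ultimately show ?case using compl by simp
      next
        case (union A)
        then have A: "range A \<subseteq> sets borel" by (auto simp: borel_eq_atMost)
        then have "measure (n t) (\<Union>i. A i) = (\<Sum>i. measure (n t) (A i))" for t
          using finite_measure.finite_measure_UNION[OF fin, of A t] union by (auto simp: sets_n intro!: sums_unique)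
        then show ?case using union by simp
      qed auto
  qed
  then have "(\<lambda>t. measure (n t) A) \<in> borel_measurable borel"
    using A by (simp add: borel_eq_atMost)
  then have "(\<lambda>t. ennreal (measure (n t) A)) \<in> borel_measurable borel" by measurable
  also have "(\<lambda>t. ennreal (measure (n t) A)) = (\<lambda>t. emeasure (n t) A)"
    using fin by (simp add: finite_measure.emeasure_eq_measure)
  finally show ?thesis by (simp add: n_def)
qed

lemma cadlag_nn_integral_measurable:
  assumes "cadlag m" and m: "\<And>t. 0 \<le> t \<Longrightarrow> m t \<in> space finite_measures"
    and "g \<in> borel_measurable borel"
  shows "(\<lambda>t. \<integral>\<^sup>+x. g x \<partial>m (max 0 t)) \<in> borel_measurable borel"
  using assms(3)
proof (induction g rule: borel_measurable_induct)
  have sets_m[measurable_cong]: "sets (m (max 0 t)) = sets borel" for t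
    using m[of "max 0 t"] by (auto simp: space_finite_measures)
  have space_m: "space (m (max 0 t)) = UNIV" for t using sets_eq_imp_space_eq[OF sets_m] by simp
  {
    case (cong f g)
    then show ?case by simp
  next
    case (set A)
    then show ?case using cadlag_emeasure_measurable[OF assms(1,2)] by (simp add: sets_m)
  next
    case (mult u c)
    then show ?case by (simp add: nn_integral_cmult measurable_cong_sets[OF sets_m refl])
  next
    case (add u v)
    then show ?case by (simp add: nn_integral_add measurable_cong_sets[OF sets_m refl])
  next
    case (seq U)
    have "(\<integral>\<^sup>+x. (SUP i. U i) x \<partial>m (max 0 t)) = (SUP i. \<integral>\<^sup>+x. U i x \<partial>m (max 0 t))" for t
      unfolding SUP_apply using seq
      by (intro nn_integral_monotone_convergence_SUP) (auto simp: measurable_cong_sets[OF sets_m refl])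
    then show ?case using seq by simp
  }
qed

text \<open>An event detected by all sufficiently fine discretisations lies in this liminf, so a
  bound uniform in the mesh survives the limit even though the discretised events are not monotone.
  It serves for grids in time (absorption) and in space (variation).\<close>

lemma (in prob_space) prob_eventually_le:
  fixes E :: "nat \<Rightarrow> 'a set"
  assumes E: "\<And>n. E n \<in> events" "\<And>n. prob (E n) \<le> c"
  shows "(\<Union>K. \<Inter>n\<in>{K..}. E n) \<in> events" "prob (\<Union>K. \<Inter>n\<in>{K..}. E n) \<le> c"
proof -
  have "(\<Inter>n\<in>{K..}. E n) \<in> events" for K
    using E(1) by (intro sets.countable_INT') auto
  then show "(\<Union>K. \<Inter>n\<in>{K..}. E n) \<in> events"
    by (intro sets.countable_UN) auto
  show "prob (\<Union>K. \<Inter>n\<in>{K..}. E n) \<le> c"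
  proof (rule LIMSEQ_le_const2)
    show "(\<lambda>K. prob (\<Inter>n\<in>{K..}. E n)) \<longlonglongrightarrow> prob (\<Union>K. \<Inter>n\<in>{K..}. E n)"
      using E(1) by (intro finite_Lim_measure_incseq) (auto simp: incseq_def intro: order_trans)
    show "\<exists>N. \<forall>n\<ge>N. prob (\<Inter>k\<in>{n..}. E k) \<le> c"
    proof (intro exI allI impI)
      fix n
      have "prob (\<Inter>k\<in>{n..}. E k) \<le> prob (E n)" using E(1) by (intro finite_measure_mono) auto
      with E(2)[of n] show "prob (\<Inter>k\<in>{n..}. E k) \<le> c" by linarith
    qed
  qed
qed

section \<open>Extinction in finite time\<close>

locale super_brownian =
  fixes \<beta> :: real and \<Omega> :: "'w measure" and X :: "real \<Rightarrow> 'w \<Rightarrow> real measure" and P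
  assumes beta_pos: "0 < \<beta>" and sbm: "super_brownian_motion \<beta> \<Omega> X P"
begin

lemmas sbm_clauses = sbm[unfolded super_brownian_motion_def]

lemma prob_space_P: "\<mu> \<in> space finite_measures \<Longrightarrow> prob_space (P \<mu>)"
  and sets_P: "\<mu> \<in> space finite_measures \<Longrightarrow> sets (P \<mu>) = sets \<Omega>"
  using sbm_clauses[THEN conjunct1] by auto

lemma X_measurable: "0 \<le> t \<Longrightarrow> X t \<in> measurable \<Omega> finite_measures"
  using sbm_clauses[THEN conjunct2, THEN conjunct1] by auto

lemma X_cadlag: "\<omega> \<in> space \<Omega> \<Longrightarrow> cadlag (\<lambda>t. X t \<omega>)"
  using sbm_clauses[THEN conjunct2, THEN conjunct2, THEN conjunct1] by auto

lemma X_strong_markov: "strong_markov \<Omega> X P"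
  by (rule sbm_clauses[THEN conjunct2, THEN conjunct2, THEN conjunct2, THEN conjunct1])

lemma log_laplace:
  assumes "\<mu> \<in> space finite_measures" "0 \<le> t" "bounded_borel_nonneg \<phi>" "bounded_borel_nonneg f"
    "mild_solution \<beta> \<phi> f V"
  shows "(\<integral>\<omega>. exp (- (\<integral>x. \<phi> x \<partial>X t \<omega>) - (LBINT s:{0..t}. \<integral>x. f x \<partial>X s \<omega>)) \<partial>P \<mu>) = exp (- (\<integral>x. V t x \<partial>\<mu>))"
  by (rule sbm_clauses[THEN conjunct2, THEN conjunct2, THEN conjunct2, THEN conjunct2,
        THEN bspec, THEN spec[of _ t], THEN mp, THEN spec[of _ \<phi>], THEN spec[of _ f], THEN spec[of _ V], THEN mp])
    (use assms in auto)

lemma space_P: "\<mu> \<in> space finite_measures \<Longrightarrow> space (P \<mu>) = space \<Omega>"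
  using sets_eq_imp_space_eq[OF sets_P] .

lemma X_in_space: "0 \<le> t \<Longrightarrow> \<omega> \<in> space \<Omega> \<Longrightarrow> X t \<omega> \<in> space finite_measures"
  using measurable_space[OF X_measurable] .

lemma X_props:
  assumes "0 \<le> t" "\<omega> \<in> space \<Omega>"
  shows "finite_measure (X t \<omega>)" "sets (X t \<omega>) = sets borel" "space (X t \<omega>) = UNIV"
  using X_in_space[OF assms] sets_eq_imp_space_eq[of "X t \<omega>" borel]
  by (auto simp: space_finite_measures)

definition mass :: "real \<Rightarrow> 'w \<Rightarrow> real" where
  "mass t \<omega> = measure (X t \<omega>) UNIV"

lemma mass_nonneg: "0 \<le> mass t \<omega>"
  by (simp add: mass_def)

lemma emeasure_measurable_finite_measures:
  "A \<in> sets borel \<Longrightarrow> (\<lambda>\<mu>. emeasure \<mu> A) \<in> borel_measurable finite_measures"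
  unfolding finite_measures_def
proof (rule measurable_SUP1)
  assume "A \<in> sets borel"
  then show "A \<in> sets borel" .
  show "(\<lambda>\<mu>. emeasure \<mu> A) \<in>
    vimage_algebra {\<mu>. finite_measure \<mu> \<and> sets \<mu> = sets borel} (\<lambda>\<mu>. emeasure \<mu> A) borel \<rightarrow>\<^sub>M borel"
    by (rule measurable_vimage_algebra1) simp
qed simp

lemma measure_measurable_finite_measures:
  "A \<in> sets borel \<Longrightarrow> (\<lambda>\<mu>. measure \<mu> A) \<in> borel_measurable finite_measures"
  unfolding measure_def by (intro borel_measurable_enn2real emeasure_measurable_finite_measures)

lemma mass_measurable: "0 \<le> t \<Longrightarrow> mass t \<in> borel_measurable \<Omega>"
  unfolding mass_def[abs_def]
  by (rule measurable_compose[OF X_measurable measure_measurable_finite_measures]) auto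

lemma mass_right_continuous:
  assumes "\<omega> \<in> space \<Omega>" "0 \<le> t"
  shows "((\<lambda>s. mass s \<omega>) \<longlongrightarrow> mass t \<omega>) (at_right t)"
proof -
  have wt: "weakly_tendsto (\<lambda>s. X s \<omega>) (X t \<omega>) (at_right t)"
    using X_cadlag[OF assms(1)] assms(2) by (auto simp: cadlag_def)
  have const: "continuous_on UNIV (\<lambda>_::real. 1::real) \<and> bounded (range (\<lambda>_::real. 1::real))"
    by auto
  have lim: "((\<lambda>s. \<integral>x. (1::real) \<partial>X s \<omega>) \<longlongrightarrow> (\<integral>x. 1 \<partial>X t \<omega>)) (at_right t)"
    by (rule wt[unfolded weakly_tendsto_def, THEN spec[of _ "\<lambda>_. 1"], THEN mp, OF const])
  have e: "(\<integral>x. 1 \<partial>X s \<omega>) = mass s \<omega>" if "0 \<le> s" for s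
    by (simp add: mass_def X_props(3)[OF that assms(1)])
  have ev: "eventually (\<lambda>s. (\<integral>x. 1 \<partial>X s \<omega>) = mass s \<omega>) (at_right t)"
    using eventually_at_right_less[of t] by eventually_elim (use e assms in auto)
  show ?thesis
    by (rule Lim_transform_eventually[OF lim[unfolded e[OF assms(2)]] ev])
qed

lemma mass_laplace:
  assumes \<mu>: "\<mu> \<in> space finite_measures" and "0 \<le> t" "0 < \<theta>"
  shows "(\<integral>\<omega>. exp (- (\<theta> * mass t \<omega>)) \<partial>P \<mu>) =
    exp (- ((\<theta> powr (- \<beta>) + \<beta> * t) powr (- 1 / \<beta>) * measure \<mu> UNIV))"
proof -
  have "space \<mu> = UNIV" using \<mu> sets_eq_imp_space_eq[of \<mu> borel] by (auto simp: space_finite_measures)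
  have "(\<integral>\<omega>. exp (- (\<integral>x. \<theta> \<partial>X t \<omega>) - (LBINT s:{0..t}. \<integral>x. 0 \<partial>X s \<omega>)) \<partial>P \<mu>) =
    exp (- (\<integral>x. (\<theta> powr (- \<beta>) + \<beta> * t) powr (- 1 / \<beta>) \<partial>\<mu>))"
    using \<open>0 < \<theta>\<close> beta_pos
    by (intro log_laplace \<mu> \<open>0 \<le> t\<close> mild_solution_const) (auto simp: bounded_borel_nonneg_def)
  moreover have "(\<integral>\<omega>. exp (- (\<integral>x. \<theta> \<partial>X t \<omega>) - (LBINT s:{0..t}. \<integral>x. 0 \<partial>X s \<omega>)) \<partial>P \<mu>) =
      (\<integral>\<omega>. exp (- (\<theta> * mass t \<omega>)) \<partial>P \<mu>)"
    using \<open>0 \<le> t\<close>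
    by (intro Bochner_Integration.integral_cong refl) (simp add: space_P[OF \<mu>] mass_def X_props mult.commute)
  ultimately show ?thesis by (simp add: \<open>space \<mu> = UNIV\<close> mult.commute)
qed

text \<open>The solution started from \<theta> comes down from infinity: as \<theta> grows,
  \<theta>^(-\<beta>) tends to 0, and \<open>mass_laplace\<close> yields the lower bound exp(-
  (\<beta> n)^(-1/\<beta>) \<mu>(1)) for the probability that the mass is 0 at time n. This bound
  tends to 1 with n.\<close>

lemma AE_extinct:
  assumes \<mu>: "\<mu> \<in> space finite_measures"
  shows "AE \<omega> in P \<mu>. \<exists>n::nat. mass (real n) \<omega> = 0"
proof -
  interpret prob_space "P \<mu>" by (rule prob_space_P[OF \<mu>])
  have [measurable]: "mass t \<in> borel_measurable (P \<mu>)" if "0 \<le> t" for t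
    using mass_measurable[OF that] by (simp add: measurable_cong_sets[OF sets_P[OF \<mu>] refl])
  let ?c = "\<lambda>n. exp (- ((\<beta> * real n) powr (- 1 / \<beta>) * measure \<mu> UNIV))"
  have lower: "?c n \<le> prob {\<omega> \<in> space (P \<mu>). mass (real n) \<omega> = 0}" if "0 < n" for n
  proof (rule LIMSEQ_le_const)
    show "(\<lambda>k. \<integral>\<omega>. exp (- (real (Suc k) * mass (real n) \<omega>)) \<partial>P \<mu>) \<longlonglongrightarrow>
      prob {\<omega> \<in> space (P \<mu>). mass (real n) \<omega> = 0}"
    proof -
      have "(\<lambda>k. \<integral>\<omega>. exp (- (real (Suc k) * mass (real n) \<omega>)) \<partial>P \<mu>) \<longlonglongrightarrow>
        (\<integral>\<omega>. indicator {\<omega> \<in> space (P \<mu>). mass (real n) \<omega> = 0} \<omega> \<partial>P \<mu>)"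
      proof (rule integral_dominated_convergence[where w="\<lambda>_. 1"])
        show "AE \<omega> in P \<mu>. (\<lambda>k. exp (- (real (Suc k) * mass (real n) \<omega>))) \<longlonglongrightarrow>
          indicator {\<omega> \<in> space (P \<mu>). mass (real n) \<omega> = 0} \<omega>"
        proof (rule AE_I2)
          fix \<omega> assume \<omega>: "\<omega> \<in> space (P \<mu>)"
          show "(\<lambda>k. exp (- (real (Suc k) * mass (real n) \<omega>))) \<longlonglongrightarrow>
            indicator {\<omega> \<in> space (P \<mu>). mass (real n) \<omega> = 0} \<omega>"
          proof (cases "mass (real n) \<omega> = 0")
            case False
            then have "0 < mass (real n) \<omega>" using mass_nonneg[of "real n" \<omega>] by linarith
            moreover have "(\<lambda>k. exp (- (real (Suc k) * c))) \<longlonglongrightarrow> 0" if "0 < c" for c :: real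
              using that by real_asymp
            ultimately have "(\<lambda>k. exp (- (real (Suc k) * mass (real n) \<omega>))) \<longlonglongrightarrow> 0" by blast
            with False show ?thesis by simp
          qed (use \<omega> in simp)
        qed
      qed (auto intro!: mult_nonneg_nonneg mass_nonneg)
      then show ?thesis by simp
    qed
    show "\<exists>N. \<forall>k\<ge>N. ?c n \<le> (\<integral>\<omega>. exp (- (real (Suc k) * mass (real n) \<omega>)) \<partial>P \<mu>)"
    proof (intro exI allI impI)
      fix k
      have "(real (Suc k) powr - \<beta> + \<beta> * real n) powr (- 1 / \<beta>) \<le> (\<beta> * real n) powr (- 1 / \<beta>)"
        using beta_pos that by (intro powr_mono2') auto
      then show "?c n \<le> (\<integral>\<omega>. exp (- (real (Suc k) * mass (real n) \<omega>)) \<partial>P \<mu>)"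
        by (subst mass_laplace[OF \<mu>]) (auto intro!: mult_right_mono)
    qed
  qed
  have "1 \<le> prob {\<omega> \<in> space (P \<mu>). \<exists>n::nat. mass (real n) \<omega> = 0}"
  proof (rule LIMSEQ_le_const2)
    have "((\<lambda>n. exp (- ((\<beta> * real n) powr (- (1 / \<beta>)) * measure \<mu> UNIV))) \<longlongrightarrow> exp (- (0 * measure \<mu> UNIV))) sequentially"
    proof (intro tendsto_intros)
      show "(\<lambda>n. (\<beta> * real n) powr (- (1 / \<beta>))) \<longlonglongrightarrow> 0"
        using beta_pos by (intro tendsto_neg_powr) (auto intro!: filterlim_tendsto_pos_mult_at_top[OF tendsto_const] filterlim_real_sequentially)
    qed
    then show "?c \<longlonglongrightarrow> 1" by simp
    show "\<exists>N. \<forall>n\<ge>N. ?c n \<le> prob {\<omega> \<in> space (P \<mu>). \<exists>n::nat. mass (real n) \<omega> = 0}"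
    proof (intro exI[of _ 1] allI impI)
      fix n :: nat assume "1 \<le> n"
      then have "?c n \<le> prob {\<omega> \<in> space (P \<mu>). mass (real n) \<omega> = 0}" by (intro lower) simp
      also have "\<dots> \<le> prob {\<omega> \<in> space (P \<mu>). \<exists>n::nat. mass (real n) \<omega> = 0}"
        by (intro finite_measure_mono) auto
      finally show "?c n \<le> prob {\<omega> \<in> space (P \<mu>). \<exists>n::nat. mass (real n) \<omega> = 0}" .
    qed
  qed
  then have "prob {\<omega> \<in> space (P \<mu>). \<exists>n::nat. mass (real n) \<omega> = 0} = 1"
    using prob_le_1 by (simp add: antisym)
  then show ?thesis by (subst (asm) prob_Collect_eq_1) auto
qed

text \<open>A bounded function of the mass that vanishes exactly at extinction. Its mean is read off
  from \<open>mass_laplace\<close> with \<theta> = 1, so the supermartingale property follows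
  without a first moment of the mass.\<close>

definition damped_mass :: "real \<Rightarrow> 'w \<Rightarrow> real" where
  "damped_mass t \<omega> = 1 - exp (- mass t \<omega>)"

lemma damped_mass_bounds: "0 \<le> damped_mass t \<omega>" "damped_mass t \<omega> \<le> 1"
  by (auto simp: damped_mass_def mass_nonneg)

lemma damped_mass_eq_0_iff: "damped_mass t \<omega> = 0 \<longleftrightarrow> mass t \<omega> = 0"
  by (simp add: damped_mass_def)

lemma damped_mass_measurable: "0 \<le> t \<Longrightarrow> damped_mass t \<in> borel_measurable \<Omega>"
  unfolding damped_mass_def[abs_def] using mass_measurable by measurable

lemma damped_mass_integrable:
  assumes "\<mu> \<in> space finite_measures" "0 \<le> t"
  shows "integrable (P \<mu>) (damped_mass t)"
proof -
  interpret prob_space "P \<mu>" by (rule prob_space_P[OF assms(1)])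
  show ?thesis
    using damped_mass_measurable[OF assms(2)] damped_mass_bounds
    by (intro integrable_const_bound[where B=1]) (auto simp: measurable_cong_sets[OF sets_P[OF assms(1)] refl])
qed

lemma damped_mass_integral_le:
  assumes \<mu>: "\<mu> \<in> space finite_measures" and "0 \<le> t"
  shows "(\<integral>\<omega>. damped_mass t \<omega> \<partial>P \<mu>) \<le> 1 - exp (- measure \<mu> UNIV)"
proof -
  interpret prob_space "P \<mu>" by (rule prob_space_P[OF \<mu>])
  have "mass t \<in> borel_measurable (P \<mu>)"
    using mass_measurable[OF \<open>0 \<le> t\<close>] by (simp add: measurable_cong_sets[OF sets_P[OF \<mu>] refl])
  then have "integrable (P \<mu>) (\<lambda>\<omega>. exp (- mass t \<omega>))"
    by (intro integrable_const_bound[where B=1]) (auto simp: mass_nonneg)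
  then have "(\<integral>\<omega>. damped_mass t \<omega> \<partial>P \<mu>) = 1 - (\<integral>\<omega>. exp (- mass t \<omega>) \<partial>P \<mu>)"
    unfolding damped_mass_def by (simp add: prob_space)
  also have "\<dots> = 1 - exp (- ((1 powr (- \<beta>) + \<beta> * t) powr (- 1 / \<beta>) * measure \<mu> UNIV))"
    using mass_laplace[OF \<mu> \<open>0 \<le> t\<close>, of 1] by simp
  also have "\<dots> \<le> 1 - exp (- measure \<mu> UNIV)"
  proof -
    have "(1 + \<beta> * t) powr (- 1 / \<beta>) \<le> 1 powr (- 1 / \<beta>)"
      using beta_pos \<open>0 \<le> t\<close> by (intro powr_mono2') auto
    then have "(1 + \<beta> * t) powr (- 1 / \<beta>) * measure \<mu> UNIV \<le> 1 * measure \<mu> UNIV"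
      by (intro mult_right_mono) auto
    then show ?thesis by simp
  qed
  finally show ?thesis .
qed

section \<open>The supermartingale property and absorption at zero\<close>

abbreviation "past \<equiv> natural_filtration \<Omega> X"

lemma natural_filtration_generator: "{X s -` A \<inter> space \<Omega> | s A. 0 \<le> s \<and> s \<le> t \<and> A \<in> sets finite_measures} \<subseteq> Pow (space \<Omega>)"
  by auto

lemma space_past: "space (past t) = space \<Omega>"
  unfolding natural_filtration_def by (rule space_measure_of[OF natural_filtration_generator])

lemma sets_past:
  "sets (past t) = sigma_sets (space \<Omega>) {X s -` A \<inter> space \<Omega> | s A. 0 \<le> s \<and> s \<le> t \<and> A \<in> sets finite_measures}"
  unfolding natural_filtration_def by (rule sets_measure_of[OF natural_filtration_generator])

lemma sets_past_subset: "sets (past t) \<subseteq> sets \<Omega>"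
  unfolding sets_past using X_measurable by (intro sets.sigma_sets_subset) (auto intro: measurable_sets)

lemma filtration_past: "filtration (space \<Omega>) past"
proof
  fix i j :: real assume "i \<le> j"
  then show "sets (past i) \<le> sets (past j)"
    unfolding sets_past by (intro sigma_sets_mono') force
qed (rule space_past)

lemma damped_mass_past: "0 \<le> s \<Longrightarrow> s \<le> t \<Longrightarrow> damped_mass s \<in> borel_measurable (past t)"
proof -
  assume *: "0 \<le> s" "s \<le> t"
  have "X s \<in> measurable (past t) finite_measures"
  proof (rule measurableI)
    show "X s \<omega> \<in> space finite_measures" if "\<omega> \<in> space (past t)" for \<omega>
      using that * X_in_space by (simp add: space_past)
    show "X s -` A \<inter> space (past t) \<in> sets (past t)" if "A \<in> sets finite_measures" for A
      using * that unfolding sets_past space_past by (intro sigma_sets.Basic) auto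
  qed
  from measurable_compose[OF this measure_measurable_finite_measures, of UNIV]
  have "mass s \<in> borel_measurable (past t)" by (simp add: mass_def[abs_def])
  then show ?thesis unfolding damped_mass_def[abs_def] by measurable
qed

text \<open>The strong Markov property at the constant stopping time s, followed by
  \<open>damped_mass_integral_le\<close> for the process restarted from X s. It is stated on events
  of the past because \<open>damped_mass_crossing\<close> sums it over the disjoint first-passage
  events.\<close>

lemma damped_mass_supermartingale:
  assumes \<mu>: "\<mu> \<in> space finite_measures" and "0 \<le> s" "s \<le> t" and B: "B \<in> sets (past s)"
  shows "(\<integral>\<omega>. indicator B \<omega> * damped_mass t \<omega> \<partial>P \<mu>) \<le> (\<integral>\<omega>. indicator B \<omega> * damped_mass s \<omega> \<partial>P \<mu>)"
proof -
  interpret prob_space "P \<mu>" by (rule prob_space_P[OF \<mu>])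
  interpret filtration "space \<Omega>" past by (rule filtration_past)
  let ?F = "pre_sigma (\<lambda>_. s)"
  have st: "stopping_time past (\<lambda>_. s)" by (rule stopping_time_const)
  have BF: "B \<in> sets ?F"
  proof (rule sets_pre_sigmaI[OF st])
    show "{\<omega> \<in> B. s \<le> t} \<in> sets (past t)" for t
      using B sets_F_mono[of s t] by (cases "s \<le> t") auto
  qed
  have "sets ?F \<subseteq> sets (past s)"
    using sets_pre_sigmaD[OF st, of _ s] by auto
  then have sub: "subalgebra (P \<mu>) ?F"
    using sets_past_subset[of s] by (auto simp: subalgebra_def space_pre_sigma space_P[OF \<mu>] sets_P[OF \<mu>])
  interpret finite_measure_subalgebra "P \<mu>" ?F
    by unfold_locales (rule sub)
  define g where "g \<nu> = 1 - exp (- measure \<nu> UNIV)" for \<nu> :: "real measure"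
  have g: "g \<in> borel_measurable finite_measures"
    unfolding g_def using measure_measurable_finite_measures[of UNIV] by measurable
  have bg: "bounded (range g)"
    unfolding bounded_iff by (rule exI[of _ 1]) (auto simp: g_def)
  have gX: "g (X u \<omega>) = damped_mass u \<omega>" for u \<omega>
    by (simp add: g_def damped_mass_def mass_def)
  have "AE \<omega> in P \<mu>. real_cond_exp (P \<mu>) ?F (\<lambda>\<omega>'. g (X (s + (t - s)) \<omega>')) \<omega>
        = (\<integral>\<omega>'. g (X (t - s) \<omega>') \<partial>P (X s \<omega>))"
    by (rule X_strong_markov[unfolded strong_markov_def, THEN bspec, OF \<mu>, THEN spec[of _ "\<lambda>_. s"],
          THEN spec[of _ "t - s"], THEN mp, THEN spec[of _ g], THEN mp])
      (use assms(2,3) g bg st in auto)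
  then have ce: "AE \<omega> in P \<mu>. real_cond_exp (P \<mu>) ?F (damped_mass t) \<omega> \<le> damped_mass s \<omega>"
  proof (rule AE_mp, intro AE_I2 impI)
    fix \<omega> assume "\<omega> \<in> space (P \<mu>)"
      and eq: "real_cond_exp (P \<mu>) ?F (\<lambda>\<omega>'. g (X (s + (t - s)) \<omega>')) \<omega> = (\<integral>\<omega>'. g (X (t - s) \<omega>') \<partial>P (X s \<omega>))"
    then have "X s \<omega> \<in> space finite_measures"
      using X_in_space \<open>0 \<le> s\<close> by (simp add: space_P[OF \<mu>])
    then show "real_cond_exp (P \<mu>) ?F (damped_mass t) \<omega> \<le> damped_mass s \<omega>"
      using damped_mass_integral_le[of "X s \<omega>" "t - s"] \<open>s \<le> t\<close> eq[unfolded gX]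
      by (simp add: damped_mass_def[of s] mass_def)
  qed
  have Bs: "B \<in> sets (P \<mu>)" using B sets_past_subset by (auto simp: sets_P[OF \<mu>])
  have i: "integrable (P \<mu>) (damped_mass t)" "integrable (P \<mu>) (damped_mass s)"
    using damped_mass_integrable[OF \<mu>] assms by auto
  have "(\<integral>\<omega>. indicator B \<omega> * damped_mass t \<omega> \<partial>P \<mu>) = (\<integral>\<omega>. indicator B \<omega> * real_cond_exp (P \<mu>) ?F (damped_mass t) \<omega> \<partial>P \<mu>)"
    using real_cond_exp_intA[OF i(1) BF] by (simp add: set_lebesgue_integral_def)
  also have "\<dots> \<le> (\<integral>\<omega>. indicator B \<omega> * damped_mass s \<omega> \<partial>P \<mu>)"
  proof (rule integral_mono_AE)
    show "integrable (P \<mu>) (\<lambda>\<omega>. indicator B \<omega> * real_cond_exp (P \<mu>) ?F (damped_mass t) \<omega>)"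
      using integrable_mult_indicator[OF Bs real_cond_exp_int(1)[OF i(1)]] by simp
    show "integrable (P \<mu>) (\<lambda>\<omega>. indicator B \<omega> * damped_mass s \<omega>)"
      using integrable_mult_indicator[OF Bs i(2)] by simp
    show "AE \<omega> in P \<mu>. indicator B \<omega> * real_cond_exp (P \<mu>) ?F (damped_mass t) \<omega> \<le> indicator B \<omega> * damped_mass s \<omega>"
      using ce by eventually_elim (auto intro: mult_left_mono)
  qed
  finally show ?thesis .
qed

text \<open>Decompose according to the first index \<open>i\<close> with \<open>damped_mass (t i) < a\<close> and apply the
  supermartingale inequality between \<open>t i\<close> and \<open>q\<close>.\<close>

lemma damped_mass_crossing:
  fixes t :: "nat \<Rightarrow> real"
  assumes \<mu>: "\<mu> \<in> space finite_measures" and t: "\<And>i. i < N \<Longrightarrow> 0 \<le> t i \<and> t i \<le> q" "\<And>i j. i \<le> j \<Longrightarrow> t i \<le> t j"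
    and "0 < d" "0 \<le> q"
  shows "measure (P \<mu>) {\<omega> \<in> space \<Omega>. (\<exists>i<N. damped_mass (t i) \<omega> < a) \<and> d \<le> damped_mass q \<omega>} \<le> \<bar>a\<bar> / d"
proof -
  interpret prob_space "P \<mu>" by (rule prob_space_P[OF \<mu>])
  note [simp] = sets_P[OF \<mu>]
  have m: "damped_mass s \<in> borel_measurable \<Omega>" if "0 \<le> s" for s
    using damped_mass_measurable[OF that] .
  define B where "B i = {\<omega> \<in> space \<Omega>. damped_mass (t i) \<omega> < a \<and> (\<forall>j<i. \<not> damped_mass (t j) \<omega> < a)}" for i
  have B: "B i \<in> sets (past (t i))" if "i < N" for i
  proof -
    have "damped_mass (t j) \<in> borel_measurable (past (t i))" if "j \<le> i" for j
      using that \<open>i < N\<close> t by (intro damped_mass_past) auto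
    then have "{\<omega> \<in> space (past (t i)). damped_mass (t i) \<omega> < a \<and> (\<forall>j<i. \<not> damped_mass (t j) \<omega> < a)} \<in> sets (past (t i))"
      by (intro sets.sets_Collect_conj sets.sets_Collect_finite_All' sets.sets_Collect_neg) (auto simp: borel_measurable_iff_less)
    then show ?thesis by (simp add: B_def space_past)
  qed
  then have Bs: "B i \<in> sets \<Omega>" if "i < N" for i using sets_past_subset that by blast
  have disj: "disjoint_family_on B {..<N}"
    by (auto simp: disjoint_family_on_def B_def) (metis linorder_neqE_nat)
  let ?Q = "{\<omega> \<in> space \<Omega>. d \<le> damped_mass q \<omega>}"
  have Q: "?Q \<in> sets \<Omega>" using m[OF \<open>0 \<le> q\<close>] by measurable
  \<comment> \<open>On \<open>?Q\<close> the damped mass at q is at least d, on \<open>B i\<close>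
    the one at t i is below a. The absolute value covers a \<le> 0, where \<open>B i\<close> is
    empty.\<close>
  have one: "d * prob (B i \<inter> ?Q) \<le> \<bar>a\<bar> * prob (B i)" if "i < N" for i
  proof -
    have "d * prob (B i \<inter> ?Q) = (\<integral>\<omega>. indicator (B i \<inter> ?Q) \<omega> * d \<partial>P \<mu>)"
      using Bs[OF that] Q by simp
    also have "\<dots> \<le> (\<integral>\<omega>. indicator (B i) \<omega> * damped_mass q \<omega> \<partial>P \<mu>)"
    proof (rule integral_mono)
      show "integrable (P \<mu>) (\<lambda>\<omega>. indicator (B i \<inter> ?Q) \<omega> * d)"
        using Bs[OF that] Q by (intro integrable_mult_left integrable_real_indicator) (auto simp: less_top[symmetric])
      show "integrable (P \<mu>) (\<lambda>\<omega>. indicator (B i) \<omega> * damped_mass q \<omega>)"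
        using integrable_mult_indicator[OF _ damped_mass_integrable[OF \<mu> \<open>0 \<le> q\<close>], of "B i"] Bs[OF that] by simp
    qed (auto simp: indicator_def damped_mass_bounds)
    also have "\<dots> \<le> (\<integral>\<omega>. indicator (B i) \<omega> * damped_mass (t i) \<omega> \<partial>P \<mu>)"
      using t that by (intro damped_mass_supermartingale[OF \<mu> _ _ B]) auto
    also have "\<dots> \<le> (\<integral>\<omega>. indicator (B i) \<omega> * \<bar>a\<bar> \<partial>P \<mu>)"
    proof (rule integral_mono)
      show "integrable (P \<mu>) (\<lambda>\<omega>. indicator (B i) \<omega> * \<bar>a\<bar>)"
        using Bs[OF that] by (intro integrable_mult_left integrable_real_indicator) (auto simp: less_top[symmetric])
      show "integrable (P \<mu>) (\<lambda>\<omega>. indicator (B i) \<omega> * damped_mass (t i) \<omega>)"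
        using integrable_mult_indicator[OF _ damped_mass_integrable[OF \<mu>], of "B i" "t i"] Bs[OF that] t that by simp
    qed (auto simp: indicator_def B_def)
    also have "\<dots> = \<bar>a\<bar> * prob (B i)" using Bs[OF that] by simp
    finally show ?thesis .
  qed
  have "{\<omega> \<in> space \<Omega>. (\<exists>i<N. damped_mass (t i) \<omega> < a) \<and> d \<le> damped_mass q \<omega>} = (\<Union>i<N. B i \<inter> ?Q)"
  proof safe
    fix \<omega> i assume *: "\<omega> \<in> space \<Omega>" "i < N" "damped_mass (t i) \<omega> < a" "d \<le> damped_mass q \<omega>"
    define k where "k = (LEAST i. damped_mass (t i) \<omega> < a)"
    have "damped_mass (t k) \<omega> < a" "k \<le> i" "\<forall>j<k. \<not> damped_mass (t j) \<omega> < a"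
      using *(3) not_less_Least unfolding k_def by (auto intro: LeastI Least_le)
    with * show "\<omega> \<in> (\<Union>i<N. B i \<inter> ?Q)" by (auto simp: B_def intro!: bexI[of _ k])
  qed (auto simp: B_def)
  also have "d * prob \<dots> = (\<Sum>i<N. d * prob (B i \<inter> ?Q))"
    using disj Bs Q
    by (subst finite_measure_finite_Union) (auto simp: sum_distrib_left disjoint_family_on_def)
  also have "\<dots> \<le> (\<Sum>i<N. \<bar>a\<bar> * prob (B i))" by (intro sum_mono one) auto
  also have "\<dots> = \<bar>a\<bar> * prob (\<Union>i<N. B i)"
    using disj Bs by (subst finite_measure_finite_Union) (auto simp: sum_distrib_left)
  also have "\<dots> \<le> \<bar>a\<bar> * 1" by (intro mult_left_mono) auto
  finally show ?thesis using \<open>0 < d\<close> by (simp add: field_simps)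
qed

end

lemma grid_point_right_of:
  fixes s q \<eta> :: real
  assumes "0 \<le> s" "s < q" "0 < \<eta>"
  shows "eventually (\<lambda>N. \<exists>i<N. s \<le> real i * q / real N \<and> real i * q / real N < s + \<eta>) sequentially"
proof -
  define e where "e = min \<eta> (q - s)"
  have e: "0 < e" "e \<le> \<eta>" "e \<le> q - s" using assms by (auto simp: e_def)
  have "eventually (\<lambda>N. q / e < real N) sequentially"
    using filterlim_real_sequentially by (simp add: filterlim_at_top_dense)
  then show ?thesis
  proof eventually_elim
    case (elim N)
    have "0 < q / e" using assms e by simp
    with elim have N: "0 < real N" by linarith
    then have qN: "q / real N < e" using elim e by (simp add: field_simps)
    define i where "i = nat \<lceil>s * real N / q\<rceil>"
    have "0 \<le> s * real N / q" using assms by simp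
    then have i: "s * real N / q \<le> real i" "real i < s * real N / q + 1"
      unfolding i_def by linarith+
    have 1: "s \<le> real i * q / real N" using i(1) N assms by (simp add: field_simps)
    have "real i * q < (s * real N / q + 1) * q" using i(2) assms by (intro mult_strict_right_mono) auto
    also have "\<dots> = s * real N + q" using assms by (simp add: distrib_right)
    finally have "real i * q < s * real N + q" .
    then have "real i * q / real N < (s * real N + q) / real N" using N by (rule divide_strict_right_mono)
    then have 2: "real i * q / real N < s + q / real N" using N by (simp add: field_simps)
    with qN e have "real i * q / real N < q" by linarith
    then have "real i < real N" using N assms by (simp add: field_simps)
    then show ?case using 1 2 qN e by (intro exI[of _ i]) auto
  qed
qed

context super_brownian begin

text \<open>If the mass is 0 at s < q, right continuity keeps the damped mass below any given a > 0
  on some interval to the right of s, and every sufficiently fine grid of [0, q) meets that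
  interval. So the crossing bound a / d, which does not depend on the grid, applies to the limit
  event; then a tends to 0.\<close>

lemma damped_mass_stays_small:
  assumes \<mu>: "\<mu> \<in> space finite_measures" and "0 < q" "0 < d"
  shows "AE \<omega> in P \<mu>. (\<exists>s. 0 \<le> s \<and> s < q \<and> mass s \<omega> = 0) \<longrightarrow> damped_mass q \<omega> < d"
proof -
  interpret prob_space "P \<mu>" by (rule prob_space_P[OF \<mu>])
  note [simp] = sets_P[OF \<mu>]
  have m: "damped_mass s \<in> borel_measurable \<Omega>" if "0 \<le> s" for s
    using damped_mass_measurable[OF that] .
  define E where "E a N = {\<omega> \<in> space \<Omega>. (\<exists>i<N. damped_mass (real i * q / real N) \<omega> < a) \<and> d \<le> damped_mass q \<omega>}"
    for a and N :: nat
  have Em: "E a N \<in> sets \<Omega>" for a N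
  proof -
    have [measurable]: "damped_mass (real i * q / real N) \<in> borel_measurable \<Omega>" "damped_mass q \<in> borel_measurable \<Omega>" for i N :: nat
      using \<open>0 < q\<close> by (auto intro!: m)
    show ?thesis unfolding E_def by measurable
  qed
  have E: "prob (E a N) \<le> \<bar>a\<bar> / d" for a N
    unfolding E_def
  proof (rule damped_mass_crossing[OF \<mu> _ _ \<open>0 < d\<close> less_imp_le[OF \<open>0 < q\<close>]])
    fix i j :: nat
    show "0 \<le> real i * q / real N \<and> real i * q / real N \<le> q" if "i < N"
      using that \<open>0 < q\<close> mult_right_mono[of "real i" "real N" q] by (simp add: divide_le_eq mult.commute)
    show "real i * q / real N \<le> real j * q / real N" if "i \<le> j"
      using that \<open>0 < q\<close> by (intro divide_right_mono mult_right_mono) auto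
  qed
  define F where "F a = (\<Union>K. \<Inter>N\<in>{K..}. E a N)" for a
  have Fm: "F a \<in> sets \<Omega>" and F: "prob (F a) \<le> \<bar>a\<bar> / d" for a
    using prob_eventually_le[of "E a" "\<bar>a\<bar> / d"] Em E by (auto simp: F_def)
  define G where "G = (\<Inter>m. F (1 / real (Suc m)))"
  have Gm: "G \<in> sets \<Omega>" unfolding G_def using Fm by auto
  have "prob G \<le> 0"
  proof (rule LIMSEQ_le_const)
    show "(\<lambda>m. \<bar>1 / real (Suc m)\<bar> / d) \<longlonglongrightarrow> 0"
      using tendsto_divide[OF LIMSEQ_Suc[OF lim_1_over_n[where 'a=real]] tendsto_const[of d]] \<open>0 < d\<close> by simp
    show "\<exists>N. \<forall>m\<ge>N. prob G \<le> \<bar>1 / real (Suc m)\<bar> / d"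
    proof (intro exI allI impI)
      fix m
      have "prob G \<le> prob (F (1 / real (Suc m)))"
        using Fm by (intro finite_measure_mono) (auto simp: G_def)
      with F[of "1 / real (Suc m)"] show "prob G \<le> \<bar>1 / real (Suc m)\<bar> / d" by linarith
    qed
  qed
  then have "prob G = 0" by (simp add: measure_le_0_iff)
  then have "AE \<omega> in P \<mu>. \<omega> \<notin> G"
    using Gm by (intro AE_not_in) (auto simp: null_sets_def emeasure_eq_measure)
  then show ?thesis
  proof (rule AE_mp, intro AE_I2 impI)
    fix \<omega> assume \<omega>: "\<omega> \<in> space (P \<mu>)" and "\<omega> \<notin> G" "\<exists>s. 0 \<le> s \<and> s < q \<and> mass s \<omega> = 0"
    then obtain s where s: "0 \<le> s" "s < q" "mass s \<omega> = 0" by blast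
    have \<omega>': "\<omega> \<in> space \<Omega>" using \<omega> by (simp add: space_P[OF \<mu>])
    show "damped_mass q \<omega> < d"
    proof (rule ccontr)
      assume "\<not> damped_mass q \<omega> < d"
      have "\<omega> \<in> F a" if "0 < a" for a
      proof -
        have "((\<lambda>u. damped_mass u \<omega>) \<longlongrightarrow> 0) (at_right s)"
          using tendsto_diff[OF tendsto_const tendsto_exp[OF tendsto_minus[OF mass_right_continuous[OF \<omega>' s(1)]]], of 1] s
          by (simp add: damped_mass_def)
        then have "eventually (\<lambda>u. damped_mass u \<omega> < a) (at_right s)"
          using that by (rule order_tendstoD)
        then obtain b where b: "b > s" "\<And>u. s < u \<Longrightarrow> u < b \<Longrightarrow> damped_mass u \<omega> < a"
          by (auto simp: eventually_at_right[OF less_add_one])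
        have b': "damped_mass u \<omega> < a" if "s \<le> u" "u < s + (b - s)" for u
        proof (cases "u = s")
          case True then show ?thesis using s \<open>0 < a\<close> by (simp add: damped_mass_def)
        next
          case False then show ?thesis using that b by auto
        qed
        have "eventually (\<lambda>N. \<omega> \<in> E a N) sequentially"
          using grid_point_right_of[OF s(1,2), of "b - s", unfolded diff_gt_0_iff_gt, OF b(1)]
          proof eventually_elim
            case (elim N)
            then have "\<exists>i<N. damped_mass (real i * q / real N) \<omega> < a" using b' by blast
            with \<open>\<not> damped_mass q \<omega> < d\<close> show ?case by (simp add: E_def \<omega>')
          qed
        then show ?thesis by (auto simp: F_def eventually_sequentially)
      qed
      then show False using \<open>\<omega> \<notin> G\<close> by (auto simp: G_def)
    qed
  qed
qed

text \<open>Countably many q and thresholds suffice: positive mass at some t > s would, by right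
  continuity, persist up to a rational time after t. Absorption is what freezes the local time after
  the extinction time.\<close>

lemma AE_absorbed:
  assumes \<mu>: "\<mu> \<in> space finite_measures"
  shows "AE \<omega> in P \<mu>. \<forall>s t. 0 \<le> s \<longrightarrow> s < t \<longrightarrow> mass s \<omega> = 0 \<longrightarrow> mass t \<omega> = 0"
proof -
  have "AE \<omega> in P \<mu>. \<forall>k::nat. \<forall>q\<in>\<rat> \<inter> {0<..}. (\<exists>s. 0 \<le> s \<and> s < q \<and> mass s \<omega> = 0) \<longrightarrow> damped_mass q \<omega> < 1 / real (Suc k)"
    using damped_mass_stays_small[OF \<mu>]
    by (subst AE_all_countable, intro allI, subst AE_ball_countable) (auto intro: countable_Int1 countable_rat)
  then show ?thesis
  proof (rule AE_mp, intro AE_I2 impI allI)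
    fix \<omega> s t
    assume \<omega>: "\<omega> \<in> space (P \<mu>)"
      and *: "\<forall>k::nat. \<forall>q\<in>\<rat> \<inter> {0<..}. (\<exists>s. 0 \<le> s \<and> s < q \<and> mass s \<omega> = 0) \<longrightarrow> damped_mass q \<omega> < 1 / real (Suc k)"
      and s: "0 \<le> s" "s < t" "mass s \<omega> = 0"
    have \<omega>': "\<omega> \<in> space \<Omega>" using \<omega> by (simp add: space_P[OF \<mu>])
    have zero: "mass q \<omega> = 0" if "q \<in> \<rat>" "s < q" for q
    proof -
      have "damped_mass q \<omega> < 1 / real (Suc k)" for k
      proof -
        have "q \<in> \<rat> \<inter> {0<..}" "\<exists>s. 0 \<le> s \<and> s < q \<and> mass s \<omega> = 0" using that s by auto
        then show ?thesis using * by blast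
      qed
      then have "damped_mass q \<omega> \<le> 0"
        by (metis inverse_eq_divide linorder_not_le reals_Archimedean order_less_asym)
      then show ?thesis using damped_mass_bounds(1)[of q \<omega>] damped_mass_eq_0_iff by force
    qed
    show "mass t \<omega> = 0"
    proof (rule ccontr)
      assume "mass t \<omega> \<noteq> 0"
      then have "0 < mass t \<omega>" using mass_nonneg[of t \<omega>] by linarith
      then have "eventually (\<lambda>u. 0 < mass u \<omega>) (at_right t)"
        using mass_right_continuous[OF \<omega>', of t] s by (intro order_tendstoD) auto
      then obtain b where b: "b > t" "\<And>u. t < u \<Longrightarrow> u < b \<Longrightarrow> 0 < mass u \<omega>"
        by (auto simp: eventually_at_right[OF less_add_one])
      obtain u where "u \<in> \<rat>" "t < u" "u < b" using Rats_dense_in_real[OF b(1)] by auto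
      with b(2)[of u] zero[of u] s show False by simp
    qed
  qed
qed

section \<open>Occupation integrals and the local time after extinction\<close>

lemma nn_integral_extinct:
  assumes "\<omega> \<in> space \<Omega>" "0 \<le> s" "mass s \<omega> = 0"
  shows "(\<integral>\<^sup>+x. g x \<partial>X s \<omega>) = 0"
proof -
  interpret finite_measure "X s \<omega>" using X_props[OF assms(2,1)] by simp
  have "AE x in X s \<omega>. g x = 0"
    using assms by (intro AE_I[where N="space (X s \<omega>)"]) (auto simp: emeasure_eq_measure mass_def X_props)
  then have "(\<integral>\<^sup>+x. g x \<partial>X s \<omega>) = (\<integral>\<^sup>+x. 0 \<partial>X s \<omega>)" by (intro nn_integral_cong_AE)
  then show ?thesis by simp
qed

lemma integral_extinct:
  fixes g :: "real \<Rightarrow> real"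
  assumes "\<omega> \<in> space \<Omega>" "0 \<le> s" "mass s \<omega> = 0"
  shows "(\<integral>x. g x \<partial>X s \<omega>) = 0"
proof -
  interpret finite_measure "X s \<omega>" using X_props[OF assms(2,1)] by simp
  have "AE x in X s \<omega>. g x = 0"
    using assms by (intro AE_I[where N="space (X s \<omega>)"]) (auto simp: emeasure_eq_measure mass_def X_props)
  then show ?thesis by (rule integral_eq_zero_AE)
qed

text \<open>This bridges two conventions: the log-Laplace functional is written with Bochner
  integrals, the defining identity of the local time with extended nonnegative ones. Since f is
  bounded and every X s is finite, the inner integrals are finite and \<open>enn2real\<close> loses
  nothing.\<close>

lemma occupation_integral:
  assumes \<omega>: "\<omega> \<in> space \<Omega>" and "0 \<le> t"
    and f: "f \<in> borel_measurable borel" "\<And>x. 0 \<le> f x" "\<And>x. f x \<le> K"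
    and l: "l \<in> borel_measurable borel" "\<And>x. 0 \<le> l x"
    and occ: "(\<integral>\<^sup>+s\<in>{0..t}. (\<integral>\<^sup>+x. ennreal (f x) \<partial>X s \<omega>) \<partial>lborel) = (\<integral>\<^sup>+x. ennreal (f x) * ennreal (l x) \<partial>lborel)"
  shows "(LBINT s:{0..t}. \<integral>x. f x \<partial>X s \<omega>) = (\<integral>x. f x * l x \<partial>lborel)"
proof -
  have fin: "(\<integral>\<^sup>+x. ennreal (f x) \<partial>X s \<omega>) < \<infinity>" if "0 \<le> s" for s
  proof -
    interpret finite_measure "X s \<omega>" using X_props[OF that \<omega>] by simp
    have "(\<integral>\<^sup>+x. ennreal (f x) \<partial>X s \<omega>) \<le> (\<integral>\<^sup>+x. ennreal K \<partial>X s \<omega>)"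
      using f by (intro nn_integral_mono ennreal_leI) auto
    also have "\<dots> < \<infinity>"
      by (auto simp: less_top[symmetric] ennreal_mult_eq_top_iff)
    finally show ?thesis .
  qed
  have 1: "(\<integral>x. f x \<partial>X s \<omega>) = enn2real (\<integral>\<^sup>+x. ennreal (f x) \<partial>X s \<omega>)" if "0 \<le> s" for s
    using f by (intro integral_eq_nn_integral) (simp_all add: measurable_cong_sets[OF X_props(2)[OF that \<omega>] refl])
  have [measurable]: "(\<lambda>s. \<integral>\<^sup>+x. ennreal (f x) \<partial>X (max 0 s) \<omega>) \<in> borel_measurable borel"
    using f X_in_space \<omega> by (intro cadlag_nn_integral_measurable[OF X_cadlag[OF \<omega>]]) auto
  have "(LBINT s:{0..t}. \<integral>x. f x \<partial>X s \<omega>) =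
      (\<integral>s. indicator {0..t} s * enn2real (\<integral>\<^sup>+x. ennreal (f x) \<partial>X (max 0 s) \<omega>) \<partial>lborel)"
    unfolding set_lebesgue_integral_def
    by (intro Bochner_Integration.integral_cong refl) (auto simp: indicator_def 1 max_def)
  also have "\<dots> = enn2real (\<integral>\<^sup>+s. ennreal (indicator {0..t} s * enn2real (\<integral>\<^sup>+x. ennreal (f x) \<partial>X (max 0 s) \<omega>)) \<partial>lborel)"
    by (intro integral_eq_nn_integral) auto
  also have "(\<integral>\<^sup>+s. ennreal (indicator {0..t} s * enn2real (\<integral>\<^sup>+x. ennreal (f x) \<partial>X (max 0 s) \<omega>)) \<partial>lborel)
    = (\<integral>\<^sup>+s\<in>{0..t}. (\<integral>\<^sup>+x. ennreal (f x) \<partial>X s \<omega>) \<partial>lborel)"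
    using fin by (intro nn_integral_cong) (auto simp: indicator_def max_def)
  also have "\<dots> = (\<integral>\<^sup>+x. ennreal (f x * l x) \<partial>lborel)"
    unfolding occ using f l by (simp add: ennreal_mult)
  also have "enn2real \<dots> = (\<integral>x. f x * l x \<partial>lborel)"
    using f l by (intro integral_eq_nn_integral[symmetric]) auto
  finally show ?thesis .
qed

text \<open>After the extinction time \<zeta> the occupation measure stops growing, so L t and L
  \<zeta> are densities of one measure; they agree almost everywhere and, being continuous,
  everywhere. The random time \<zeta> can therefore be replaced by any large integer.\<close>

lemma local_time_after_extinction:
  assumes \<omega>: "\<omega> \<in> space \<Omega>" and ext: "mass (real m) \<omega> = 0"
    and abs: "\<And>s t. 0 \<le> s \<Longrightarrow> s < t \<Longrightarrow> mass s \<omega> = 0 \<Longrightarrow> mass t \<omega> = 0"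
    and cont: "continuous_on ({0..} \<times> UNIV) (\<lambda>(t, x). L t x \<omega>)"
    and nonneg: "\<And>t x. 0 \<le> t \<Longrightarrow> 0 \<le> L t x \<omega>"
    and occ: "\<And>t \<phi>. 0 \<le> t \<Longrightarrow> \<phi> \<in> borel_measurable borel \<Longrightarrow>
        (\<integral>\<^sup>+s\<in>{0..t}. (\<integral>\<^sup>+x. \<phi> x \<partial>X s \<omega>) \<partial>lborel) = (\<integral>\<^sup>+x. \<phi> x * ennreal (L t x \<omega>) \<partial>lborel)"
  shows "continuous_on UNIV (total_local_time X L \<omega>)" "0 \<le> total_local_time X L \<omega> x"
    and "eventually (\<lambda>n::nat. mass (real n) \<omega> = 0 \<and> (\<forall>x. L (real n) x \<omega> = total_local_time X L \<omega> x)) sequentially"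
proof -
  define \<zeta> where "\<zeta> = extinction_time X \<omega>"
  have \<zeta>: "\<zeta> = Inf {t. 0 \<le> t \<and> mass t \<omega> = 0}"
    by (simp add: \<zeta>_def extinction_time_def mass_def)
  have ne: "{t. 0 \<le> t \<and> mass t \<omega> = 0} \<noteq> {}" using ext by (auto intro!: exI[of _ "real m"])
  have "0 \<le> \<zeta>" unfolding \<zeta> using ne by (intro cInf_greatest) auto
  have zero: "mass t \<omega> = 0" if "\<zeta> < t" for t
    using cInf_lessD[OF ne that[unfolded \<zeta>]] abs by auto
  have cont_L: "continuous_on UNIV (\<lambda>x. L t x \<omega>)" if "0 \<le> t" for t
  proof -
    have "continuous_on UNIV (\<lambda>x. (\<lambda>(t, x). L t x \<omega>) (t, x))"
      by (rule continuous_on_compose2[OF cont]) (use that in \<open>auto intro!: continuous_intros\<close>)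
    then show ?thesis by simp
  qed
  then show "continuous_on UNIV (total_local_time X L \<omega>)" "0 \<le> total_local_time X L \<omega> x"
    using nonneg \<open>0 \<le> \<zeta>\<close> by (auto simp: total_local_time_def[abs_def] \<zeta>_def)
  have eq: "L t x \<omega> = L \<zeta> x \<omega>" if "\<zeta> \<le> t" for t x
  proof -
    have meas: "(\<lambda>x. L u x \<omega>) \<in> borel_measurable borel" if "0 \<le> u" for u
      using cont_L[OF that] by (rule borel_measurable_continuous_onI)
    have "AE x in lborel. ennreal (L t x \<omega>) = ennreal (L \<zeta> x \<omega>)"
    proof (rule sigma_finite_measure.density_unique2[OF sigma_finite_lborel])
      fix A :: "real set" assume "A \<in> sets lborel"
      then have A: "(indicator A :: real \<Rightarrow> ennreal) \<in> borel_measurable borel" by simp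
      have "(\<integral>\<^sup>+x\<in>A. ennreal (L t x \<omega>) \<partial>lborel) = (\<integral>\<^sup>+s\<in>{0..t}. (\<integral>\<^sup>+x. indicator A x \<partial>X s \<omega>) \<partial>lborel)"
        using occ[OF _ A, of t] \<open>0 \<le> \<zeta>\<close> that by (simp add: mult.commute)
      also have "\<dots> = (\<integral>\<^sup>+s\<in>{0..\<zeta>}. (\<integral>\<^sup>+x. indicator A x \<partial>X s \<omega>) \<partial>lborel)"
        using nn_integral_extinct[OF \<omega>, of _ "indicator A"] zero that \<open>0 \<le> \<zeta>\<close>
        by (intro nn_integral_cong) (auto simp: indicator_def)
      also have "\<dots> = (\<integral>\<^sup>+x\<in>A. ennreal (L \<zeta> x \<omega>) \<partial>lborel)"
        using occ[OF \<open>0 \<le> \<zeta>\<close> A] by (simp add: mult.commute)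
      finally show "(\<integral>\<^sup>+x\<in>A. ennreal (L t x \<omega>) \<partial>lborel) = (\<integral>\<^sup>+x\<in>A. ennreal (L \<zeta> x \<omega>) \<partial>lborel)" .
    qed (use meas \<open>0 \<le> \<zeta>\<close> that in auto)
    then have "AE x in lborel. L t x \<omega> = L \<zeta> x \<omega>"
    proof eventually_elim
      case (elim x)
      have "0 \<le> L t x \<omega>" "0 \<le> L \<zeta> x \<omega>"
        using \<open>0 \<le> \<zeta>\<close> that by (auto intro: nonneg)
      with elim show ?case by (simp add: ennreal_inj)
    qed
    then have "(\<lambda>x. L t x \<omega>) = (\<lambda>x. L \<zeta> x \<omega>)"
      by (rule AE_lborel_eq_continuous[OF cont_L cont_L, rotated 2]) (use \<open>0 \<le> \<zeta>\<close> that in auto)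
    then show ?thesis by (simp add: fun_eq_iff)
  qed
  have "eventually (\<lambda>n. \<zeta> < real n) sequentially"
    using filterlim_real_sequentially by (simp add: filterlim_at_top_dense)
  then show "eventually (\<lambda>n::nat. mass (real n) \<omega> = 0 \<and> (\<forall>x. L (real n) x \<omega> = total_local_time X L \<omega> x)) sequentially"
  proof eventually_elim
    case (elim n)
    have "mass (real n) \<omega> = 0" "L (real n) x \<omega> = L \<zeta> x \<omega>" for x
      using zero[OF elim] eq[OF less_imp_le[OF elim], of x] by auto
    then show ?case by (simp add: total_local_time_def \<zeta>_def)
  qed
qed

text \<open>The total local time is modified on a null set so that its regularity holds everywhere.\<close>

lemma total_local_time_version:
  assumes \<mu>: "\<mu> \<in> space finite_measures" and L: "local_time (P \<mu>) X L"
    and supp: "AE \<omega> in P \<mu>. {x. total_local_time X L \<omega> x > 0} = {lft \<omega><..<rgt \<omega>}"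
  obtains \<Lambda> where "\<And>x. \<Lambda> x \<in> borel_measurable (P \<mu>)"
    and "\<And>\<omega>. continuous_on UNIV (\<lambda>x. \<Lambda> x \<omega>)"
    and "\<And>\<omega> x. 0 \<le> \<Lambda> x \<omega>"
    and "\<And>\<omega> x. \<Lambda> x \<omega> \<noteq> 0 \<Longrightarrow> lft \<omega> < x \<and> x < rgt \<omega>"
    and "AE \<omega> in P \<mu>. (\<lambda>x. \<Lambda> x \<omega>) = total_local_time X L \<omega>"
    and "AE \<omega> in P \<mu>. eventually (\<lambda>n::nat. mass (real n) \<omega> = 0 \<and>
      (\<forall>f K. f \<in> borel_measurable borel \<longrightarrow> (\<forall>x. 0 \<le> f x \<and> f x \<le> K) \<longrightarrow>
        (LBINT s:{0..real n}. \<integral>x. f x \<partial>X s \<omega>) = (\<integral>x. f x * \<Lambda> x \<omega> \<partial>lborel))) sequentially"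
proof -
  let ?T = "\<lambda>\<omega>. total_local_time X L \<omega>"
  let ?good = "\<lambda>\<omega>. (\<exists>n::nat. mass (real n) \<omega> = 0) \<and> (\<forall>s t. 0 \<le> s \<longrightarrow> s < t \<longrightarrow> mass s \<omega> = 0 \<longrightarrow> mass t \<omega> = 0) \<and>
    (continuous_on ({0..} \<times> UNIV) (\<lambda>(t, x). L t x \<omega>) \<and> (\<forall>t\<ge>0. \<forall>x. 0 \<le> L t x \<omega>) \<and>
      (\<forall>t\<ge>0. \<forall>\<phi> \<in> borel_measurable borel.
        (\<integral>\<^sup>+s\<in>{0..t}. (\<integral>\<^sup>+x. \<phi> x \<partial>X s \<omega>) \<partial>lborel) = (\<integral>\<^sup>+x. \<phi> x * ennreal (L t x \<omega>) \<partial>lborel))) \<and>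
    {x. ?T \<omega> x > 0} = {lft \<omega><..<rgt \<omega>}"
  have "AE \<omega> in P \<mu>. ?good \<omega>"
    using AE_extinct[OF \<mu>] AE_absorbed[OF \<mu>] L[unfolded local_time_def, THEN conjunct2] supp
    by eventually_elim simp
  then obtain N where N: "{\<omega> \<in> space (P \<mu>). \<not> ?good \<omega>} \<subseteq> N" "emeasure (P \<mu>) N = 0" "N \<in> sets (P \<mu>)"
    by (rule AE_E)
  have good: "?good \<omega>" if "\<omega> \<in> space (P \<mu>) - N" for \<omega>
    using that N(1) by blast
  have ev: "continuous_on UNIV (?T \<omega>)" "\<And>x. 0 \<le> ?T \<omega> x"
    "eventually (\<lambda>n::nat. mass (real n) \<omega> = 0 \<and> (\<forall>x. L (real n) x \<omega> = ?T \<omega> x)) sequentially"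
    if dom: "\<omega> \<in> space (P \<mu>) - N" for \<omega>
  proof -
    note g = good[OF dom]
    from g obtain m where m: "mass (real m) \<omega> = 0" by blast
    have \<omega>: "\<omega> \<in> space \<Omega>" using dom by (simp add: space_P[OF \<mu>])
    note * = local_time_after_extinction[OF \<omega> m, of L]
    show "continuous_on UNIV (?T \<omega>)" "\<And>x. 0 \<le> ?T \<omega> x"
      "eventually (\<lambda>n::nat. mass (real n) \<omega> = 0 \<and> (\<forall>x. L (real n) x \<omega> = ?T \<omega> x)) sequentially"
      by (rule *; use g in simp)+
  qed
  define \<Lambda> where "\<Lambda> x \<omega> = (if \<omega> \<in> space (P \<mu>) - N then ?T \<omega> x else 0)" for x \<omega>
  have AE_N: "AE \<omega> in P \<mu>. \<omega> \<in> space (P \<mu>) - N"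
  proof -
    have "AE \<omega> in P \<mu>. \<omega> \<notin> N" using N by (intro AE_not_in) (auto simp: null_sets_def)
    with AE_space show ?thesis by eventually_elim simp
  qed
  show thesis
  proof (rule that)
    fix x
    \<comment> \<open>The total local time evaluates L at a random time. It is measurable because L
      n x is eventually constant in n, so that it equals a limit of measurable functions off the
      null set N.\<close>
    have "(\<lambda>\<omega>. if \<omega> \<in> space (P \<mu>) - N then lim (\<lambda>n. L (real n) x \<omega>) else 0) \<in> borel_measurable (P \<mu>)"
      using N(3) L unfolding local_time_def
      by (intro measurable_If borel_measurable_lim_metric) auto
    also have "?this \<longleftrightarrow> \<Lambda> x \<in> borel_measurable (P \<mu>)"
    proof (rule measurable_cong)
      fix \<omega> assume "\<omega> \<in> space (P \<mu>)"
      have "lim (\<lambda>n. L (real n) x \<omega>) = ?T \<omega> x" if "\<omega> \<in> space (P \<mu>) - N"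
        by (rule limI, rule tendsto_eventually) (use ev(3)[OF that] in \<open>auto elim: eventually_mono\<close>)
      then show "(if \<omega> \<in> space (P \<mu>) - N then lim (\<lambda>n. L (real n) x \<omega>) else 0) = \<Lambda> x \<omega>"
        by (simp add: \<Lambda>_def)
    qed
    finally show "\<Lambda> x \<in> borel_measurable (P \<mu>)" .
  next
    show "continuous_on UNIV (\<lambda>x. \<Lambda> x \<omega>)" for \<omega>
    proof (cases "\<omega> \<in> space (P \<mu>) - N")
      case True
      then have "(\<lambda>x. \<Lambda> x \<omega>) = ?T \<omega>" by (simp add: \<Lambda>_def)
      then show ?thesis using ev(1)[OF True] by (simp only:)
    next
      case False
      then have "(\<lambda>x. \<Lambda> x \<omega>) = (\<lambda>x. 0)" by (auto simp: \<Lambda>_def)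
      then show ?thesis by (simp only: continuous_on_const)
    qed
    show nn: "0 \<le> \<Lambda> x \<omega>" for x \<omega>
      using ev(2)[of \<omega> x] by (simp add: \<Lambda>_def)
    show "lft \<omega> < x \<and> x < rgt \<omega>" if "\<Lambda> x \<omega> \<noteq> 0" for \<omega> x
    proof -
      have *: "\<omega> \<in> space (P \<mu>) - N" "?T \<omega> x \<noteq> 0"
        using that by (auto simp: \<Lambda>_def split: if_splits)
      then have "x \<in> {x. ?T \<omega> x > 0}" using ev(2)[of \<omega> x] by simp
      then show ?thesis using good[OF *(1)] by simp
    qed
    show "AE \<omega> in P \<mu>. (\<lambda>x. \<Lambda> x \<omega>) = ?T \<omega>"
      using AE_N by eventually_elim (simp add: \<Lambda>_def)
    show "AE \<omega> in P \<mu>. eventually (\<lambda>n::nat. mass (real n) \<omega> = 0 \<and>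
      (\<forall>f K. f \<in> borel_measurable borel \<longrightarrow> (\<forall>x. 0 \<le> f x \<and> f x \<le> K) \<longrightarrow>
        (LBINT s:{0..real n}. \<integral>x. f x \<partial>X s \<omega>) = (\<integral>x. f x * \<Lambda> x \<omega> \<partial>lborel))) sequentially"
      using AE_N
    proof eventually_elim
      case (elim \<omega>)
      have \<omega>: "\<omega> \<in> space \<Omega>" using elim by (simp add: space_P[OF \<mu>])
      show ?case
        using ev(3)[OF elim]
      proof eventually_elim
        case (elim n)
        have eqL: "\<Lambda> x \<omega> = L (real n) x \<omega>" for x using elim \<open>\<omega> \<in> space (P \<mu>) - N\<close> by (simp add: \<Lambda>_def)
        have "(LBINT s:{0..real n}. \<integral>x. f x \<partial>X s \<omega>) = (\<integral>x. f x * \<Lambda> x \<omega> \<partial>lborel)"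
          if f: "f \<in> borel_measurable borel" "\<forall>x. 0 \<le> f x \<and> f x \<le> K" for f :: "real \<Rightarrow> real" and K
        proof (rule occupation_integral[OF \<omega> _ f(1), where K=K])
          have "(\<lambda>x. \<Lambda> x \<omega>) = ?T \<omega>" using \<open>\<omega> \<in> space (P \<mu>) - N\<close> by (simp add: \<Lambda>_def)
          then show "(\<lambda>x. \<Lambda> x \<omega>) \<in> borel_measurable borel"
            using ev(1)[OF \<open>\<omega> \<in> space (P \<mu>) - N\<close>] by (simp add: borel_measurable_continuous_onI)
          have "(\<lambda>x. ennreal (f x)) \<in> borel_measurable borel" using f(1) by measurable
          then show "(\<integral>\<^sup>+s\<in>{0..real n}. (\<integral>\<^sup>+x. ennreal (f x) \<partial>X s \<omega>) \<partial>lborel) = (\<integral>\<^sup>+x. ennreal (f x) * ennreal (\<Lambda> x \<omega>) \<partial>lborel)"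
            using good[OF \<open>\<omega> \<in> space (P \<mu>) - N\<close>] unfolding eqL by simp
        qed (use f nn in auto)
        then show ?case using elim by blast
      qed
    qed
  qed
qed

end

section \<open>Exact Laplace transforms of the total local time\<close>

text \<open>The class is tailored to gluing: U2 may jump at finitely many points, and U1 is hidden
  because only U and its second derivative enter the potential. Differentiability of U at the
  junctions is not demanded; it follows from the continuity of U1.\<close>

definition bounded_C11 :: "(real \<Rightarrow> real) \<Rightarrow> (real \<Rightarrow> real) \<Rightarrow> bool" where
  "bounded_C11 U U2 \<longleftrightarrow> (\<exists>S U1 K. finite S \<and> continuous_on UNIV U \<and> continuous_on UNIV U1 \<and>
     (\<forall>y. y \<notin> S \<longrightarrow> (U has_real_derivative U1 y) (at y) \<and> (U1 has_real_derivative U2 y) (at y)) \<and>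
     U2 \<in> borel_measurable borel \<and> (\<forall>y. \<bar>U y\<bar> \<le> K \<and> \<bar>U1 y\<bar> \<le> K \<and> \<bar>U2 y\<bar> \<le> K))"

lemma bounded_C11I:
  assumes "finite S" "continuous_on UNIV U" "continuous_on UNIV U1"
    "\<And>y. y \<notin> S \<Longrightarrow> (U has_real_derivative U1 y) (at y)" "\<And>y. y \<notin> S \<Longrightarrow> (U1 has_real_derivative U2 y) (at y)"
    "U2 \<in> borel_measurable borel" "\<And>y. \<bar>U y\<bar> \<le> K0" "\<And>y. \<bar>U1 y\<bar> \<le> K1" "\<And>y. \<bar>U2 y\<bar> \<le> K2"
  shows "bounded_C11 U U2"
  unfolding bounded_C11_def
  by (rule exI[of _ S], rule exI[of _ U1], rule exI[of _ "max K0 (max K1 K2)"])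
    (use assms in \<open>auto simp: le_max_iff_disj\<close>)

text \<open>Across the finitely many exceptional points U is still the integral of the continuous
  function U1, so the derivative exists there too. This spares the glued functions a check at every
  junction.\<close>

lemma has_real_derivative_removable:
  fixes U U1 :: "real \<Rightarrow> real"
  assumes "finite S" "continuous_on UNIV U" "continuous_on UNIV U1"
    and "\<And>y. y \<notin> S \<Longrightarrow> (U has_real_derivative U1 y) (at y)"
  shows "(U has_real_derivative U1 y) (at y)"
proof -
  have I: "integral {y - 1..z} U1 = U z - U (y - 1)" if "y - 1 \<le> z" for z
    using assms that
    by (intro integral_unique fundamental_theorem_of_calculus_interior_strong[OF assms(1)])
      (auto simp: has_real_derivative_iff_has_vector_derivative intro: continuous_on_subset)
  have "((\<lambda>z. integral {y - 1..z} U1) has_real_derivative U1 y) (at y within {y - 1..y + 1})"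
    using assms(3) by (intro integral_has_real_derivative) (auto intro: continuous_on_subset)
  then have "((\<lambda>z. integral {y - 1..z} U1) has_real_derivative U1 y) (at y within {y - 1<..<y + 1})"
    by (rule DERIV_subset) auto
  then have "((\<lambda>z. integral {y - 1..z} U1) has_real_derivative U1 y) (at y)"
    by (subst (asm) at_within_open) auto
  from DERIV_add[OF this DERIV_const[of "U (y - 1)"]]
  have "((\<lambda>z. integral {y - 1..z} U1 + U (y - 1)) has_real_derivative U1 y) (at y)" by simp
  then show ?thesis
    by (rule has_field_derivative_transform_within_open[where S="{y - 1<..<y + 1}"]) (auto simp: I)
qed

lemma bounded_C11E:
  assumes "bounded_C11 U U2"
  obtains S U1 K where "finite S" "\<And>y. (U has_real_derivative U1 y) (at y)"
    "\<And>y. y \<notin> S \<Longrightarrow> (U1 has_real_derivative U2 y) (at y)" "continuous_on UNIV U1" "U2 \<in> borel_measurable borel"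
    "\<And>y. \<bar>U y\<bar> \<le> K" "\<And>y. \<bar>U1 y\<bar> \<le> K" "\<And>y. \<bar>U2 y\<bar> \<le> K"
proof -
  from assms obtain S U1 K where *: "finite S" "continuous_on UNIV U" "continuous_on UNIV U1"
     "\<And>y. y \<notin> S \<Longrightarrow> (U has_real_derivative U1 y) (at y) \<and> (U1 has_real_derivative U2 y) (at y)"
     "U2 \<in> borel_measurable borel" "\<And>y. \<bar>U y\<bar> \<le> K \<and> \<bar>U1 y\<bar> \<le> K \<and> \<bar>U2 y\<bar> \<le> K"
    unfolding bounded_C11_def by blast
  show thesis
  proof (rule that[OF *(1)])
    show "(U has_real_derivative U1 y) (at y)" for y
      using has_real_derivative_removable[OF *(1-3)] *(4) by blast
  qed (use * in auto)
qed

lemma bounded_C11_add_mult: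
  assumes "bounded_C11 U U2" "bounded_C11 w w2"
  shows "bounded_C11 (\<lambda>y. U y + c * w y) (\<lambda>y. U2 y + c * w2 y)"
proof -
  obtain S U1 K where U: "finite S" "\<And>y. (U has_real_derivative U1 y) (at y)"
    "\<And>y. y \<notin> S \<Longrightarrow> (U1 has_real_derivative U2 y) (at y)" "continuous_on UNIV U1" "U2 \<in> borel_measurable borel"
    "\<And>y. \<bar>U y\<bar> \<le> K" "\<And>y. \<bar>U1 y\<bar> \<le> K" "\<And>y. \<bar>U2 y\<bar> \<le> K"
    using bounded_C11E[OF assms(1)] by metis
  obtain T w1 J where w: "finite T" "\<And>y. (w has_real_derivative w1 y) (at y)"
    "\<And>y. y \<notin> T \<Longrightarrow> (w1 has_real_derivative w2 y) (at y)" "continuous_on UNIV w1" "w2 \<in> borel_measurable borel"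
    "\<And>y. \<bar>w y\<bar> \<le> J" "\<And>y. \<bar>w1 y\<bar> \<le> J" "\<And>y. \<bar>w2 y\<bar> \<le> J"
    using bounded_C11E[OF assms(2)] by metis
  have cont: "continuous_on UNIV U" "continuous_on UNIV w"
    using U(2) w(2) by (auto intro: continuous_at_imp_continuous_on DERIV_isCont)
  have b: "\<bar>a + c * b\<bar> \<le> K + \<bar>c\<bar> * J" if "\<bar>a\<bar> \<le> K" "\<bar>b\<bar> \<le> J" for a b
  proof -
    have "\<bar>a + c * b\<bar> \<le> \<bar>a\<bar> + \<bar>c\<bar> * \<bar>b\<bar>" by (metis abs_mult abs_triangle_ineq)
    also have "\<dots> \<le> K + \<bar>c\<bar> * J" using that by (intro add_mono mult_left_mono) auto
    finally show ?thesis .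
  qed
  have d: "((\<lambda>y. f y + c * g y) has_real_derivative (f' + c * g')) (at y)"
    if "(f has_real_derivative f') (at y)" "(g has_real_derivative g') (at y)" for f g f' g' y
    using DERIV_add[OF that(1) DERIV_cmult[OF that(2), of c]] .
  show ?thesis
    by (rule bounded_C11I[where S="S \<union> T" and ?U1.0="\<lambda>y. U1 y + c * w1 y"
          and ?K0.0="K + \<bar>c\<bar> * J" and ?K1.0="K + \<bar>c\<bar> * J" and ?K2.0="K + \<bar>c\<bar> * J"])
      (use U w in \<open>auto intro!: continuous_intros cont d b\<close>)
qed

lemma bounded_C11_cmult: "bounded_C11 w w2 \<Longrightarrow> bounded_C11 (\<lambda>y. c * w y) (\<lambda>y. c * w2 y)"
  using bounded_C11_add_mult[of "\<lambda>_. 0" "\<lambda>_. 0" w w2 c]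
    bounded_C11I[of "{}" "\<lambda>_. 0" "\<lambda>_. 0" "\<lambda>_. 0" 0 0 0] by simp

lemma bounded_C11_reflect:
  assumes "bounded_C11 U U2"
  shows "bounded_C11 (\<lambda>y. U (- y)) (\<lambda>y. U2 (- y))"
proof -
  obtain S U1 K where U: "finite S" "\<And>y. (U has_real_derivative U1 y) (at y)"
    "\<And>y. y \<notin> S \<Longrightarrow> (U1 has_real_derivative U2 y) (at y)" "continuous_on UNIV U1" "U2 \<in> borel_measurable borel"
    "\<And>y. \<bar>U y\<bar> \<le> K" "\<And>y. \<bar>U1 y\<bar> \<le> K" "\<And>y. \<bar>U2 y\<bar> \<le> K"
    using bounded_C11E[OF assms] by metis
  have cont: "continuous_on UNIV U"
    using U(2) by (auto intro: continuous_at_imp_continuous_on DERIV_isCont)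
  have d: "((\<lambda>y. f (- y)) has_real_derivative - f') (at y)"
    if "(f has_real_derivative f') (at (- y))" for f f' and y :: real
  proof -
    have "(uminus has_real_derivative - 1) (at y)" by (auto intro!: derivative_eq_intros)
    from DERIV_chain2[where f=f and g=uminus, OF that this] show ?thesis by simp
  qed
  show ?thesis
  proof (rule bounded_C11I[where S="uminus ` S" and ?U1.0="\<lambda>y. - U1 (- y)" and ?K0.0=K and ?K1.0=K and ?K2.0=K])
    show "continuous_on UNIV (\<lambda>y. U (- y))" "continuous_on UNIV (\<lambda>y. - U1 (- y))"
      by (intro continuous_intros continuous_on_compose2[OF cont] continuous_on_compose2[OF U(4)]; simp)+
    fix y
    show "((\<lambda>y. U (- y)) has_real_derivative - U1 (- y)) (at y)"
      using U(2) by (rule d)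
    assume "y \<notin> uminus ` S"
    then have "- y \<notin> S" by (auto simp: image_iff)
    from DERIV_minus[OF d[OF U(3)[OF this]]]
    show "((\<lambda>y. - U1 (- y)) has_real_derivative U2 (- y)) (at y)" by simp
  qed (use U in auto)
qed

definition potential :: "real \<Rightarrow> (real \<Rightarrow> real) \<Rightarrow> (real \<Rightarrow> real) \<Rightarrow> real \<Rightarrow> real" where
  "potential \<beta> U U2 y = U y powr (1 + \<beta>) - U2 y / 2"

lemma bounded_C11_measurable:
  assumes "bounded_C11 U U2"
  shows "U \<in> borel_measurable borel" "U2 \<in> borel_measurable borel" "continuous_on UNIV U"
    "potential \<beta> U U2 \<in> borel_measurable borel"
proof -
  show "continuous_on UNIV U" and [measurable]: "U2 \<in> borel_measurable borel"
    using assms unfolding bounded_C11_def by blast+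
  then show [measurable]: "U \<in> borel_measurable borel" by (simp add: borel_measurable_continuous_onI)
  show "potential \<beta> U U2 \<in> borel_measurable borel" unfolding potential_def[abs_def] by measurable
qed

lemma bounded_C11_bound:
  assumes "bounded_C11 U U2" "\<And>y. 0 \<le> U y" "-1 \<le> \<beta>"
  obtains K where "\<And>y. \<bar>U y\<bar> \<le> K" "\<And>y. \<bar>U2 y\<bar> \<le> K" "\<And>y. \<bar>potential \<beta> U U2 y\<bar> \<le> K"
proof -
  obtain K where K: "\<And>y. \<bar>U y\<bar> \<le> K" "\<And>y. \<bar>U2 y\<bar> \<le> K"
    using assms(1) unfolding bounded_C11_def by blast
  have "\<bar>potential \<beta> U U2 y\<bar> \<le> \<bar>K\<bar> powr (1 + \<beta>) + \<bar>K\<bar>" for y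
  proof -
    have "U y powr (1 + \<beta>) \<le> \<bar>K\<bar> powr (1 + \<beta>)"
      using K(1)[of y] assms by (intro powr_mono2) auto
    then show ?thesis
      using K(2)[of y] powr_ge_zero[of "U y" "1 + \<beta>"] powr_ge_zero[of "\<bar>K\<bar>" "1 + \<beta>"]
      unfolding potential_def by linarith
  qed
  moreover have "K \<le> max K (\<bar>K\<bar> powr (1 + \<beta>) + \<bar>K\<bar>)" by simp
  ultimately show thesis
    using K by (intro that[of "max K (\<bar>K\<bar> powr (1 + \<beta>) + \<bar>K\<bar>)"]) (auto intro: order_trans simp: le_max_iff_disj)
qed

lemma measurable_continuous_field:
  fixes \<Lambda> :: "real \<Rightarrow> 'w \<Rightarrow> real"
  assumes [measurable]: "\<And>x. \<Lambda> x \<in> borel_measurable M" and cont: "\<And>\<omega>. continuous_on UNIV (\<lambda>x. \<Lambda> x \<omega>)"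
  shows "(\<lambda>(\<omega>, y). \<Lambda> y \<omega>) \<in> borel_measurable (M \<Otimes>\<^sub>M borel)"
proof (rule borel_measurable_LIMSEQ_real)
  show "(\<lambda>n. case z of (\<omega>, y) \<Rightarrow> \<Lambda> (real_of_int \<lfloor>y * real (Suc n)\<rfloor> / real (Suc n)) \<omega>) \<longlonglongrightarrow> (case z of (\<omega>, y) \<Rightarrow> \<Lambda> y \<omega>)" for z
  proof -
    obtain \<omega> y where z: "z = (\<omega>, y)" by (cases z)
    have "(\<lambda>n. real_of_int \<lfloor>y * real (Suc n)\<rfloor> / real (Suc n)) \<longlonglongrightarrow> y"
    proof (rule real_tendsto_sandwich[OF _ _ _ tendsto_const])
      show "(\<lambda>n. y - 1 / real (Suc n)) \<longlonglongrightarrow> y"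
        using tendsto_diff[OF tendsto_const LIMSEQ_Suc[OF lim_1_over_n[where 'a=real]], of y] by simp
      have "y - 1 / real (Suc n) \<le> real_of_int \<lfloor>y * real (Suc n)\<rfloor> / real (Suc n)" for n
      proof -
        have "y * real (Suc n) - 1 \<le> real_of_int \<lfloor>y * real (Suc n)\<rfloor>" by linarith
        then have "(y * real (Suc n) - 1) / real (Suc n) \<le> real_of_int \<lfloor>y * real (Suc n)\<rfloor> / real (Suc n)"
          by (intro divide_right_mono) auto
        then show ?thesis by (simp add: diff_divide_distrib del: of_nat_Suc)
      qed
      then show "eventually (\<lambda>n. y - 1 / real (Suc n) \<le> real_of_int \<lfloor>y * real (Suc n)\<rfloor> / real (Suc n)) sequentially"
        by (intro always_eventually) auto
      show "eventually (\<lambda>n. real_of_int \<lfloor>y * real (Suc n)\<rfloor> / real (Suc n) \<le> y) sequentially"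
        by (intro always_eventually) (auto simp: divide_le_eq simp del: of_nat_Suc)
    qed
    moreover have "isCont (\<lambda>x. \<Lambda> x \<omega>) y"
      using cont by (simp add: continuous_on_eq_continuous_at)
    ultimately show ?thesis unfolding z by (auto intro: isCont_tendsto_compose)
  qed
  show "(\<lambda>z. case z of (\<omega>, y) \<Rightarrow> \<Lambda> (real_of_int \<lfloor>y * real (Suc n)\<rfloor> / real (Suc n)) \<omega>) \<in> borel_measurable (M \<Otimes>\<^sub>M borel)" for n
    by measurable
qed

lemma (in super_brownian) total_local_time_laplace:
  assumes \<mu>: "\<mu> \<in> space finite_measures"
    and meas: "\<And>x. \<Lambda> x \<in> borel_measurable (P \<mu>)" and cont: "\<And>\<omega>. continuous_on UNIV (\<lambda>x. \<Lambda> x \<omega>)"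
    and occ: "AE \<omega> in P \<mu>. eventually (\<lambda>n::nat. mass (real n) \<omega> = 0 \<and>
      (\<forall>f K. f \<in> borel_measurable borel \<longrightarrow> (\<forall>x. 0 \<le> f x \<and> f x \<le> K) \<longrightarrow>
        (LBINT s:{0..real n}. \<integral>x. f x \<partial>X s \<omega>) = (\<integral>x. f x * \<Lambda> x \<omega> \<partial>lborel))) sequentially"
    and U: "bounded_C11 U U2" "\<And>y. 0 \<le> U y" "\<And>y. 0 \<le> potential \<beta> U U2 y"
  shows "(\<integral>\<omega>. exp (- (\<integral>y. potential \<beta> U U2 y * \<Lambda> y \<omega> \<partial>lborel)) \<partial>P \<mu>) = exp (- (\<integral>y. U y \<partial>\<mu>))"
proof -
  interpret prob_space "P \<mu>" by (rule prob_space_P[OF \<mu>])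
  let ?f = "potential \<beta> U U2"
  let ?g = "\<lambda>n \<omega>. exp (- (\<integral>x. U x \<partial>X (real n) \<omega>) - (LBINT s:{0..real n}. \<integral>x. ?f x \<partial>X s \<omega>))"
  note [measurable] = bounded_C11_measurable[OF U(1)]
  have "- 1 \<le> \<beta>" using beta_pos by simp
  then obtain K where K: "\<And>y. \<bar>U y\<bar> \<le> K" "\<And>y. \<bar>U2 y\<bar> \<le> K" "\<And>y. \<bar>?f y\<bar> \<le> K"
    using bounded_C11_bound[OF U(1,2)] by metis
  obtain S U1 J where C: "finite S" "\<And>y. (U has_real_derivative U1 y) (at y)"
    "\<And>y. y \<notin> S \<Longrightarrow> (U1 has_real_derivative U2 y) (at y)" "continuous_on UNIV U1" "U2 \<in> borel_measurable borel"
    "\<And>y. \<bar>U y\<bar> \<le> J" "\<And>y. \<bar>U1 y\<bar> \<le> J" "\<And>y. \<bar>U2 y\<bar> \<le> J"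
    using bounded_C11E[OF U(1)] by metis
  have "mild_solution \<beta> U ?f (\<lambda>t. U)"
    using mild_solution_stationary[OF C U(2), of \<beta>] by (simp add: potential_def[abs_def])
  moreover have "bounded_borel_nonneg U" "bounded_borel_nonneg ?f"
    using K U by (auto simp: bounded_borel_nonneg_def bounded_iff)
  ultimately have eq: "(\<integral>\<omega>. ?g n \<omega> \<partial>P \<mu>) = exp (- (\<integral>y. U y \<partial>\<mu>))" for n
    using log_laplace[OF \<mu>, of "real n" U ?f "\<lambda>t. U"] by simp
  have g: "?g n \<in> borel_measurable (P \<mu>)" for n
  proof -
    \<comment> \<open>a Bochner integral different from the junk value \<open>0\<close> forces integrability\<close>
    have "integrable (P \<mu>) (?g n)"
      using not_integrable_integral_eq[of "P \<mu>" "?g n"] eq[of n] by (metis exp_not_eq_zero)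
    then show ?thesis by (rule borel_measurable_integrable)
  qed
  have joint[measurable]: "(\<lambda>(\<omega>, y). \<Lambda> y \<omega>) \<in> borel_measurable (P \<mu> \<Otimes>\<^sub>M borel)"
    by (rule measurable_continuous_field[OF meas cont])
  have "(\<lambda>n. \<integral>\<omega>. ?g n \<omega> \<partial>P \<mu>) \<longlonglongrightarrow> (\<integral>\<omega>. exp (- (\<integral>y. ?f y * \<Lambda> y \<omega> \<partial>lborel)) \<partial>P \<mu>)"
  proof (rule integral_dominated_convergence[where w="\<lambda>_. 1"])
    have "(\<lambda>(\<omega>, y). ?f y * \<Lambda> y \<omega>) \<in> borel_measurable (P \<mu> \<Otimes>\<^sub>M borel)"
      by measurable
    then show "(\<lambda>\<omega>. exp (- (\<integral>y. ?f y * \<Lambda> y \<omega> \<partial>lborel))) \<in> borel_measurable (P \<mu>)"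
      by (intro borel_measurable_exp[THEN measurable_compose[rotated]] borel_measurable_uminus
          lborel.borel_measurable_lebesgue_integral) simp
    show "AE \<omega> in P \<mu>. (\<lambda>n. ?g n \<omega>) \<longlonglongrightarrow> exp (- (\<integral>y. ?f y * \<Lambda> y \<omega> \<partial>lborel))"
      using occ AE_space
    proof eventually_elim
      case (elim \<omega>)
      have \<omega>: "\<omega> \<in> space \<Omega>" using elim by (simp add: space_P[OF \<mu>])
      have "eventually (\<lambda>n. ?g n \<omega> = exp (- (\<integral>y. ?f y * \<Lambda> y \<omega> \<partial>lborel))) sequentially"
        using elim(1)
      proof eventually_elim
        case (elim n)
        have "\<forall>x. 0 \<le> ?f x \<and> ?f x \<le> K" using U(3) K(3) abs_le_D1 by blast
        then have "(LBINT s:{0..real n}. \<integral>x. ?f x \<partial>X s \<omega>) = (\<integral>x. ?f x * \<Lambda> x \<omega> \<partial>lborel)"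
          using elim bounded_C11_measurable(4)[OF U(1)] by blast
        then show ?case using integral_extinct[OF \<omega>, of "real n" U] elim by simp
      qed
      then show ?case by (rule tendsto_eventually)
    qed
    show "AE \<omega> in P \<mu>. norm (?g n \<omega>) \<le> 1" for n
    proof (rule AE_I2)
      fix \<omega>
      have "0 \<le> (\<integral>x. U x \<partial>X (real n) \<omega>)" using U(2) by (intro Bochner_Integration.integral_nonneg) auto
      moreover have "0 \<le> (LBINT s:{0..real n}. \<integral>x. ?f x \<partial>X s \<omega>)"
        unfolding set_lebesgue_integral_def
        using U(3) by (intro Bochner_Integration.integral_nonneg) auto
      ultimately show "norm (?g n \<omega>) \<le> 1" by simp
    qed
  qed (use g in auto)
  then show ?thesis unfolding eq by (simp add: LIMSEQ_const_iff)
qed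

section \<open>Elementary inequalities\<close>

text \<open>Weighted arithmetic-geometric mean inequality for 1 + s and 1 with weights q and 1 -
  q.\<close>

lemma powr_le_linear:
  fixes s q :: real
  assumes "0 \<le> q" "q \<le> 1" "-1 \<le> s"
  shows "(1 + s) powr q \<le> 1 + q * s"
proof (cases "s = -1")
  case True
  then show ?thesis using assms by simp
next
  case False
  then show ?thesis
    using assms Youngs_inequality_0[of q "1 - q" "1 + s" 1] by (simp add: algebra_simps)
qed

lemma powr_ge_linear:
  fixes s q :: real
  assumes "1 \<le> q" "-1 \<le> s"
  shows "1 + q * s \<le> (1 + s) powr q"
proof -
  \<comment> \<open>The concave case with exponent 1 / q, applied to the number (1 + s)^q.\<close>
  have "(1 + ((1 + s) powr q - 1)) powr (1 / q) \<le> 1 + (1 / q) * ((1 + s) powr q - 1)"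
    using assms by (intro powr_le_linear) auto
  moreover have "((1 + s) powr q) powr (1 / q) = 1 + s"
    using assms by (simp add: powr_powr)
  ultimately show ?thesis using assms by (simp add: field_simps)
qed

lemma powr_tangent:
  fixes a b q :: real
  assumes "0 < q" "0 \<le> a" "0 \<le> b"
  shows "a powr (1 + q) + (1 + q) * a powr q * b \<le> (a + b) powr (1 + q)"
proof (cases "a = 0")
  case False
  with assms have a: "0 < a" by simp
  then have 0: "a + b = a * (1 + b / a)" by (simp add: field_simps)
  have "a powr (1 + q) * (b / a) = a powr q * b"
    using a by (simp add: powr_add)
  moreover have "a powr (1 + q) * (1 + (1 + q) * (b / a)) = a powr (1 + q) + (1 + q) * (a powr (1 + q) * (b / a))"
    by (simp only: distrib_left mult_1_right mult.left_commute)
  ultimately have "a powr (1 + q) + (1 + q) * a powr q * b = a powr (1 + q) * (1 + (1 + q) * (b / a))"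
    by (simp only: mult.assoc)
  also have "\<dots> \<le> a powr (1 + q) * (1 + b / a) powr (1 + q)"
    using a assms divide_nonneg_pos[OF \<open>0 \<le> b\<close> a]
    by (intro mult_left_mono powr_ge_linear) (auto intro: order_trans[of _ 0])
  also have "\<dots> = (a + b) powr (1 + q)"
    unfolding 0 by (rule powr_mult[symmetric])
  finally show ?thesis .
qed (use assms in auto)

text \<open>Even and odd parts of the perturbation of u^(1+q), quadratic and linear in the relative
  size s = w / u. As 1 + q < 2, the second derivative of the power blows up at 0, so a Taylor
  estimate is replaced by scaling u out and writing (1 \<plusminus> s)^(1+q) = (1 \<plusminus> s) (1
  \<plusminus> s)^q \<le> (1 \<plusminus> s) (1 \<plusminus> q s): the even part is then at most 1 +
  q s^2.\<close>

lemma powr_symmetric_difference: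
  fixes u w q :: real
  assumes q: "0 < q" "q < 1" and u: "0 < u" and w: "0 \<le> w" "w \<le> u"
  shows "u powr (1 + q) \<le> ((u + w) powr (1 + q) + (u - w) powr (1 + q)) / 2"
    and "((u + w) powr (1 + q) + (u - w) powr (1 + q)) / 2 - u powr (1 + q) \<le> u powr (1 + q) * (w / u)\<^sup>2"
    and "0 \<le> ((u + w) powr (1 + q) - (u - w) powr (1 + q)) / 2"
    and "((u + w) powr (1 + q) - (u - w) powr (1 + q)) / 2 \<le> 3 * u powr (1 + q) * (w / u)"
proof -
  define s where "s = w / u"
  have s: "0 \<le> s" "s \<le> 1" using assms by (auto simp: s_def)
  have "u + w = u * (1 + s)" "u - w = u * (1 - s)" using u by (auto simp: s_def field_simps)
  then have e: "(u + w) powr (1 + q) = u powr (1 + q) * (1 + s) powr (1 + q)"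
    "(u - w) powr (1 + q) = u powr (1 + q) * (1 - s) powr (1 + q)"
    using u s by (simp_all add: powr_mult)
  have p: "0 \<le> u powr (1 + q)" by simp
  have l: "1 + (1 + q) * s \<le> (1 + s) powr (1 + q)" "1 - (1 + q) * s \<le> (1 - s) powr (1 + q)"
    using powr_ge_linear[of "1 + q" s] powr_ge_linear[of "1 + q" "- s"] q s by auto
  have r: "(1 + s) powr (1 + q) \<le> (1 + s) * (1 + q * s)" "(1 - s) powr (1 + q) \<le> (1 - s) * (1 - q * s)"
  proof -
    have "(1 + s) powr (1 + q) = (1 + s) * (1 + s) powr q" using s by (simp add: powr_add)
    also have "\<dots> \<le> (1 + s) * (1 + q * s)"
      using powr_le_linear[of q s] q s by (intro mult_left_mono) auto
    finally show "(1 + s) powr (1 + q) \<le> (1 + s) * (1 + q * s)" .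
    have "(1 - s) powr (1 + q) = (1 - s) * (1 - s) powr q" using s by (cases "s = 1") (auto simp: powr_add)
    also have "\<dots> \<le> (1 - s) * (1 - q * s)"
      using powr_le_linear[of q "- s"] q s by (intro mult_left_mono) auto
    finally show "(1 - s) powr (1 + q) \<le> (1 - s) * (1 - q * s)" .
  qed
  have ss: "q * s\<^sup>2 \<le> s\<^sup>2" "q * s\<^sup>2 \<le> s" "q * s \<le> s"
  proof -
    show "q * s\<^sup>2 \<le> s\<^sup>2" "q * s \<le> s" using q s by (auto intro: mult_left_le_one_le)
    have "s * s \<le> s * 1" using s by (intro mult_left_mono) auto
    with \<open>q * s\<^sup>2 \<le> s\<^sup>2\<close> show "q * s\<^sup>2 \<le> s" by (simp add: power2_eq_square)
  qed
  have 1: "1 \<le> ((1 + s) powr (1 + q) + (1 - s) powr (1 + q)) / 2" using l by simp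
  have 2: "((1 + s) powr (1 + q) + (1 - s) powr (1 + q)) / 2 - 1 \<le> s\<^sup>2"
    using r ss by (simp add: algebra_simps power2_eq_square)
  have 3: "((1 + s) powr (1 + q) - (1 - s) powr (1 + q)) / 2 \<le> 3 * s"
    using r(1) l(2) ss s by (simp add: algebra_simps power2_eq_square)
  have 4: "(1 - s) powr (1 + q) \<le> (1 + s) powr (1 + q)" using s q by (intro powr_mono2) auto
  show "u powr (1 + q) \<le> ((u + w) powr (1 + q) + (u - w) powr (1 + q)) / 2"
    using mult_left_mono[OF 1 p] by (simp add: e algebra_simps)
  show "((u + w) powr (1 + q) + (u - w) powr (1 + q)) / 2 - u powr (1 + q) \<le> u powr (1 + q) * (w / u)\<^sup>2"
    using mult_left_mono[OF 2 p] by (simp add: e s_def[symmetric] algebra_simps)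
  show "0 \<le> ((u + w) powr (1 + q) - (u - w) powr (1 + q)) / 2"
    using mult_left_mono[OF 4 p] by (simp add: e)
  show "((u + w) powr (1 + q) - (u - w) powr (1 + q)) / 2 \<le> 3 * u powr (1 + q) * (w / u)"
    using mult_left_mono[OF 3 p] by (simp add: e s_def[symmetric] algebra_simps)
qed

lemma cosh_ge_quadratic: "1 + x\<^sup>2 / 2 \<le> cosh (x :: real)"
proof -
  let ?f = "\<lambda>n. if even n then x ^ n /\<^sub>R fact n else 0"
  have "(\<Sum>n<3. ?f n) \<le> suminf ?f"
    using cosh_converges[of x]
    by (intro sum_le_suminf) (auto simp: sums_iff zero_le_even_power)
  then show ?thesis
    using cosh_converges[of x] by (simp add: sums_iff eval_nat_numeral field_simps)
qed

lemma sum_differences_ge: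
  fixes a :: "nat \<Rightarrow> real"
  assumes "a N = 0" "i < N"
  shows "a i \<le> (\<Sum>j<N. \<bar>a j - a (Suc j)\<bar>)"
proof -
  have "a i = (\<Sum>j\<in>{i..<N}. a j - a (Suc j))"
    using sum_Suc_diff'[of i N "\<lambda>j. - a j"] assms by simp
  also have "\<dots> \<le> (\<Sum>j\<in>{i..<N}. \<bar>a j - a (Suc j)\<bar>)" by (intro sum_mono) auto
  also have "\<dots> \<le> (\<Sum>j<N. \<bar>a j - a (Suc j)\<bar>)" by (intro sum_mono2) auto
  finally show ?thesis .
qed

lemma dyadic_scale:
  fixes z :: real
  assumes "0 < z" "z \<le> (1/2) ^ k0"
  obtains k where "k0 \<le> k" "z \<le> (1/2) ^ k" "(1/2) ^ k < 2 * z"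
proof -
  define P where "P j \<longleftrightarrow> (1/2) ^ j < 2 * z" for j :: nat
  obtain m where "(1/2 :: real) ^ m < 2 * z"
    using real_arch_pow_inv[of "2 * z" "1/2"] assms by auto
  then have "P (k0 + m)"
  proof -
    have "(1/2 :: real) ^ (k0 + m) \<le> (1/2) ^ m" by (rule power_decreasing) auto
    with \<open>(1/2) ^ m < 2 * z\<close> show ?thesis unfolding P_def by linarith
  qed
  then have ex: "\<exists>j. P (k0 + j)" by blast
  define i where "i = (LEAST j. P (k0 + j))"
  have i: "P (k0 + i)" unfolding i_def using ex by (rule LeastI_ex)
  have "z \<le> (1/2) ^ (k0 + i)"
  proof (cases i)
    case 0 then show ?thesis using assms by simp
  next
    case (Suc j)
    then have "\<not> P (k0 + j)" using not_less_Least[of j "\<lambda>j. P (k0 + j)"] by (simp add: i_def)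
    then show ?thesis by (simp add: P_def Suc)
  qed
  with i show thesis using that[of "k0 + i"] by (simp add: P_def)
qed

section \<open>Moment bounds from the exact Laplace transforms\<close>

text \<open>What the analysis of the right end point requires of the total local time. All of it is
  stable under reflection once the left end point is measurable too, so the left end point becomes a
  second interpretation. The support condition is demanded everywhere, which makes occupation
  integrals finite for every outcome.\<close>

locale occupation_field = prob_space M for M :: "'w measure" +
  fixes \<beta> :: real and \<Lambda> :: "real \<Rightarrow> 'w \<Rightarrow> real" and lft rgt :: "'w \<Rightarrow> real"
  assumes beta: "0 < \<beta>" "\<beta> < 1"
    and field_measurable: "\<And>x. \<Lambda> x \<in> borel_measurable M"
    and field_continuous: "\<And>\<omega>. continuous_on UNIV (\<lambda>x. \<Lambda> x \<omega>)"
    and field_nonneg: "\<And>\<omega> x. 0 \<le> \<Lambda> x \<omega>"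
    and field_support: "\<And>\<omega> x. \<Lambda> x \<omega> \<noteq> 0 \<Longrightarrow> lft \<omega> < x \<and> x < rgt \<omega>"
    and rgt_measurable: "rgt \<in> borel_measurable M"
    and field_positive: "AE \<omega> in M. lft \<omega> < 0 \<and> 0 < rgt \<omega> \<and> (\<forall>x. lft \<omega> < x \<longrightarrow> x < rgt \<omega> \<longrightarrow> 0 < \<Lambda> x \<omega>)"
    and laplace: "\<And>U U2. bounded_C11 U U2 \<Longrightarrow> (\<And>y. 0 \<le> U y) \<Longrightarrow> (\<And>y. 0 \<le> potential \<beta> U U2 y) \<Longrightarrow>
      (\<integral>\<omega>. exp (- (\<integral>y. potential \<beta> U U2 y * \<Lambda> y \<omega> \<partial>lborel)) \<partial>M) = exp (- U 0)"
begin

declare rgt_measurable [measurable]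

definition occ :: "(real \<Rightarrow> real) \<Rightarrow> 'w \<Rightarrow> real" where
  "occ h \<omega> = (\<integral>y. h y * \<Lambda> y \<omega> \<partial>lborel)"

definition weight :: "(real \<Rightarrow> real) \<Rightarrow> bool" where
  "weight h \<longleftrightarrow> h \<in> borel_measurable borel \<and> bounded (range h)"

lemma weightI: "h \<in> borel_measurable borel \<Longrightarrow> (\<And>y. \<bar>h y\<bar> \<le> K) \<Longrightarrow> weight h"
  by (auto simp: weight_def bounded_iff)

lemma weight_bound:
  assumes "weight h"
  obtains K where "\<And>y. \<bar>h y\<bar> \<le> K"
  using assms by (auto simp: weight_def bounded_iff)

lemma weight_measurable: "weight h \<Longrightarrow> h \<in> borel_measurable borel"
  by (simp add: weight_def)

lemma weight_add: "weight g \<Longrightarrow> weight h \<Longrightarrow> weight (\<lambda>y. g y + h y)"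
  by (auto simp: weight_def intro: bounded_plus_comp)

lemma weight_diff: "weight g \<Longrightarrow> weight h \<Longrightarrow> weight (\<lambda>y. g y - h y)"
  by (auto simp: weight_def intro: bounded_minus_comp)

lemma weight_cmult: "weight h \<Longrightarrow> weight (\<lambda>y. c * h y)"
proof -
  assume h: "weight h"
  then obtain K where "\<And>y. \<bar>h y\<bar> \<le> K" using weight_bound by blast
  then have "\<bar>c * h y\<bar> \<le> \<bar>c\<bar> * K" for y by (simp add: abs_mult mult_left_mono)
  with weight_measurable[OF h] show ?thesis by (intro weightI) auto
qed

lemma weight_indicator: "A \<in> sets borel \<Longrightarrow> weight (indicator A)"
  by (rule weightI[where K=1]) (auto simp: indicator_def)

lemma weight_potential:
  assumes "bounded_C11 U U2" "\<And>y. 0 \<le> U y"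
  shows "weight (potential \<beta> U U2)"
proof -
  have "- 1 \<le> \<beta>" using beta by simp
  then obtain K where "\<And>y. \<bar>potential \<beta> U U2 y\<bar> \<le> K"
    using bounded_C11_bound[OF assms] by metis
  then show ?thesis using bounded_C11_measurable(4)[OF assms(1)] by (rule weightI[rotated])
qed

lemma occ_integrable:
  assumes "weight h"
  shows "integrable lborel (\<lambda>y. h y * \<Lambda> y \<omega>)"
proof -
  obtain K where K: "\<And>y. \<bar>h y\<bar> \<le> K" using weight_bound[OF assms] by blast
  have [measurable]: "h \<in> borel_measurable borel" "(\<lambda>x. \<Lambda> x \<omega>) \<in> borel_measurable borel"
    using weight_measurable[OF assms] field_continuous by (auto intro: borel_measurable_continuous_onI)
  have "compact ((\<lambda>x. \<Lambda> x \<omega>) ` {lft \<omega>..rgt \<omega>})"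
    by (intro compact_continuous_image continuous_on_subset[OF field_continuous]) auto
  then obtain B where "\<forall>x\<in>{lft \<omega>..rgt \<omega>}. \<bar>\<Lambda> x \<omega>\<bar> \<le> B"
    by (auto dest!: compact_imp_bounded simp: bounded_iff)
  then have B: "\<And>x. x \<in> {lft \<omega>..rgt \<omega>} \<Longrightarrow> \<bar>\<Lambda> x \<omega>\<bar> \<le> B" by blast
  show ?thesis
  proof (rule Bochner_Integration.integrable_bound)
    show "integrable lborel (\<lambda>y. (K * B) * indicator {lft \<omega>..rgt \<omega>} y)"
      by (intro integrable_mult_right integrable_real_indicator) (auto simp: emeasure_lborel_Icc_eq)
    show "AE y in lborel. norm (h y * \<Lambda> y \<omega>) \<le> norm (K * B * indicator {lft \<omega>..rgt \<omega>} y)"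
    proof (rule AE_I2)
      fix y
      show "norm (h y * \<Lambda> y \<omega>) \<le> norm (K * B * indicator {lft \<omega>..rgt \<omega>} y)"
      proof (cases "\<Lambda> y \<omega> = 0")
        case False
        then have y: "y \<in> {lft \<omega>..rgt \<omega>}" using field_support by fastforce
        have "\<bar>h y\<bar> * \<bar>\<Lambda> y \<omega>\<bar> \<le> \<bar>K\<bar> * \<bar>B\<bar>"
          using K[of y] B[OF y] by (intro mult_mono) auto
        then show ?thesis using y by (simp add: abs_mult)
      qed simp
    qed
  qed measurable
qed

lemma occ_measurable:
  assumes "weight h"
  shows "occ h \<in> borel_measurable M"
proof -
  have [measurable]: "(\<lambda>(\<omega>, y). \<Lambda> y \<omega>) \<in> borel_measurable (M \<Otimes>\<^sub>M borel)"
    by (rule measurable_continuous_field[OF field_measurable field_continuous])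
  have [measurable]: "h \<in> borel_measurable borel" using weight_measurable[OF assms] .
  have "(\<lambda>(\<omega>, y). h y * \<Lambda> y \<omega>) \<in> borel_measurable (M \<Otimes>\<^sub>M borel)" by measurable
  then have "(\<lambda>\<omega>. \<integral>y. h y * \<Lambda> y \<omega> \<partial>lborel) \<in> borel_measurable M"
    by (intro lborel.borel_measurable_lebesgue_integral) simp
  then show ?thesis by (simp add: occ_def[abs_def])
qed

lemma occ_add: "weight g \<Longrightarrow> weight h \<Longrightarrow> occ (\<lambda>y. g y + h y) \<omega> = occ g \<omega> + occ h \<omega>"
  using occ_integrable[of g \<omega>] occ_integrable[of h \<omega>] by (simp add: occ_def distrib_right)

lemma occ_diff: "weight g \<Longrightarrow> weight h \<Longrightarrow> occ (\<lambda>y. g y - h y) \<omega> = occ g \<omega> - occ h \<omega>"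
  using occ_integrable[of g \<omega>] occ_integrable[of h \<omega>] by (simp add: occ_def left_diff_distrib)

lemma occ_cmult: "occ (\<lambda>y. c * h y) \<omega> = c * occ h \<omega>"
  by (simp add: occ_def mult.assoc)

text \<open>The comparison is asked only left of R, because the field vanishes beyond. This
  localises estimates: on the event R \<le> g + e nothing has to be known about the functions right
  of the window.\<close>

lemma occ_mono:
  assumes "weight g" "weight h" "\<And>y. y < rgt \<omega> \<Longrightarrow> g y \<le> h y"
  shows "occ g \<omega> \<le> occ h \<omega>"
  unfolding occ_def
proof (rule integral_mono[OF occ_integrable[OF assms(1)] occ_integrable[OF assms(2)]])
  fix y show "g y * \<Lambda> y \<omega> \<le> h y * \<Lambda> y \<omega>"
    using assms(3)[of y] field_nonneg[of y \<omega>] field_support[of y \<omega>]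
    by (cases "\<Lambda> y \<omega> = 0") (auto intro: mult_right_mono)
qed

lemma weight_zero: "weight (\<lambda>_. 0)"
  by (rule weightI[where K=0]) auto

lemma occ_zero: "occ (\<lambda>_. 0) \<omega> = 0"
  by (simp add: occ_def)

lemma occ_nonneg: "weight h \<Longrightarrow> (\<And>y. y < rgt \<omega> \<Longrightarrow> 0 \<le> h y) \<Longrightarrow> 0 \<le> occ h \<omega>"
  using occ_mono[OF weight_zero, of h \<omega>] by (simp add: occ_zero)

lemma occ_eq_0: "(\<And>y. y < rgt \<omega> \<Longrightarrow> h y = 0) \<Longrightarrow> occ h \<omega> = 0"
  unfolding occ_def using field_support[of _ \<omega>] by (intro integral_eq_zero_AE AE_I2) fastforce

lemma laplace_occ:
  assumes "bounded_C11 U U2" "\<And>y. 0 \<le> U y" "\<And>y. 0 \<le> potential \<beta> U U2 y"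
  shows "expectation (\<lambda>\<omega>. exp (- occ (potential \<beta> U U2) \<omega>)) = exp (- U 0)"
  using laplace[OF assms] by (simp add: occ_def)

lemma integrable_exp_occ:
  assumes "weight h" "\<And>y. 0 \<le> h y"
  shows "integrable M (\<lambda>\<omega>. exp (- occ h \<omega>))"
  using occ_nonneg[OF assms(1)] occ_measurable[OF assms(1)] assms(2)
  by (intro integrable_const_bound[where B=1]) auto

text \<open>This is the derivative at l = 0 of the Laplace functional for U + l w. The last
  assumption says that h lies below the linearised operator applied to w, and convexity of the power
  makes the potential of U + l w at least that of U plus l h. Hence the expectation of exp(- occ f)
  (1 - exp(- l occ h)) is at most exp(- U 0) (1 - exp(- l w 0)) \<le> l w 0. Dividing by l, Fatou's
  lemma gives finiteness of the moment and its bound at once.\<close>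

lemma first_moment:
  assumes U: "bounded_C11 U U2" "\<And>y. 0 \<le> U y" "\<And>y. 0 \<le> potential \<beta> U U2 y"
    and w: "bounded_C11 w w2" "\<And>y. 0 \<le> w y"
    and h: "weight h" "\<And>y. 0 \<le> h y" "\<And>y. h y \<le> (1 + \<beta>) * U y powr \<beta> * w y - w2 y / 2"
  shows "integrable M (\<lambda>\<omega>. exp (- occ (potential \<beta> U U2) \<omega>) * occ h \<omega>)"
    and "expectation (\<lambda>\<omega>. exp (- occ (potential \<beta> U U2) \<omega>) * occ h \<omega>) \<le> w 0"
proof -
  let ?f = "potential \<beta> U U2"
  have f: "weight ?f" using weight_potential[OF U(1,2)] .
  have [measurable]: "occ ?f \<in> borel_measurable M" "occ h \<in> borel_measurable M"
    using occ_measurable f h(1) by auto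
  have occ_h: "0 \<le> occ h \<omega>" and occ_f: "0 \<le> occ ?f \<omega>" for \<omega>
    using occ_nonneg h U f by auto
  define F where "F l \<omega> = exp (- occ ?f \<omega>) * ((1 - exp (- (l * occ h \<omega>))) / l)" for l \<omega>
  have F: "(\<integral>\<^sup>+\<omega>. ennreal (F l \<omega>) \<partial>M) \<le> ennreal (w 0)" if l: "0 < l" for l
  proof -
    let ?U = "\<lambda>y. U y + l * w y" and ?U2 = "\<lambda>y. U2 y + l * w2 y"
    let ?g = "potential \<beta> ?U ?U2"
    have g: "?f y + l * h y \<le> ?g y" for y
    proof -
      have "U y powr (1 + \<beta>) + (1 + \<beta>) * U y powr \<beta> * (l * w y) \<le> (U y + l * w y) powr (1 + \<beta>)"
        using beta U w l by (intro powr_tangent) auto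
      moreover have "l * h y \<le> l * ((1 + \<beta>) * U y powr \<beta> * w y - w2 y / 2)"
        using h(3)[of y] l by (intro mult_left_mono) auto
      ultimately show ?thesis
        unfolding potential_def mult.left_commute[of _ l] right_diff_distrib add_divide_distrib
        by (simp add: mult.assoc)
    qed
    have C: "bounded_C11 ?U ?U2" by (rule bounded_C11_add_mult[OF U(1) w(1)])
    have U0: "0 \<le> ?U y" for y using U w l by auto
    have g0: "0 \<le> ?g y" for y
      using order_trans[OF _ g[of y]] U(3)[of y] h(2)[of y] l by simp
    have wg: "weight ?g" using weight_potential[OF C U0] .
    have "occ ?f \<omega> + l * occ h \<omega> \<le> occ ?g \<omega>" for \<omega>
    proof -
      have "occ (\<lambda>y. ?f y + l * h y) \<omega> \<le> occ ?g \<omega>"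
        using g by (intro occ_mono weight_add weight_cmult f h(1) wg) auto
      then show ?thesis using occ_add[OF f weight_cmult[OF h(1)], of l \<omega>] by (simp add: occ_cmult)
    qed
    then have le: "F l \<omega> \<le> (exp (- occ ?f \<omega>) - exp (- occ ?g \<omega>)) / l" for \<omega>
    proof -
      have "exp (- occ ?g \<omega>) \<le> exp (- occ ?f \<omega>) * exp (- (l * occ h \<omega>))"
        using \<open>occ ?f \<omega> + l * occ h \<omega> \<le> occ ?g \<omega>\<close> by (simp add: exp_add[symmetric])
      then show ?thesis using l by (simp add: F_def right_diff_distrib divide_right_mono)
    qed
    have F0: "0 \<le> F l \<omega>" for \<omega> using l occ_h by (simp add: F_def)
    have i: "integrable M (\<lambda>\<omega>. (exp (- occ ?f \<omega>) - exp (- occ ?g \<omega>)) / l)"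
      by (intro integrable_divide Bochner_Integration.integrable_diff integrable_exp_occ f wg U g0)
    have Fm: "F l \<in> borel_measurable M" unfolding F_def by measurable
    have iF: "integrable M (F l)"
    proof (rule Bochner_Integration.integrable_bound[OF i Fm], rule AE_I2)
      show "norm (F l \<omega>) \<le> norm ((exp (- occ ?f \<omega>) - exp (- occ ?g \<omega>)) / l)" for \<omega>
        using F0[of \<omega>] order_trans[OF le[of \<omega>] abs_ge_self] by simp
    qed
    have "expectation (F l) \<le> expectation (\<lambda>\<omega>. (exp (- occ ?f \<omega>) - exp (- occ ?g \<omega>)) / l)"
      by (rule integral_mono[OF iF i le])
    also have "\<dots> = (exp (- U 0) - exp (- (U 0 + l * w 0))) / l"
      using laplace_occ[OF U] laplace_occ[OF C U0 g0] integrable_exp_occ[OF f U(3)] integrable_exp_occ[OF wg g0]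
      by simp
    also have "\<dots> \<le> w 0"
    proof -
      have "exp (- U 0) - exp (- (U 0 + l * w 0)) = exp (- U 0) * (1 - exp (- (l * w 0)))"
        by (simp add: right_diff_distrib exp_add[symmetric])
      also have "\<dots> \<le> 1 * (1 - exp (- (l * w 0)))"
        using U(2)[of 0] w(2)[of 0] l by (intro mult_right_mono) auto
      also have "\<dots> \<le> l * w 0" using exp_ge_add_one_self[of "- (l * w 0)"] by simp
      finally show ?thesis using l by (simp add: field_simps)
    qed
    finally have "expectation (F l) \<le> w 0" .
    then show ?thesis
      by (subst nn_integral_eq_integral[OF iF]) (use F0 in \<open>auto intro: ennreal_leI\<close>)
  qed
  let ?G = "\<lambda>\<omega>. exp (- occ ?f \<omega>) * occ h \<omega>"
  have G0: "0 \<le> ?G \<omega>" for \<omega> using occ_h by simp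
  have lim: "(\<lambda>n. ennreal (F (1 / real (Suc n)) \<omega>)) \<longlonglongrightarrow> ennreal (?G \<omega>)" for \<omega>
  proof -
    have "((\<lambda>l. (1 - exp (- (l * c))) / l) \<longlongrightarrow> c) (at_right 0)" for c :: real
      by real_asymp
    moreover have "filterlim (\<lambda>n. 1 / real (Suc n)) (at_right 0) sequentially"
      by real_asymp
    ultimately have "(\<lambda>n. (1 - exp (- (1 / real (Suc n) * occ h \<omega>))) / (1 / real (Suc n))) \<longlonglongrightarrow> occ h \<omega>"
      using filterlim_compose by fastforce
    then show ?thesis unfolding F_def by (intro tendsto_ennrealI tendsto_mult tendsto_const)
  qed
  have "(\<integral>\<^sup>+\<omega>. ennreal (?G \<omega>) \<partial>M) = (\<integral>\<^sup>+\<omega>. liminf (\<lambda>n. ennreal (F (1 / real (Suc n)) \<omega>)) \<partial>M)"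
    by (intro nn_integral_cong lim_imp_Liminf[symmetric] lim) simp
  also have "\<dots> \<le> liminf (\<lambda>n. \<integral>\<^sup>+\<omega>. ennreal (F (1 / real (Suc n)) \<omega>) \<partial>M)"
    unfolding F_def by (intro nn_integral_liminf) measurable
  also have "\<dots> \<le> ennreal (w 0)"
    using F[of "1 / real (Suc n)" for n] by (intro Liminf_le) (auto intro!: always_eventually)
  finally have le: "(\<integral>\<^sup>+\<omega>. ennreal (?G \<omega>) \<partial>M) \<le> ennreal (w 0)" .
  have Gm: "?G \<in> borel_measurable M" by measurable
  show i: "integrable M ?G"
    by (rule integrableI_bounded[OF Gm]) (use le G0 in \<open>auto simp: less_top[symmetric] top_unique\<close>)
  have "ennreal (expectation ?G) \<le> ennreal (w 0)"
    using le nn_integral_eq_integral[OF i] G0 by simp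
  then show "expectation ?G \<le> w 0" using w(2) by simp
qed

text \<open>Since \<open>w 0 = 0\<close>, the potentials of \<open>U\<close>, \<open>U + w\<close> and \<open>U - w\<close> have the same Laplace functional.
  Its second difference therefore vanishes, which bounds the square of the odd part \<open>d\<close> by the
  curvature of \<open>u \<mapsto> u\<^bsup>1+\<beta>\<^esup>\<close>.\<close>

lemma second_moment:
  assumes U: "bounded_C11 U U2" "\<And>y. 0 \<le> U y" "\<And>y. 0 \<le> potential \<beta> U U2 y"
    and w: "bounded_C11 w w2" "\<And>y. 0 \<le> w y" "\<And>y. w y \<le> U y" "w 0 = 0"
    and plus: "\<And>y. 0 \<le> potential \<beta> (\<lambda>y. U y + w y) (\<lambda>y. U2 y + w2 y) y"
    and minus: "\<And>y. 0 \<le> potential \<beta> (\<lambda>y. U y - w y) (\<lambda>y. U2 y - w2 y) y"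
  defines "m \<equiv> \<lambda>y. (potential \<beta> (\<lambda>y. U y + w y) (\<lambda>y. U2 y + w2 y) y +
      potential \<beta> (\<lambda>y. U y - w y) (\<lambda>y. U2 y - w2 y) y) / 2"
  defines "d \<equiv> \<lambda>y. (potential \<beta> (\<lambda>y. U y + w y) (\<lambda>y. U2 y + w2 y) y -
      potential \<beta> (\<lambda>y. U y - w y) (\<lambda>y. U2 y - w2 y) y) / 2"
  assumes k: "weight k" "\<And>y. m y \<le> potential \<beta> U U2 y + k y"
    "integrable M (\<lambda>\<omega>. exp (- occ (potential \<beta> U U2) \<omega>) * occ k \<omega>)"
    "expectation (\<lambda>\<omega>. exp (- occ (potential \<beta> U U2) \<omega>) * occ k \<omega>) \<le> C"
  shows "weight m" "weight d" "integrable M (\<lambda>\<omega>. exp (- occ m \<omega>) * (occ d \<omega>)\<^sup>2)"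
    and "expectation (\<lambda>\<omega>. exp (- occ m \<omega>) * (occ d \<omega>)\<^sup>2) \<le> 2 * C"
proof -
  let ?f = "potential \<beta> U U2"
  define p where "p = potential \<beta> (\<lambda>y. U y + w y) (\<lambda>y. U2 y + w2 y)"
  define q where "q = potential \<beta> (\<lambda>y. U y - w y) (\<lambda>y. U2 y - w2 y)"
  have m_eq: "m = (\<lambda>y. (1/2) * (p y + q y))" and d_eq: "d = (\<lambda>y. (1/2) * (p y - q y))"
    by (auto simp: m_def d_def p_def q_def)
  have Cp: "bounded_C11 (\<lambda>y. U y + w y) (\<lambda>y. U2 y + w2 y)"
    using bounded_C11_add_mult[OF U(1) w(1), of 1] by simp
  have Cq: "bounded_C11 (\<lambda>y. U y - w y) (\<lambda>y. U2 y - w2 y)"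
    using bounded_C11_add_mult[OF U(1) w(1), of "-1"] by simp
  have np: "0 \<le> U y + w y" and nq: "0 \<le> U y - w y" for y using U(2)[of y] w(2,3)[of y] by auto
  have f: "weight ?f" and p: "weight p" and q: "weight q"
    unfolding p_def q_def by (auto intro!: weight_potential U Cp Cq np nq)
  have p0: "0 \<le> p y" and q0: "0 \<le> q y" for y using plus minus by (auto simp: p_def q_def)
  show m: "weight m" and d: "weight d"
    unfolding m_eq d_eq by (intro weight_cmult weight_add weight_diff p q)+
  have m0: "0 \<le> m y" for y using p0 q0 by (auto simp: m_eq)
  have occ_m: "occ m \<omega> = (occ p \<omega> + occ q \<omega>) / 2" for \<omega>
    unfolding m_eq occ_cmult by (simp add: occ_add[OF p q])
  have occ_d: "occ d \<omega> = (occ p \<omega> - occ q \<omega>) / 2" for \<omega>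
    unfolding d_eq occ_cmult by (simp add: occ_diff[OF p q])
  have ip: "integrable M (\<lambda>\<omega>. exp (- occ p \<omega>))" and iq: "integrable M (\<lambda>\<omega>. exp (- occ q \<omega>))"
    and im: "integrable M (\<lambda>\<omega>. exp (- occ m \<omega>))" and i_f: "integrable M (\<lambda>\<omega>. exp (- occ ?f \<omega>))"
    by (intro integrable_exp_occ p q m f p0 q0 m0 U)+
  \<comment> \<open>The second difference of exp(- x) at \<open>occ m\<close> with step
    \<open>occ d\<close>; it equals exp(- occ m) (2 cosh (occ d) - 2) and so dominates the weighted
    square.\<close>
  let ?R = "\<lambda>\<omega>. exp (- occ p \<omega>) + exp (- occ q \<omega>) - 2 * exp (- occ m \<omega>)"
  have iR: "integrable M ?R" using ip iq im by auto
  have sq: "exp (- occ m \<omega>) * (occ d \<omega>)\<^sup>2 \<le> ?R \<omega>" for \<omega>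
  proof -
    have "occ p \<omega> = occ m \<omega> + occ d \<omega>" "occ q \<omega> = occ m \<omega> - occ d \<omega>"
      by (auto simp: occ_m occ_d field_simps)
    then have "?R \<omega> = exp (- occ m \<omega>) * (2 * cosh (occ d \<omega>) - 2)"
      by (simp add: cosh_field_def right_diff_distrib distrib_left exp_add[symmetric] exp_diff exp_minus field_simps)
    moreover have "exp (- occ m \<omega>) * (occ d \<omega>)\<^sup>2 \<le> exp (- occ m \<omega>) * (2 * cosh (occ d \<omega>) - 2)"
      using cosh_ge_quadratic[of "occ d \<omega>"] by (intro mult_left_mono) auto
    ultimately show ?thesis by simp
  qed
  have [measurable]: "occ m \<in> borel_measurable M" "occ d \<in> borel_measurable M"
    using occ_measurable m d by auto
  show i: "integrable M (\<lambda>\<omega>. exp (- occ m \<omega>) * (occ d \<omega>)\<^sup>2)"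
  proof (rule Bochner_Integration.integrable_bound[OF iR])
    show "AE \<omega> in M. norm (exp (- occ m \<omega>) * (occ d \<omega>)\<^sup>2) \<le> norm (?R \<omega>)"
    proof (rule AE_I2)
      fix \<omega>
      show "norm (exp (- occ m \<omega>) * (occ d \<omega>)\<^sup>2) \<le> norm (?R \<omega>)"
        using sq[of \<omega>] unfolding real_norm_def by (simp add: abs_mult)
    qed
  qed measurable
  have "expectation (\<lambda>\<omega>. exp (- occ m \<omega>) * (occ d \<omega>)\<^sup>2) \<le> expectation ?R"
    by (rule integral_mono[OF i iR sq])
  also have "\<dots> = 2 * exp (- U 0) - 2 * expectation (\<lambda>\<omega>. exp (- occ m \<omega>))"
    using laplace_occ[OF Cp np plus] laplace_occ[OF Cq nq minus] ip iq im w(4)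
    by (simp add: p_def[symmetric] q_def[symmetric])
  also have "\<dots> = 2 * expectation (\<lambda>\<omega>. exp (- occ ?f \<omega>) - exp (- occ m \<omega>))"
    using laplace_occ[OF U] i_f im by simp
  also have "\<dots> \<le> 2 * expectation (\<lambda>\<omega>. exp (- occ ?f \<omega>) * occ k \<omega>)"
  proof (intro mult_left_mono integral_mono k(3))
    show "integrable M (\<lambda>\<omega>. exp (- occ ?f \<omega>) - exp (- occ m \<omega>))" using i_f im by auto
    fix \<omega>
    have "occ m \<omega> \<le> occ (\<lambda>y. ?f y + k y) \<omega>"
      using k by (intro occ_mono m weight_add f) auto
    then have "occ m \<omega> - occ ?f \<omega> \<le> occ k \<omega>" using occ_add[OF f k(1)] by simp
    moreover have "1 - exp (occ ?f \<omega> - occ m \<omega>) \<le> occ m \<omega> - occ ?f \<omega>"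
      using exp_ge_add_one_self[of "occ ?f \<omega> - occ m \<omega>"] by linarith
    ultimately have "exp (- occ ?f \<omega>) * (1 - exp (occ ?f \<omega> - occ m \<omega>)) \<le> exp (- occ ?f \<omega>) * occ k \<omega>"
      by (intro mult_left_mono) auto
    then show "exp (- occ ?f \<omega>) - exp (- occ m \<omega>) \<le> exp (- occ ?f \<omega>) * occ k \<omega>"
      by (simp add: right_diff_distrib exp_add[symmetric])
  qed simp
  finally show "expectation (\<lambda>\<omega>. exp (- occ m \<omega>) * (occ d \<omega>)\<^sup>2) \<le> 2 * C" using k(4) by linarith
qed

end

section \<open>Barrier functions\<close>

text \<open>The power \<open>(B - y)\<^bsup>-q\<^esup>\<close>, continued beyond \<open>g < B\<close> by a bounded concave function.\<close>

definition profile :: "real \<Rightarrow> real \<Rightarrow> real \<Rightarrow> real \<Rightarrow> real" where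
  "profile q g B y = (B - min y g) powr (- q) + q * (B - g) powr (- q) * (1 - exp (- (max y g - g) / (B - g)))"

definition profile2 :: "real \<Rightarrow> real \<Rightarrow> real \<Rightarrow> real \<Rightarrow> real" where
  "profile2 q g B y = (if y \<le> g then q * (q + 1) * (B - y) powr (- q - 2)
     else - (q * (B - g) powr (- q - 2) * exp (- (y - g) / (B - g))))"

lemma profile_left: "y \<le> g \<Longrightarrow> profile q g B y = (B - y) powr (- q)"
  by (simp add: profile_def)

lemma profile_bounds:
  assumes "0 < q" "g < B"
  shows "0 < profile q g B y" "profile q g B y \<le> (1 + q) * (B - g) powr (- q)"
    and "g \<le> y \<Longrightarrow> (B - g) powr (- q) \<le> profile q g B y"
proof -
  let ?e = "exp (- (max y g - g) / (B - g))"
  have e: "0 < ?e" "?e \<le> 1" using assms by (auto simp: divide_nonpos_pos)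
  have p: "0 < (B - g) powr (- q)" using assms by simp
  have "0 < B - min y g" "B - g \<le> B - min y g" using assms by auto
  then have l: "0 < (B - min y g) powr (- q)" "(B - min y g) powr (- q) \<le> (B - g) powr (- q)"
    using assms by (auto intro!: powr_mono2')
  have r: "0 \<le> q * (B - g) powr (- q) * (1 - ?e)" "q * (B - g) powr (- q) * (1 - ?e) \<le> q * (B - g) powr (- q) * 1"
    using assms p e by (auto intro!: mult_nonneg_nonneg mult_left_mono simp del: mult_1_right)
  show "0 < profile q g B y" "profile q g B y \<le> (1 + q) * (B - g) powr (- q)"
    using add_pos_nonneg[OF l(1) r(1)] add_mono[OF l(2) r(2)] by (auto simp: profile_def distrib_right)
  show "(B - g) powr (- q) \<le> profile q g B y" if "g \<le> y"
    using that r(1) by (simp add: profile_def)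
qed

lemma profile_C11:
  assumes "0 < q" "g < B"
  shows "bounded_C11 (profile q g B) (profile2 q g B)"
proof -
  define r where "r = B - g"
  have r: "0 < r" using assms by (simp add: r_def)
  \<comment> \<open>The relaxation length r = B - g of the exponential is chosen so that both
    one-sided slopes at g are q r^(-q-1); the min/max form joins the two branches into one visibly
    continuous formula.\<close>
  let ?P1 = "\<lambda>y. q * (B - min y g) powr (- q - 1) * exp (- (max y g - g) / r)"
  have pos: "0 < B - min y g" "r \<le> B - min y g" for y using assms by (auto simp: r_def)
  show ?thesis
  proof (rule bounded_C11I[where S="{g}" and ?U1.0="?P1"])
    show "continuous_on UNIV (profile q g B)"
      unfolding profile_def[abs_def] using pos(1) assms by (intro continuous_intros) (auto simp: less_imp_neq[symmetric] dest: less_imp_neq)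
    show "continuous_on UNIV ?P1"
      using pos(1) r by (intro continuous_intros) (auto dest: less_imp_neq)
    show "profile2 q g B \<in> borel_measurable borel"
      unfolding profile2_def[abs_def] by measurable
    show "\<bar>profile q g B y\<bar> \<le> (1 + q) * r powr (- q)" for y
      using profile_bounds[OF assms, of y] by (simp add: r_def)
    show "\<bar>?P1 y\<bar> \<le> q * r powr (- q - 1) * 1" for y
    proof -
      have "(B - min y g) powr (- q - 1) \<le> r powr (- q - 1)"
        using pos r assms by (intro powr_mono2') auto
      then have "q * (B - min y g) powr (- q - 1) * exp (- (max y g - g) / r) \<le> q * r powr (- q - 1) * 1"
        using assms r by (intro mult_mono) (auto simp: divide_nonpos_pos)
      then show ?thesis using assms by (simp add: abs_mult)
    qed
    show "\<bar>profile2 q g B y\<bar> \<le> q * (q + 1) * r powr (- q - 2)" for y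
    proof (cases "y \<le> g")
      case True
      then have "(B - y) powr (- q - 2) \<le> r powr (- q - 2)"
        using r assms by (intro powr_mono2') (auto simp: r_def)
      with True show ?thesis using assms by (simp add: profile2_def abs_mult)
    next
      case False
      have "q * r powr (- q - 2) * exp (- (y - g) / r) \<le> q * r powr (- q - 2) * 1"
        using False assms r by (intro mult_left_mono) (auto simp: divide_nonpos_pos)
      also have "\<dots> \<le> q * (q + 1) * r powr (- q - 2)"
        using assms by (simp add: algebra_simps)
      finally show ?thesis using False assms by (simp add: profile2_def abs_mult r_def)
    qed
    fix y assume "y \<notin> {g}"
    then consider "y < g" | "g < y" by fastforce
    then show "(profile q g B has_real_derivative ?P1 y) (at y)"
    proof cases
      case 1
      have "((\<lambda>y. (B - y) powr (- q)) has_real_derivative q * (B - y) powr (- q - 1)) (at y)"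
        using 1 assms by (auto intro!: derivative_eq_intros)
      then have "(profile q g B has_real_derivative q * (B - y) powr (- q - 1)) (at y)"
        by (rule has_field_derivative_transform_within_open[where S="{..<g}"]) (use 1 in \<open>auto simp: profile_left\<close>)
      with 1 show ?thesis by simp
    next
      case 2
      have "((\<lambda>y. r powr (- q) + q * r powr (- q) * (1 - exp (- (y - g) / r))) has_real_derivative
        q * r powr (- q) * (exp (- (y - g) / r) * (1 / r))) (at y)"
        using r by (auto intro!: derivative_eq_intros)
      then have "(profile q g B has_real_derivative q * r powr (- q) * (exp (- (y - g) / r) * (1 / r))) (at y)"
        by (rule has_field_derivative_transform_within_open[where S="{g<..}"]) (use 2 in \<open>auto simp: profile_def r_def\<close>)
      moreover have "r powr (- q - 1) = r powr (- q) / r" using r by (simp add: powr_diff)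
      ultimately show ?thesis using 2 by (simp add: r_def)
    qed
    consider "y < g" | "g < y" using \<open>y \<notin> {g}\<close> by fastforce
    then show "(?P1 has_real_derivative profile2 q g B y) (at y)"
    proof cases
      case 1
      have "((\<lambda>y. q * (B - y) powr (- q - 1)) has_real_derivative q * ((q + 1) * (B - y) powr (- q - 2))) (at y)"
        using 1 assms by (auto intro!: derivative_eq_intros simp: algebra_simps)
      then have "(?P1 has_real_derivative q * ((q + 1) * (B - y) powr (- q - 2))) (at y)"
        by (rule has_field_derivative_transform_within_open[where S="{..<g}"]) (use 1 in auto)
      with 1 show ?thesis by (simp add: profile2_def mult.assoc)
    next
      case 2
      have "((\<lambda>y. q * r powr (- q - 1) * exp (- (y - g) / r)) has_real_derivative
        q * r powr (- q - 1) * (exp (- (y - g) / r) * (- 1 / r))) (at y)"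
        using r by (auto intro!: derivative_eq_intros)
      then have "(?P1 has_real_derivative q * r powr (- q - 1) * (exp (- (y - g) / r) * (- 1 / r))) (at y)"
        by (rule has_field_derivative_transform_within_open[where S="{g<..}"]) (use 2 in \<open>auto simp: r_def\<close>)
      moreover have "r powr (- q - 2) = r powr (- q - 1) / r"
      proof -
        have "- q - 2 = (- q - 1) - 1" by simp
        then have "r powr (- q - 2) = r powr (- q - 1) / r powr 1" by (metis powr_diff)
        then show ?thesis using r by simp
      qed
      ultimately show ?thesis using 2 by (simp add: profile2_def r_def)
    qed
  qed simp
qed

section \<open>Barriers, the law of the right end point and the mass near it\<close>

context occupation_field
begin

definition p where "p = 2 / \<beta>"

text \<open>The constant for which \<open>U = A (B - y)\<^bsup>-p\<^esup>\<close> solves \<open>U'' / 2 = U\<^bsup>1+\<beta>\<^esup>\<close>.\<close>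

definition A where "A = (p * (p + 1) / 2) powr (1 / \<beta>)"

lemma p_gt: "2 < p" using beta by (simp add: p_def field_simps)

lemma p_beta: "p * \<beta> = 2" using beta by (simp add: p_def)

lemma p_one_beta: "p * (1 + \<beta>) = p + 2" using p_beta by (simp add: algebra_simps)

lemma A_powr: "A powr \<beta> = p * (p + 1) / 2"
  using beta p_gt by (simp add: A_def powr_powr)

text \<open>The margin matters in \<open>increment_bound\<close>: since A / 2 > 1, a perturbation of
  height r^(-p) stays below half the barrier, and half the barrier still has a power at least
  r^(-p-2).\<close>

lemma A_gt: "3 < A"
proof -
  have "2 * 3 < p * (p + 1)" using p_gt by (intro mult_strict_mono) auto
  then have 3: "3 < p * (p + 1) / 2" by simp
  also have "\<dots> = (p * (p + 1) / 2) powr 1" using 3 by simp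
  also have "\<dots> \<le> A" unfolding A_def using beta 3 by (intro powr_mono) auto
  finally show ?thesis .
qed

lemma A_powr_one: "A powr (1 + \<beta>) = A * (p * (p + 1) / 2)"
  using A_gt A_powr by (simp add: powr_add)

definition barrier where "barrier g B y = A * profile p g B y"

definition barrier2 where "barrier2 g B y = A * profile2 p g B y"

abbreviation "pot g B \<equiv> potential \<beta> (barrier g B) (barrier2 g B)"

lemma barrier_C11: "g < B \<Longrightarrow> bounded_C11 (barrier g B) (barrier2 g B)"
  unfolding barrier_def[abs_def] barrier2_def[abs_def] using p_gt by (intro bounded_C11_cmult profile_C11) auto

lemma barrier_pos: "g < B \<Longrightarrow> 0 < barrier g B y"
  unfolding barrier_def using A_gt p_gt by (intro mult_pos_pos profile_bounds) auto

lemma barrier_right: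
  assumes "g < B"
  shows "barrier g B y \<le> A * (1 + p) * (B - g) powr (- p)" "g \<le> y \<Longrightarrow> A * (B - g) powr (- p) \<le> barrier g B y"
  unfolding barrier_def using A_gt p_gt profile_bounds[OF _ assms, of p y] by auto

lemma powr_power_law: "0 < r \<Longrightarrow> (c * r powr (- p)) powr (1 + \<beta>) = c powr (1 + \<beta>) * r powr (- p - 2)"
  using p_one_beta by (simp add: powr_mult powr_powr)

lemma pot_left:
  assumes "g < B" "y \<le> g"
  shows "pot g B y = 0"
  using assms by (simp add: potential_def barrier_def barrier2_def profile_left profile2_def powr_power_law A_powr_one)

definition K1 where "K1 = (A * (1 + p)) powr (1 + \<beta>) + A * p / 2"

lemma barrier2_right:
  assumes "g < B" "g < y"
  shows "barrier2 g B y \<le> 0" "- barrier2 g B y \<le> A * p * (B - g) powr (- p - 2)"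
proof -
  have *: "- barrier2 g B y = A * p * (B - g) powr (- p - 2) * exp (- (y - g) / (B - g))"
    using assms by (simp add: barrier2_def profile2_def)
  have "0 \<le> A * p * (B - g) powr (- p - 2) * exp (- (y - g) / (B - g))"
    using A_gt p_gt by simp
  then show "barrier2 g B y \<le> 0" using * by linarith
  show "- barrier2 g B y \<le> A * p * (B - g) powr (- p - 2)"
    unfolding * using assms A_gt p_gt by (intro mult_left_le) (auto simp: divide_nonpos_pos)
qed

lemma pot_right:
  assumes "g < B" "g < y"
  shows "(A * (B - g) powr (- p)) powr (1 + \<beta>) \<le> pot g B y" "pot g B y \<le> K1 * (B - g) powr (- p - 2)"
proof -
  have r: "0 < B - g" using assms by simp
  note b2 = barrier2_right[OF assms]
  have "(A * (B - g) powr (- p)) powr (1 + \<beta>) \<le> barrier g B y powr (1 + \<beta>)"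
    using barrier_right(2)[OF assms(1), of y] assms A_gt beta by (intro powr_mono2) auto
  then show "(A * (B - g) powr (- p)) powr (1 + \<beta>) \<le> pot g B y"
    using b2 by (simp add: potential_def)
  have "barrier g B y powr (1 + \<beta>) \<le> (A * (1 + p) * (B - g) powr (- p)) powr (1 + \<beta>)"
    using barrier_right(1)[OF assms(1), of y] less_imp_le[OF barrier_pos[OF assms(1), of y]] beta by (intro powr_mono2) auto
  also have "\<dots> = (A * (1 + p)) powr (1 + \<beta>) * (B - g) powr (- p - 2)"
    using r by (rule powr_power_law)
  finally show "pot g B y \<le> K1 * (B - g) powr (- p - 2)"
    using b2 by (simp add: potential_def K1_def algebra_simps)
qed

lemma pot_nonneg: "g < B \<Longrightarrow> 0 \<le> pot g B y"
  using pot_left[of g B y] pot_right(1)[of g B y] by (cases "y \<le> g") (auto intro: order_trans[OF powr_ge_zero])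

lemma weight_pot: "g < B \<Longrightarrow> weight (pot g B)"
  using barrier_C11 barrier_pos by (intro weight_potential) (auto intro: less_imp_le)

lemma laplace_barrier:
  assumes "0 \<le> g" "g < B"
  shows "expectation (\<lambda>\<omega>. exp (- occ (pot g B) \<omega>)) = exp (- (A * B powr (- p)))"
  using laplace_occ[OF barrier_C11[OF assms(2)] less_imp_le[OF barrier_pos[OF assms(2)]] pot_nonneg[OF assms(2)]] assms
  by (simp add: barrier_def profile_left)

lemma occ_pot_eq_0:
  assumes "g < B" "rgt \<omega> \<le> g"
  shows "occ (pot g B) \<omega> = 0"
  using assms by (intro occ_eq_0 pot_left) auto

text \<open>The potential lives to the right of g, so its weight equals 1 on the event R \<le>
  g.\<close>

lemma survival_upper:
  assumes "0 \<le> g" "g < B"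
  shows "prob {\<omega> \<in> space M. rgt \<omega> \<le> g} \<le> exp (- (A * B powr (- p)))"
proof -
  have "prob {\<omega> \<in> space M. rgt \<omega> \<le> g} = expectation (indicator {\<omega> \<in> space M. rgt \<omega> \<le> g})"
    by simp
  also have "\<dots> \<le> expectation (\<lambda>\<omega>. exp (- occ (pot g B) \<omega>))"
  proof (rule integral_mono)
    show "integrable M (\<lambda>\<omega>. exp (- occ (pot g B) \<omega>))"
      using assms by (intro integrable_exp_occ weight_pot pot_nonneg) auto
    show "indicator {\<omega> \<in> space M. rgt \<omega> \<le> g} \<omega> \<le> exp (- occ (pot g B) \<omega>)" for \<omega>
      using occ_pot_eq_0[OF assms(2), of \<omega>] by (auto simp: indicator_def)
  qed (simp add: less_top[symmetric])
  also have "\<dots> = exp (- (A * B powr (- p)))" by (rule laplace_barrier[OF assms])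
  finally show ?thesis .
qed

lemma occ_tail_pos:
  assumes pos: "\<And>x. lft \<omega> < x \<Longrightarrow> x < rgt \<omega> \<Longrightarrow> 0 < \<Lambda> x \<omega>" and "lft \<omega> \<le> g" "g < rgt \<omega>"
  shows "0 < occ (indicator {g<..}) \<omega>"
proof -
  have i: "integrable lborel (\<lambda>y. indicator {g<..} y * \<Lambda> y \<omega>)"
    by (intro occ_integrable weight_indicator) auto
  have "\<not> (AE y in lborel. indicator {g<..} y * \<Lambda> y \<omega> = 0)"
  proof
    assume "AE y in lborel. indicator {g<..} y * \<Lambda> y \<omega> = 0"
    then have "AE y in lborel. y \<notin> {g<..<rgt \<omega>}"
    proof eventually_elim
      case (elim y)
      then show ?case using pos[of y] assms(2) by (auto simp: indicator_def)
    qed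
    then have "emeasure lborel {g<..<rgt \<omega>} = 0"
      by (subst (asm) AE_iff_measurable[where N="{g<..<rgt \<omega>}"]) auto
    with \<open>g < rgt \<omega>\<close> show False by simp
  qed
  then have "occ (indicator {g<..}) \<omega> \<noteq> 0"
    using integral_nonneg_eq_0_iff_AE[OF i] field_nonneg by (auto simp: occ_def)
  moreover have "0 \<le> occ (indicator {g<..}) \<omega>"
    by (intro occ_nonneg weight_indicator) auto
  ultimately show ?thesis by linarith
qed

text \<open>As B decreases to g the potential right of g is at least \<open>?c n\<close>, which
  tends to infinity, so in the limit the weight charges only outcomes without mass right of g. By
  \<open>occ_tail_pos\<close>, which rests on the positivity of the field up to R, these are the
  outcomes with R \<le> g. Together with the upper bound this determines the distribution function
  of R.\<close>

lemma survival_lower: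
  assumes "0 < g"
  shows "exp (- (A * g powr (- p))) \<le> prob {\<omega> \<in> space M. rgt \<omega> \<le> g}"
proof -
  let ?h = "indicator {g<..} :: real \<Rightarrow> real"
  let ?c = "\<lambda>n. (A * (1 / real (Suc n)) powr (- p)) powr (1 + \<beta>)"
  let ?E = "\<lambda>n. expectation (\<lambda>\<omega>. exp (- (?c n * occ ?h \<omega>)))"
  have h: "weight ?h" by (intro weight_indicator) auto
  have [measurable]: "occ ?h \<in> borel_measurable M" by (rule occ_measurable[OF h])
  have c_lim: "filterlim ?c at_top sequentially"
  proof -
    have "filterlim (\<lambda>n. (a * (1 / real (Suc n)) powr (- q)) powr (1 + b)) at_top sequentially"
      if "0 < a" "0 < b" "0 < q" for a b q :: real
      using that by real_asymp
    then show ?thesis using A_gt beta p_gt by simp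
  qed
  have "(\<lambda>n. exp (- (A * (g + 1 / real (Suc n)) powr (- p)))) \<longlonglongrightarrow> exp (- (A * (g + 0) powr (- p)))"
    using assms by (intro tendsto_intros LIMSEQ_Suc[OF lim_1_over_n]) auto
  moreover have "?E \<longlonglongrightarrow> expectation (indicator {\<omega> \<in> space M. rgt \<omega> \<le> g})"
  proof (rule integral_dominated_convergence[where w="\<lambda>_. 1"])
    show "AE \<omega> in M. (\<lambda>n. exp (- (?c n * occ ?h \<omega>))) \<longlonglongrightarrow> indicator {\<omega> \<in> space M. rgt \<omega> \<le> g} \<omega>"
      using field_positive AE_space
    proof eventually_elim
      case (elim \<omega>)
      show ?case
      proof (cases "rgt \<omega> \<le> g")
        case True
        then have "occ ?h \<omega> = 0" by (intro occ_eq_0) auto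
        with True elim show ?thesis by simp
      next
        case False
        then have pos: "0 < occ ?h \<omega>" using elim assms by (intro occ_tail_pos) auto
        have "(\<lambda>n. exp (- (?c n * occ ?h \<omega>))) \<longlonglongrightarrow> 0"
          by (intro filterlim_compose[OF exp_at_bot] filterlim_compose[OF filterlim_uminus_at_bot_at_top]
              filterlim_at_top_mult_tendsto_pos[OF tendsto_const pos c_lim])
        with False show ?thesis by simp
      qed
    qed
    show "AE \<omega> in M. norm (exp (- (?c n * occ ?h \<omega>))) \<le> 1" for n
      using occ_nonneg[OF h] by (auto intro!: AE_I2 mult_nonneg_nonneg)
  qed auto
  moreover have "exp (- (A * (g + 1 / real (Suc n)) powr (- p))) \<le> ?E n" for n
  proof -
    let ?B = "g + 1 / real (Suc n)"
    have B: "g < ?B" by simp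
    have "exp (- (A * ?B powr (- p))) = expectation (\<lambda>\<omega>. exp (- occ (pot g ?B) \<omega>))"
      using laplace_barrier[of g ?B] assms by simp
    also have "\<dots> \<le> ?E n"
    proof (rule integral_mono)
      show "integrable M (\<lambda>\<omega>. exp (- occ (pot g ?B) \<omega>))"
        using B by (intro integrable_exp_occ weight_pot pot_nonneg)
      show "integrable M (\<lambda>\<omega>. exp (- (?c n * occ ?h \<omega>)))"
        using occ_nonneg[OF h] by (intro integrable_const_bound[where B=1]) (auto intro!: mult_nonneg_nonneg)
      fix \<omega>
      have "occ (\<lambda>y. ?c n * ?h y) \<omega> \<le> occ (pot g ?B) \<omega>"
      proof (intro occ_mono weight_cmult h weight_pot B)
        fix y show "?c n * ?h y \<le> pot g ?B y"
          using pot_right(1)[OF B, of y] pot_nonneg[OF B, of y] by (auto simp: indicator_def simp del: of_nat_Suc)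
      qed
      then show "exp (- occ (pot g ?B) \<omega>) \<le> exp (- (?c n * occ ?h \<omega>))" by (simp add: occ_cmult)
    qed
    finally show ?thesis .
  qed
  ultimately show ?thesis
    by (simp add: LIMSEQ_le[of _ _ ?E])
qed

lemma survival_between:
  assumes "0 < g" "0 < e"
  shows "prob {\<omega> \<in> space M. g < rgt \<omega> \<and> rgt \<omega> \<le> g + e} \<le> 2 * A * p * g powr (- p - 1) * e"
proof -
  have "{\<omega> \<in> space M. g < rgt \<omega> \<and> rgt \<omega> \<le> g + e} = {\<omega> \<in> space M. rgt \<omega> \<le> g + e} - {\<omega> \<in> space M. rgt \<omega> \<le> g}"
    by auto
  also have "prob \<dots> = prob {\<omega> \<in> space M. rgt \<omega> \<le> g + e} - prob {\<omega> \<in> space M. rgt \<omega> \<le> g}"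
    using assms by (intro finite_measure_Diff) auto
  \<comment> \<open>\<open>survival_upper\<close> asks for a singularity strictly to the right of g
    + e; placing it at g + 2 e is the origin of the factor 2 in the bound.\<close>
  also have "\<dots> \<le> exp (- (A * (g + 2 * e) powr (- p))) - exp (- (A * g powr (- p)))"
    using survival_upper[of "g + e" "g + 2 * e"] survival_lower[of g] assms by simp
  also have "\<dots> \<le> A * g powr (- p) - A * (g + 2 * e) powr (- p)"
  proof -
    let ?a = "A * (g + 2 * e) powr (- p)" and ?b = "A * g powr (- p)"
    have "?a \<le> ?b" using assms A_gt p_gt by (intro mult_left_mono powr_mono2') auto
    have "exp (- ?a) - exp (- ?b) = exp (- ?a) * (1 - exp (?a - ?b))"
      by (simp add: right_diff_distrib exp_add[symmetric])
    also have "\<dots> \<le> 1 * (1 - exp (?a - ?b))"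
      using \<open>?a \<le> ?b\<close> A_gt by (intro mult_right_mono) auto
    also have "\<dots> \<le> ?b - ?a" using exp_ge_add_one_self[of "?a - ?b"] unfolding mult_1_left by linarith
    finally show ?thesis .
  qed
  also have "\<dots> = A * g powr (- p) * (1 - (1 + 2 * e / g) powr (- p))"
  proof -
    have "g + 2 * e = g * (1 + 2 * e / g)" using assms by (simp add: field_simps)
    then have "(g + 2 * e) powr (- p) = g powr (- p) * (1 + 2 * e / g) powr (- p)"
      by (metis powr_mult)
    then show ?thesis by (simp add: right_diff_distrib)
  qed
  also have "\<dots> \<le> A * g powr (- p) * (p * (2 * e / g))"
  proof (intro mult_left_mono)
    define s where "s = 2 * e / g"
    have s: "0 < s" using assms by (simp add: s_def)
    have "1 - p * s \<le> 1 - p * ln (1 + s)"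
      using ln_add_one_self_le_self[of s] s p_gt by (intro diff_left_mono mult_left_mono) auto
    also have "\<dots> \<le> exp (- p * ln (1 + s))" using exp_ge_add_one_self[of "- p * ln (1 + s)"] by simp
    also have "\<dots> = (1 + s) powr (- p)" using s by (simp add: powr_def)
    finally show "1 - (1 + 2 * e / g) powr (- p) \<le> p * (2 * e / g)" by (simp add: s_def)
  qed (use A_gt in auto)
  also have "\<dots> = 2 * A * p * g powr (- p - 1) * e"
    using assms powr_diff[of g "- p" 1] by simp
  finally show ?thesis .
qed

text \<open>The functions A (B - y)^(-p) solve U'' / 2 = U^(1+\<beta>) for every B. Differentiating
  in B shows that (B - y)^(-p-1) solves the linearised equation, hence the exponent p + 1. The two
  cut-off points g and g' may differ, as they do in the next lemma.\<close>

lemma linearised_left: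
  assumes "g < B" "y \<le> g" "y \<le> g'"
  shows "(1 + \<beta>) * barrier g' B y powr \<beta> * profile (p + 1) g B y - profile2 (p + 1) g B y / 2 = 0"
proof -
  have B: "0 < B - y" using assms by simp
  have "barrier g' B y powr \<beta> = p * (p + 1) / 2 * (B - y) powr (- 2)"
    using assms B p_beta by (simp add: barrier_def profile_left powr_mult powr_powr A_powr)
  moreover have "(B - y) powr (- 2) * (B - y) powr (- (p + 1)) = (B - y) powr (- p - 3)"
  proof -
    have "- 2 + - (p + 1) = - p - 3" by simp
    then show ?thesis by (metis powr_add)
  qed
  ultimately have "(1 + \<beta>) * barrier g' B y powr \<beta> * profile (p + 1) g B y
      = (p * (1 + \<beta>)) * (p + 1) / 2 * (B - y) powr (- p - 3)"
  proof -
    assume a: "barrier g' B y powr \<beta> = p * (p + 1) / 2 * (B - y) powr (- 2)"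
      and b: "(B - y) powr (- 2) * (B - y) powr (- (p + 1)) = (B - y) powr (- p - 3)"
    have "(1 + b) * (q * (q + 1) / 2 * u) * v = (q * (1 + b)) * (q + 1) / 2 * (u * v)" for b q u v :: real
      by (simp add: field_simps)
    then show ?thesis unfolding a profile_left[OF assms(2)] b[symmetric] .
  qed
  then show ?thesis
    using assms unfolding p_one_beta by (simp add: profile2_def algebra_simps)
qed

text \<open>The barrier is cut at g + e and does not see outcomes with R \<le> g + e, whereas the
  test function w is cut already at g. Left of g it is in the kernel of the linearised operator; in
  the window its concave continuation supplies the lower bound. The result is w 0, of order e^(p+3)
  by the choice of the prefactor.\<close>

lemma occupation_before_extinction:
  assumes "0 < g" "0 < e"
  shows "integrable M (\<lambda>\<omega>. indicator {\<omega> \<in> space M. rgt \<omega> \<le> g + e} \<omega> * occ (indicator {g<..g + e}) \<omega>)"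
    and "expectation (\<lambda>\<omega>. indicator {\<omega> \<in> space M. rgt \<omega> \<le> g + e} \<omega> * occ (indicator {g<..g + e}) \<omega>)
      \<le> 2 powr (p + 5) * g powr (- p - 1) * e powr (p + 3)"
proof -
  let ?B = "g + 2 * e"
  \<comment> \<open>Chosen so that - w'' / 2 = 2 exp(- (y - g) / (2 e)) right of g, which is at
    least 1 on the window because the exponent is at least - 1/2 there.\<close>
  define K where "K = 4 * (2 * e) powr (p + 3) / (p + 1)"
  have K: "0 < K" using assms p_gt by (simp add: K_def)
  let ?w = "\<lambda>y. K * profile (p + 1) g ?B y" and ?w2 = "\<lambda>y. K * profile2 (p + 1) g ?B y"
  let ?h = "indicator {g<..g + e} :: real \<Rightarrow> real"
  have gB: "g < ?B" "g + e < ?B" using assms by auto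
  have h: "weight ?h" by (intro weight_indicator) auto
  have ineq: "?h y \<le> (1 + \<beta>) * barrier (g + e) ?B y powr \<beta> * ?w y - ?w2 y / 2" for y
  proof (cases "y \<le> g")
    case True
    have "(1 + \<beta>) * barrier (g + e) ?B y powr \<beta> * ?w y - ?w2 y / 2 =
      K * ((1 + \<beta>) * barrier (g + e) ?B y powr \<beta> * profile (p + 1) g ?B y - profile2 (p + 1) g ?B y / 2)"
      by (simp add: algebra_simps)
    also have "\<dots> = 0" using linearised_left[OF gB(1), of y "g + e"] True assms by simp
    finally have z: "(1 + \<beta>) * barrier (g + e) ?B y powr \<beta> * ?w y - ?w2 y / 2 = 0" .
    show ?thesis unfolding z using True by simp
  next
    case False
    have w: "0 \<le> (1 + \<beta>) * barrier (g + e) ?B y powr \<beta> * ?w y"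
      using beta K less_imp_le[OF profile_bounds(1)[of "p + 1" g ?B y]] p_gt gB by simp
    have w2: "- ?w2 y = K * (p + 1) * (2 * e) powr (- (p + 3)) * exp (- (y - g) / (2 * e))"
      using False by (simp add: profile2_def algebra_simps)
    also have "\<dots> = 4 * exp (- (y - g) / (2 * e))"
    proof -
      have "(2 * e) powr (p + 3) * (2 * e) powr (- (p + 3)) = 1"
        using assms by (simp add: powr_add[symmetric])
      then show ?thesis using p_gt by (simp add: K_def)
    qed
    finally have w2: "- ?w2 y / 2 = 2 * exp (- (y - g) / (2 * e))" by simp
    have "?h y \<le> 2 * exp (- (y - g) / (2 * e))"
    proof (cases "y \<le> g + e")
      case True
      have "- (1 / 2) \<le> - (y - g) / (2 * e)" using True assms by (simp add: field_simps)
      then have "1 / 2 \<le> exp (- (y - g) / (2 * e))"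
        using exp_ge_add_one_self[of "- (y - g) / (2 * e)"] by linarith
      then show ?thesis by (simp add: indicator_def)
    qed simp
    then show ?thesis using w w2 by linarith
  qed
  note fm = first_moment[OF barrier_C11[OF gB(2)] less_imp_le[OF barrier_pos[OF gB(2)]] pot_nonneg[OF gB(2)]
      bounded_C11_cmult[OF profile_C11[of "p + 1" g ?B], of K] _ h _ ineq]
  have prem: "0 < p + 1" "0 \<le> ?w y" "0 \<le> ?h y" for y
    using p_gt gB K less_imp_le[OF profile_bounds(1)[of "p + 1" g ?B y]] by auto
  note fm = fm[OF prem(1) gB(1) prem(2) prem(3)]
  let ?F = "\<lambda>\<omega>. indicator {\<omega> \<in> space M. rgt \<omega> \<le> g + e} \<omega> * occ ?h \<omega>"
  let ?G = "\<lambda>\<omega>. exp (- occ (pot (g + e) ?B) \<omega>) * occ ?h \<omega>"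
  have oh: "0 \<le> occ ?h \<omega>" for \<omega> using occ_nonneg[OF h] by simp
  have le: "?F \<omega> \<le> ?G \<omega>" for \<omega>
    using oh[of \<omega>] occ_pot_eq_0[OF gB(2), of \<omega>] by (auto simp: indicator_def)
  have [measurable]: "occ ?h \<in> borel_measurable M" by (rule occ_measurable[OF h])
  show i: "integrable M ?F"
    by (rule Bochner_Integration.integrable_bound[OF fm(1)])
      (use le oh in \<open>auto intro!: AE_I2 simp: abs_mult\<close>)
  have "expectation ?F \<le> expectation ?G" by (rule integral_mono[OF i fm(1) le])
  also have "\<dots> \<le> K * profile (p + 1) g ?B 0" by (rule fm(2))
  also have "\<dots> = K * ?B powr (- p - 1)" using assms by (simp add: profile_left)
  also have "\<dots> \<le> (2 powr (p + 5) * e powr (p + 3)) * g powr (- p - 1)"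
  proof (intro mult_mono)
    have "K \<le> 4 * (2 * e) powr (p + 3) / 1"
      unfolding K_def using p_gt by (intro divide_left_mono) auto
    then have "K \<le> 4 * (2 * e) powr (p + 3)" by simp
    also have "\<dots> = 2 powr (p + 5) * e powr (p + 3)"
      using powr_add[of 2 2 "p + 3"] by (simp add: powr_mult add.commute)
    finally show "K \<le> 2 powr (p + 5) * e powr (p + 3)" .
    show "?B powr (- p - 1) \<le> g powr (- p - 1)" using assms p_gt by (intro powr_mono2') auto
  qed auto
  finally show "expectation ?F \<le> 2 powr (p + 5) * g powr (- p - 1) * e powr (p + 3)" by (simp add: ac_simps)
qed

text \<open>Here both functions are cut at g, and the mass is measured on a whole half line. The
  concave part of w decays there, so the zeroth order term has to do the work: U^\<beta> is at least
  r^(-2) and w at least r^(p+3) r^(-p-1) = r^2, and their product is at least 1. This is the moment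
  that bounds the curvature term k in \<open>second_moment\<close>.\<close>

lemma occupation_beyond_barrier:
  assumes "0 < g" "0 < r"
  shows "integrable M (\<lambda>\<omega>. exp (- occ (pot g (g + r)) \<omega>) * occ (indicator {g<..}) \<omega>)"
    and "expectation (\<lambda>\<omega>. exp (- occ (pot g (g + r)) \<omega>) * occ (indicator {g<..}) \<omega>)
      \<le> g powr (- p - 1) * r powr (p + 3)"
proof -
  let ?B = "g + r"
  let ?K = "r powr (p + 3)"
  let ?w = "\<lambda>y. ?K * profile (p + 1) g ?B y" and ?w2 = "\<lambda>y. ?K * profile2 (p + 1) g ?B y"
  let ?h = "indicator {g<..} :: real \<Rightarrow> real"
  have gB: "g < ?B" using assms by auto
  have h: "weight ?h" by (intro weight_indicator) auto
  have prem: "0 < p + 1" "0 \<le> ?w y" "0 \<le> ?h y" for y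
    using p_gt gB less_imp_le[OF profile_bounds(1)[of "p + 1" g ?B y]] by auto
  have ineq: "?h y \<le> (1 + \<beta>) * barrier g ?B y powr \<beta> * ?w y - ?w2 y / 2" for y
  proof (cases "y \<le> g")
    case True
    have "(1 + \<beta>) * barrier g ?B y powr \<beta> * ?w y - ?w2 y / 2 =
      ?K * ((1 + \<beta>) * barrier g ?B y powr \<beta> * profile (p + 1) g ?B y - profile2 (p + 1) g ?B y / 2)"
      by (simp add: algebra_simps)
    also have "\<dots> = 0" using linearised_left[OF gB, of y g] True by simp
    finally have z: "(1 + \<beta>) * barrier g ?B y powr \<beta> * ?w y - ?w2 y / 2 = 0" .
    show ?thesis unfolding z using True by simp
  next
    case False
    have w2: "0 \<le> - ?w2 y" using False p_gt by (simp add: profile2_def)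
    have "3 \<le> p * (p + 1) / 2"
      using p_gt mult_mono[of 2 p 3 "p + 1"] by simp
    then have "r powr (- 2) \<le> A powr \<beta> * r powr (- 2)"
      using mult_right_mono[of 1 "A powr \<beta>" "r powr (- 2)"] by (simp add: A_powr)
    also have "\<dots> = (A * r powr (- p)) powr \<beta>" using p_beta assms by (simp add: powr_mult powr_powr)
    also have "\<dots> \<le> barrier g ?B y powr \<beta>"
      using barrier_right(2)[OF gB, of y] False A_gt beta by (intro powr_mono2) auto
    finally have u: "r powr (- 2) \<le> barrier g ?B y powr \<beta>" .
    have "1 = r powr (- 2 + ((p + 3) + - (p + 1)))"
      using assms by simp
    also have "\<dots> = r powr (- 2) * (?K * r powr (- (p + 1)))"
      by (simp only: powr_add)
    also have "\<dots> \<le> barrier g ?B y powr \<beta> * ?w y"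
      using u profile_bounds(3)[of "p + 1" g ?B y] p_gt gB False by (intro mult_mono) auto
    also have "\<dots> \<le> (1 + \<beta>) * (barrier g ?B y powr \<beta> * ?w y)"
      using beta prem mult_right_mono[of 1 "1 + \<beta>" "barrier g ?B y powr \<beta> * ?w y"] by simp
    finally show ?thesis using w2 by (simp add: indicator_def mult.assoc)
  qed
  note fm = first_moment[OF barrier_C11[OF gB] less_imp_le[OF barrier_pos[OF gB]] pot_nonneg[OF gB]
      bounded_C11_cmult[OF profile_C11[OF prem(1) gB], of ?K] prem(2) h prem(3) ineq]
  show "integrable M (\<lambda>\<omega>. exp (- occ (pot g ?B) \<omega>) * occ ?h \<omega>)" by (rule fm(1))
  have "expectation (\<lambda>\<omega>. exp (- occ (pot g ?B) \<omega>) * occ ?h \<omega>) \<le> ?K * profile (p + 1) g ?B 0"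
    by (rule fm(2))
  also have "\<dots> = ?K * ?B powr (- p - 1)" using assms by (simp add: profile_left)
  also have "\<dots> \<le> ?K * g powr (- p - 1)"
    using assms p_gt by (intro mult_left_mono powr_mono2') auto
  finally show "expectation (\<lambda>\<omega>. exp (- occ (pot g ?B) \<omega>) * occ ?h \<omega>) \<le> g powr (- p - 1) * r powr (p + 3)"
    by (simp add: mult.commute)
qed

end

section \<open>Increments of the local time near the right end point\<close>

text \<open>The smoothed step is the dipole integrated twice.\<close>

definition dipole :: "real \<Rightarrow> real \<Rightarrow> real \<Rightarrow> real" where
  "dipole x h y = indicator {x<..x + h} y - indicator {x + h<..x + 2 * h} y"

definition smooth_step :: "real \<Rightarrow> real \<Rightarrow> real \<Rightarrow> real" where
  "smooth_step x h y = (max 0 (y - x))\<^sup>2 / 2 - (max 0 (y - (x + h)))\<^sup>2 + (max 0 (y - (x + 2 * h)))\<^sup>2 / 2"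

lemma smooth_step_left: "y \<le> x \<Longrightarrow> 0 < h \<Longrightarrow> smooth_step x h y = 0"
  by (simp add: smooth_step_def)

lemma dipole_left: "y \<le> x \<Longrightarrow> 0 < h \<Longrightarrow> dipole x h y = 0"
  by (simp add: dipole_def)

lemma abs_dipole_le: "\<bar>dipole x h y\<bar> \<le> 1"
  by (auto simp: dipole_def indicator_def)

lemma smooth_step_bounds:
  assumes "0 < h"
  shows "0 \<le> smooth_step x h y" "smooth_step x h y \<le> h\<^sup>2"
proof -
  define z where "z = y - x"
  have s: "smooth_step x h y = (max 0 z)\<^sup>2 / 2 - (max 0 (z - h))\<^sup>2 + (max 0 (z - 2 * h))\<^sup>2 / 2"
    by (simp add: smooth_step_def z_def algebra_simps)
  consider "z \<le> 0" | "0 < z" "z \<le> h" | "h < z" "z \<le> 2 * h" | "2 * h < z" by linarith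
  then have "0 \<le> smooth_step x h y \<and> smooth_step x h y \<le> h\<^sup>2"
  proof cases
    case 1
    then show ?thesis using assms by (simp add: s)
  next
    case 2
    then have "smooth_step x h y = z\<^sup>2 / 2" using assms by (simp add: s)
    moreover have "z\<^sup>2 \<le> h\<^sup>2" using 2 by (intro power_mono) auto
    ultimately show ?thesis using zero_le_power2[of z] by linarith
  next
    case 3
    then have "smooth_step x h y = h\<^sup>2 - (2 * h - z)\<^sup>2 / 2"
      using assms by (simp add: s power2_eq_square field_simps)
    moreover have "(2 * h - z)\<^sup>2 \<le> h\<^sup>2" using 3 by (intro power_mono) auto
    ultimately show ?thesis using zero_le_power2[of "2 * h - z"] zero_le_power2[of h] by linarith
  next
    case 4
    then have "smooth_step x h y = h\<^sup>2"
      using assms by (simp add: s power2_eq_square field_simps)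
    then show ?thesis by simp
  qed
  then show "0 \<le> smooth_step x h y" "smooth_step x h y \<le> h\<^sup>2" by auto
qed

lemma smooth_step_C11:
  assumes "0 < h"
  shows "bounded_C11 (smooth_step x h) (dipole x h)"
proof -
  let ?D1 = "\<lambda>y. max 0 (y - x) - 2 * max 0 (y - (x + h)) + max 0 (y - (x + 2 * h))"
  have sq: "((\<lambda>y. (max 0 (y - a))\<^sup>2) has_real_derivative 2 * max 0 (y - a)) (at y)" if "y \<noteq> a" for a y :: real
  proof (cases "y < a")
    case True
    have "((\<lambda>y. 0) has_real_derivative 2 * max 0 (y - a)) (at y)" using True by simp
    then show ?thesis
      by (rule has_field_derivative_transform_within_open[where S="{..<a}"]) (use True in auto)
  next
    case False
    have "((\<lambda>y. (y - a)\<^sup>2) has_real_derivative 2 * max 0 (y - a)) (at y)"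
      using False by (auto intro!: derivative_eq_intros)
    then show ?thesis
      by (rule has_field_derivative_transform_within_open[where S="{a<..}"]) (use False that in auto)
  qed
  have lin: "((\<lambda>y. max 0 (y - a)) has_real_derivative indicator {a<..} y) (at y)" if "y \<noteq> a" for a y :: real
  proof (cases "y < a")
    case True
    have "((\<lambda>y. 0) has_real_derivative indicator {a<..} y) (at y)" using True by simp
    then show ?thesis
      by (rule has_field_derivative_transform_within_open[where S="{..<a}"]) (use True in auto)
  next
    case False
    have "((\<lambda>y. y - a) has_real_derivative indicator {a<..} y) (at y)"
      using False that by (auto intro!: derivative_eq_intros)
    then show ?thesis
      by (rule has_field_derivative_transform_within_open[where S="{a<..}"]) (use False that in auto)
  qed
  show ?thesis
  proof (rule bounded_C11I[where S="{x, x + h, x + 2 * h}" and ?U1.0="?D1" and ?K2.0=1])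
    show "continuous_on UNIV (smooth_step x h)"
      unfolding smooth_step_def[abs_def] by (intro continuous_intros) auto
    show "continuous_on UNIV ?D1" by (intro continuous_intros)
    show "dipole x h \<in> borel_measurable borel" unfolding dipole_def[abs_def] by measurable
    show "\<bar>smooth_step x h y\<bar> \<le> h\<^sup>2" for y using smooth_step_bounds[OF assms, of x y] by simp
    show "\<bar>?D1 y\<bar> \<le> h" for y using assms by (auto simp: max_def)
    fix y assume y: "y \<notin> {x, x + h, x + 2 * h}"
    show "(smooth_step x h has_real_derivative ?D1 y) (at y)"
      unfolding smooth_step_def[abs_def]
      by (rule DERIV_cong[OF DERIV_add[OF DERIV_diff[OF DERIV_cdivide[OF sq] sq] DERIV_cdivide[OF sq]]]) (use y in auto)
    have "(?D1 has_real_derivative indicator {x<..} y - 2 * indicator {x + h<..} y + indicator {x + 2 * h<..} y) (at y)"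
      by (rule DERIV_cong[OF DERIV_add[OF DERIV_diff[OF lin DERIV_cmult[OF lin]] lin]]) (use y in auto)
    then show "(?D1 has_real_derivative dipole x h y) (at y)"
      by (rule DERIV_cong) (use assms in \<open>auto simp: dipole_def indicator_def\<close>)
  qed (auto intro: abs_dipole_le)
qed

context occupation_field
begin

text \<open>The cap on the mass is what keeps the weight of the second moment bounded below. The
  parameter r is decoupled from e so that exceeding the cap can be made unlikely enough for
  Borel-Cantelli.\<close>

definition near :: "real \<Rightarrow> real \<Rightarrow> real \<Rightarrow> 'w set" where
  "near g e r = {\<omega> \<in> space M. g < rgt \<omega> \<and> rgt \<omega> \<le> g + e \<and> occ (indicator {g<..g + e}) \<omega> \<le> r powr (p + 2)}"

lemma near_measurable: "near g e r \<in> events"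
proof -
  have [measurable]: "occ (indicator {g<..g + e}) \<in> borel_measurable M"
    by (intro occ_measurable weight_indicator) auto
  show ?thesis unfolding near_def by measurable
qed

text \<open>The summands are the contributions of the correction v (first moment), of the square of
  d (second moment, with exp(2 K1) for removing the weight) and of the constant term of the
  arithmetic-geometric mean inequality (probability of the window). All three have the order h^2
  r^(p+1).\<close>

definition K2 where "K2 = 2 * (3 * K1 * 2 powr (p + 5) + exp (2 * K1) * K1 + A * p)"

lemma K1_pos: "0 < K1"
  unfolding K1_def using A_gt p_gt by (intro add_nonneg_pos) auto

lemma barrier_powr_le:
  assumes "g < B"
  shows "barrier g B y powr (1 + \<beta>) \<le> K1 * (B - g) powr (- p - 2)"
proof -
  have "barrier g B y powr (1 + \<beta>) \<le> (A * (1 + p) * (B - g) powr (- p)) powr (1 + \<beta>)"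
    using barrier_right(1)[OF assms, of y] less_imp_le[OF barrier_pos[OF assms, of y]] beta by (intro powr_mono2) auto
  also have "\<dots> = (A * (1 + p)) powr (1 + \<beta>) * (B - g) powr (- p - 2)"
    using assms by (intro powr_power_law) auto
  also have "\<dots> \<le> K1 * (B - g) powr (- p - 2)"
    unfolding K1_def using A_gt p_gt by (intro mult_right_mono) auto
  finally show ?thesis .
qed

text \<open>Apply the second moment bound to a multiple \<open>w\<close> of the smoothed step, scaled so that \<open>w''\<close> stays
  below the potential of the barrier.  Then \<open>d = v - w'' / 2\<close>, where the correction \<open>v\<close> comes from the
  nonlinearity and is controlled by the first moment.\<close>

lemma increment_bound:
  assumes g: "0 < g" "g \<le> x" and e: "0 < e" "e \<le> r" and h: "0 < h" "h \<le> e"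
  shows "integrable M (\<lambda>\<omega>. indicator (near g e r) \<omega> * \<bar>occ (dipole x h) \<omega>\<bar>)"
    and "expectation (\<lambda>\<omega>. indicator (near g e r) \<omega> * \<bar>occ (dipole x h) \<omega>\<bar>)
      \<le> K2 * g powr (- p - 1) * r powr (p + 1) * h\<^sup>2"
proof -
  have r: "0 < r" using e by simp
  let ?B = "g + r"
  have gB: "g < ?B" using r by simp
  \<comment> \<open>The potential right of g has order r^(-p-2), so this is the largest order that
    w'' may have if the potentials of U + w and U - w are to stay nonnegative. As l r^2 = r^(-p), w
    is then at most of the order of the barrier.\<close>
  define l where "l = r powr (- p - 2)"
  have l: "0 < l" using r by (simp add: l_def)
  let ?U = "barrier g ?B" and ?U2 = "barrier2 g ?B"
  define w where "w y = l * smooth_step x h y" for y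
  define w2 where "w2 y = l * dipole x h y" for y
  let ?f = "potential \<beta> ?U ?U2"
  note Upos = barrier_pos[OF gB]
  have wC: "bounded_C11 w w2"
    unfolding w_def[abs_def] w2_def[abs_def] by (intro bounded_C11_cmult smooth_step_C11 h)
  have w0: "0 \<le> w y" for y using smooth_step_bounds[OF h(1)] l by (simp add: w_def)
  have lr: "l * r\<^sup>2 = r powr (- p)"
    using r powr_add[of r "- p - 2" 2] by (simp add: l_def)
  have w_le: "w y \<le> l * h\<^sup>2" for y using smooth_step_bounds[OF h(1)] l by (simp add: w_def)
  have "h\<^sup>2 \<le> r\<^sup>2" using h e by (intro power_mono) auto
  then have "l * h\<^sup>2 \<le> r powr (- p)" using l lr by (metis mult_left_mono less_imp_le)
  then have w_r: "w y \<le> r powr (- p)" for y using w_le[of y] by linarith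
  have left: "w y = 0" "w2 y = 0" if "y \<le> g" for y
    using that g h by (auto simp: w_def w2_def smooth_step_left dipole_left)
  have abs_w2: "\<bar>w2 y\<bar> \<le> l" for y
    using abs_dipole_le[of x h y] l by (simp add: w2_def abs_mult mult_left_le)
  have U_ge: "A * r powr (- p) \<le> ?U y" if "g < y" for y
    using barrier_right(2)[OF gB, of y] that by simp
  have half: "w y \<le> ?U y / 2" for y
  proof (cases "y \<le> g")
    case True then show ?thesis using left Upos[of y] by simp
  next
    case False
    have "r powr (- p) \<le> (A / 2) * r powr (- p)"
      using A_gt mult_right_mono[of 1 "A / 2" "r powr (- p)"] by simp
    then show ?thesis using w_r[of y] U_ge[of y] False by simp
  qed
  have wU: "w y \<le> ?U y" for y using half[of y] w0[of y] by linarith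
  \<comment> \<open>Half of this lower bound absorbs w'' / 2, since w'' is at most l in absolute
    value; the concavity of the barrier right of g only helps.\<close>
  have big: "l \<le> (?U y - w y) powr (1 + \<beta>)" if "g < y" for y
  proof -
    have "(A / 2 * r powr (- p)) powr (1 + \<beta>) \<le> (?U y - w y) powr (1 + \<beta>)"
      using half[of y] U_ge[OF that] A_gt beta by (intro powr_mono2) auto
    moreover have "1 * l \<le> (A / 2) powr (1 + \<beta>) * l"
      using A_gt beta l by (intro mult_right_mono ge_one_powr_ge_zero) auto
    ultimately show ?thesis using powr_power_law[OF r, of "A / 2"] by (simp add: l_def)
  qed
  have big': "l \<le> (?U y + w y) powr (1 + \<beta>)" if "g < y" for y
    using big[OF that] w0[of y] wU[of y] beta powr_mono2[of "1 + \<beta>" "?U y - w y" "?U y + w y"] by simp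
  let ?plus = "potential \<beta> (\<lambda>y. ?U y + w y) (\<lambda>y. ?U2 y + w2 y)"
  let ?minus = "potential \<beta> (\<lambda>y. ?U y - w y) (\<lambda>y. ?U2 y - w2 y)"
  have at_left: "?plus y = ?f y" "?minus y = ?f y" if "y \<le> g" for y
    using left[OF that] by (auto simp: potential_def)
  have plus: "0 \<le> ?plus y" for y
  proof (cases "y \<le> g")
    case True then show ?thesis using at_left pot_nonneg[OF gB] by simp
  next
    case False
    then have gy: "g < y" by simp
    show ?thesis using big'[OF gy] barrier2_right(1)[OF gB gy] abs_le_D1[OF abs_w2[of y]] l
      by (simp add: potential_def)
  qed
  have minus: "0 \<le> ?minus y" for y
  proof (cases "y \<le> g")
    case True then show ?thesis using at_left pot_nonneg[OF gB] by simp
  next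
    case False
    then have gy: "g < y" by simp
    show ?thesis using big[OF gy] barrier2_right(1)[OF gB gy] abs_le_D2[OF abs_w2[of y]] l
      by (simp add: potential_def)
  qed
  let ?m = "\<lambda>y. (?plus y + ?minus y) / 2"
  let ?d = "\<lambda>y. (?plus y - ?minus y) / 2"
  define v where "v y = ((?U y + w y) powr (1 + \<beta>) - (?U y - w y) powr (1 + \<beta>)) / 2" for y
  note diffs = powr_symmetric_difference[OF beta Upos w0 wU]
  have U_powr: "?U y powr (1 + \<beta>) \<le> K1 * l" for y
    using barrier_powr_le[OF gB, of y] by (simp add: l_def)
  have ratio: "w y / ?U y \<le> h\<^sup>2 / r\<^sup>2" if "g < y" for y
  proof -
    have "w y / ?U y \<le> (l * h\<^sup>2) / (l * r\<^sup>2)"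
    proof (rule frac_le)
      have "l * r\<^sup>2 \<le> A * r powr (- p)"
        unfolding lr using A_gt mult_right_mono[of 1 A "r powr (- p)"] by simp
      then show "l * r\<^sup>2 \<le> ?U y" using U_ge[OF that] by linarith
    qed (use w_le w0 l r in auto)
    then show ?thesis using l by simp
  qed
  have ratio0: "0 \<le> w y / ?U y" for y using w0 Upos less_imp_le by (intro divide_nonneg_nonneg) auto
  \<comment> \<open>The power of the barrier, at most K1 l, times the square of the relative
    perturbation w / U \<le> h^2 / r^2.\<close>
  define kc where "kc = K1 * l * (h\<^sup>2 / r\<^sup>2)\<^sup>2"
  let ?k = "\<lambda>y. kc * indicator {g<..} y"
  have k: "weight ?k" by (intro weight_cmult weight_indicator) auto
  have m_le: "?m y \<le> ?f y + ?k y" for y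
  proof (cases "y \<le> g")
    case True then show ?thesis using at_left by simp
  next
    case False
    have "?m y - ?f y = ((?U y + w y) powr (1 + \<beta>) + (?U y - w y) powr (1 + \<beta>)) / 2 - ?U y powr (1 + \<beta>)"
      by (simp add: potential_def field_simps)
    also have "\<dots> \<le> ?U y powr (1 + \<beta>) * (w y / ?U y)\<^sup>2" by (rule diffs(2))
    also have "\<dots> \<le> (K1 * l) * (h\<^sup>2 / r\<^sup>2)\<^sup>2"
      using ratio[of y] ratio0[of y] False K1_pos l U_powr[of y] by (intro mult_mono power_mono) auto
    finally have "?m y - ?f y \<le> kc" by (simp only: kc_def)
    moreover have "?k y = kc" using False by simp
    ultimately show ?thesis by (simp only: diff_le_eq add.commute)
  qed
  note ob = occupation_beyond_barrier[OF g(1) r]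
  have ik: "integrable M (\<lambda>\<omega>. exp (- occ ?f \<omega>) * occ ?k \<omega>)"
    unfolding occ_cmult using integrable_mult_right[OF ob(1), of kc] by (simp add: mult.left_commute)
  have ek: "expectation (\<lambda>\<omega>. exp (- occ ?f \<omega>) * occ ?k \<omega>) \<le> kc * (g powr (- p - 1) * r powr (p + 3))"
  proof -
    have "expectation (\<lambda>\<omega>. exp (- occ ?f \<omega>) * occ ?k \<omega>) =
      kc * expectation (\<lambda>\<omega>. exp (- occ ?f \<omega>) * occ (indicator {g<..}) \<omega>)"
      unfolding occ_cmult by (simp add: mult.left_commute[of _ kc])
    also have "\<dots> \<le> kc * (g powr (- p - 1) * r powr (p + 3))"
      using ob(2) K1_pos l by (intro mult_left_mono) (auto simp: kc_def)
    finally show ?thesis .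
  qed
  have w_0: "w 0 = 0" using left(1)[of 0] g by simp
  note sm = second_moment[OF barrier_C11[OF gB] less_imp_le[OF Upos] pot_nonneg[OF gB] wC w0 wU w_0 plus minus k m_le ik ek]
  let ?G = "near g e r" and ?Y = "occ (indicator {g<..g + e})"
  have Y: "weight (indicator {g<..g + e})" by (intro weight_indicator) auto
  have dip: "weight (dipole x h)"
    by (rule weightI[OF bounded_C11_measurable(2)[OF smooth_step_C11[OF h(1)]] abs_dipole_le])
  have [measurable]: "?Y \<in> borel_measurable M" "occ ?d \<in> borel_measurable M" "occ (dipole x h) \<in> borel_measurable M"
    "?G \<in> events"
    by (auto intro: occ_measurable Y sm dip near_measurable)
  have Y0: "0 \<le> ?Y \<omega>" for \<omega> by (rule occ_nonneg[OF Y]) simp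
  have on_near: "?Y \<omega> \<le> r powr (p + 2)" "rgt \<omega> \<le> g + e" "g < rgt \<omega>" if "\<omega> \<in> ?G" for \<omega>
    using that by (auto simp: near_def)
  \<comment> \<open>All the mass right of g lies in the window, where m is at most 2 K1 l, and the
    cap in \<open>near\<close> is r^(p+2) = 1 / l. So the weight is at least exp(- 2 K1).\<close>
  have m_occ: "occ ?m \<omega> \<le> 2 * K1" if "\<omega> \<in> ?G" for \<omega>
  proof -
    have "occ ?m \<omega> \<le> occ (\<lambda>y. 2 * K1 * l * indicator {g<..g + e} y) \<omega>"
    proof (rule occ_mono[OF sm(1) weight_cmult[OF Y]])
      fix y assume "y < rgt \<omega>"
      then have yb: "y \<le> g + e" using on_near(2)[OF that] by simp
      show "?m y \<le> 2 * K1 * l * indicator {g<..g + e} y"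
      proof (cases "y \<le> g")
        case True
        then show ?thesis using at_left[OF True] pot_left[OF gB True] by simp
      next
        case False
        have "(w y / ?U y)\<^sup>2 \<le> 1\<^sup>2" using ratio0[of y] wU[of y] Upos[of y] by (intro power_mono) auto
        then have "?U y powr (1 + \<beta>) * (w y / ?U y)\<^sup>2 \<le> ?U y powr (1 + \<beta>) * 1"
          by (intro mult_left_mono) auto
        moreover have "?m y - ?f y \<le> ?U y powr (1 + \<beta>) * (w y / ?U y)\<^sup>2"
          using diffs(2)[of y] by (simp add: potential_def field_simps)
        moreover have "?f y \<le> K1 * l" using pot_right(2)[OF gB, of y] False by (simp add: l_def)
        ultimately have "?m y \<le> 2 * K1 * l" using U_powr[of y] by linarith
        then show ?thesis using False yb by simp
      qed
    qed
    also have "\<dots> = 2 * K1 * l * ?Y \<omega>" by (simp add: occ_cmult)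
    also have "\<dots> \<le> 2 * K1 * l * r powr (p + 2)"
      using on_near(1)[OF that] K1_pos l by (intro mult_left_mono) auto
    also have "\<dots> = 2 * K1 * (l * r powr (p + 2))" by (simp only: mult.assoc)
    also have "l * r powr (p + 2) = 1" using r by (simp add: l_def powr_add[symmetric])
    finally show ?thesis unfolding mult_1_right .
  qed
  have v_weight: "weight v"
  proof -
    have "v = (\<lambda>y. ?d y + 1 / 2 * w2 y)" by (auto simp: v_def potential_def field_simps)
    moreover have "weight w2" unfolding w2_def[abs_def] by (rule weight_cmult[OF dip])
    ultimately show ?thesis using weight_add[OF sm(2) weight_cmult[of w2 "1 / 2"]] by simp
  qed
  have v_occ: "occ v \<omega> \<le> 3 * K1 * l * (h\<^sup>2 / r\<^sup>2) * ?Y \<omega>" if "\<omega> \<in> ?G" for \<omega>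
  proof -
    have "occ v \<omega> \<le> occ (\<lambda>y. 3 * K1 * l * (h\<^sup>2 / r\<^sup>2) * indicator {g<..g + e} y) \<omega>"
    proof (rule occ_mono[OF v_weight weight_cmult[OF Y]])
      fix y assume "y < rgt \<omega>"
      then have yb: "y \<le> g + e" using on_near(2)[OF that] by simp
      show "v y \<le> 3 * K1 * l * (h\<^sup>2 / r\<^sup>2) * indicator {g<..g + e} y"
      proof (cases "y \<le> g")
        case True
        then show ?thesis using left by (simp add: v_def)
      next
        case False
        have "v y \<le> 3 * ?U y powr (1 + \<beta>) * (w y / ?U y)" unfolding v_def by (rule diffs(4))
        also have "\<dots> \<le> 3 * (K1 * l) * (h\<^sup>2 / r\<^sup>2)"
          using ratio[of y] ratio0[of y] False K1_pos l U_powr[of y] by (intro mult_mono) auto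
        finally show ?thesis using False yb by simp
      qed
    qed
    then show ?thesis by (simp only: occ_cmult)
  qed
  have v_nonneg: "0 \<le> occ v \<omega>" for \<omega>
    using diffs(3) by (intro occ_nonneg v_weight) (auto simp: v_def)
  have decomp: "l * occ (dipole x h) \<omega> = 2 * (occ v \<omega> - occ ?d \<omega>)" for \<omega>
  proof -
    have "(\<lambda>y. l * dipole x h y) = (\<lambda>y. 2 * (v y - ?d y))"
      by (auto simp: v_def potential_def w2_def field_simps)
    then have "occ (\<lambda>y. l * dipole x h y) \<omega> = occ (\<lambda>y. 2 * (v y - ?d y)) \<omega>" by (rule arg_cong)
    then show ?thesis unfolding occ_cmult by (simp add: occ_diff[OF v_weight sm(2)])
  qed
  let ?I1 = "\<lambda>\<omega>. indicator {\<omega> \<in> space M. rgt \<omega> \<le> g + e} \<omega> * ?Y \<omega>"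
  let ?I2 = "\<lambda>\<omega>. exp (- occ ?m \<omega>) * (occ ?d \<omega>)\<^sup>2"
  let ?I3 = "\<lambda>\<omega>. indicator {\<omega> \<in> space M. g < rgt \<omega> \<and> rgt \<omega> \<le> g + e} \<omega> :: real"
  let ?c1 = "3 * K1 * l * (h\<^sup>2 / r\<^sup>2)" and ?c2 = "r\<^sup>2 / (2 * h\<^sup>2) * exp (2 * K1)" and ?c3 = "h\<^sup>2 / r\<^sup>2 / 2"
  let ?Z = "\<lambda>\<omega>. 2 / l * (?c1 * ?I1 \<omega> + ?c2 * ?I2 \<omega> + ?c3 * ?I3 \<omega>)"
  let ?F = "\<lambda>\<omega>. indicator ?G \<omega> * \<bar>occ (dipole x h) \<omega>\<bar>"
  have Z0: "0 \<le> ?Z \<omega>" for \<omega>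
    using l K1_pos Y0[of \<omega>] by (intro mult_nonneg_nonneg add_nonneg_nonneg) (auto simp: indicator_def)
  have le: "?F \<omega> \<le> ?Z \<omega>" for \<omega>
  proof (cases "\<omega> \<in> ?G")
    case False then show ?thesis using Z0[of \<omega>] by simp
  next
    case True
    have sp: "\<omega> \<in> space M" using True by (simp add: near_def)
    define t where "t = \<bar>occ ?d \<omega>\<bar>"
    \<comment> \<open>The weight r / h balances the two sides: over a window, which has probability
      of order r, the mean of t^2 is of order r (h^2 / r^2)^2, so both terms have order h^2 / r^2
      relative to that probability. This turns the second moment into a first one without losing the
      small probability of the window.\<close>
    have "0 \<le> (r / h * t - h / r)\<^sup>2" by simp
    also have "\<dots> = (r\<^sup>2 / h\<^sup>2) * t\<^sup>2 - 2 * t + h\<^sup>2 / r\<^sup>2"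
      using r h by (simp add: power2_diff power_mult_distrib power_divide)
    finally have amgm: "t \<le> (r\<^sup>2 / (2 * h\<^sup>2)) * t\<^sup>2 + ?c3" by simp
    have "exp (- (2 * K1)) \<le> exp (- occ ?m \<omega>)" using m_occ[OF True] by simp
    then have "exp (2 * K1) * exp (- (2 * K1)) * t\<^sup>2 \<le> exp (2 * K1) * exp (- occ ?m \<omega>) * t\<^sup>2"
      by (intro mult_right_mono mult_left_mono) auto
    then have "t\<^sup>2 \<le> exp (2 * K1) * ?I2 \<omega>" by (simp add: exp_minus t_def mult.assoc)
    then have "(r\<^sup>2 / (2 * h\<^sup>2)) * t\<^sup>2 \<le> ?c2 * ?I2 \<omega>"
      unfolding mult.assoc by (intro mult_left_mono) auto
    with amgm have t: "t \<le> ?c2 * ?I2 \<omega> + ?c3 * ?I3 \<omega>"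
      using on_near[OF True] sp by simp
    have "l * \<bar>occ (dipole x h) \<omega>\<bar> = \<bar>l * occ (dipole x h) \<omega>\<bar>" using l by (simp add: abs_mult)
    also have "\<dots> \<le> 2 * (occ v \<omega> + t)"
      unfolding decomp t_def using v_nonneg[of \<omega>] by (simp add: abs_mult)
    also have "\<dots> \<le> 2 * (?c1 * ?I1 \<omega> + (?c2 * ?I2 \<omega> + ?c3 * ?I3 \<omega>))"
    proof (intro mult_left_mono add_mono t)
      show "occ v \<omega> \<le> ?c1 * ?I1 \<omega>" using v_occ[OF True] on_near[OF True] sp by simp
    qed simp
    finally have "l * \<bar>occ (dipole x h) \<omega>\<bar> \<le> 2 * (?c1 * ?I1 \<omega> + ?c2 * ?I2 \<omega> + ?c3 * ?I3 \<omega>)"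
      by (simp only: add.assoc)
    then have "\<bar>occ (dipole x h) \<omega>\<bar> \<le> 2 * (?c1 * ?I1 \<omega> + ?c2 * ?I2 \<omega> + ?c3 * ?I3 \<omega>) / l"
      using l by (simp add: pos_le_divide_eq mult.commute)
    then show ?thesis using True by simp
  qed
  note o = occupation_before_extinction[OF g(1) e(1)]
  have i3: "integrable M ?I3" by (intro integrable_real_indicator) (auto simp: less_top[symmetric])
  have iZ: "integrable M ?Z"
    by (intro integrable_mult_right Bochner_Integration.integrable_add o sm i3)
  show i: "integrable M ?F"
  proof (rule Bochner_Integration.integrable_bound[OF iZ], measurable, rule AE_I2)
    show "norm (?F \<omega>) \<le> norm (?Z \<omega>)" for \<omega>
      using le[of \<omega>] order_trans[OF le[of \<omega>] abs_ge_self[of "?Z \<omega>"]] by (simp add: abs_mult)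
  qed
  let ?g = "g powr (- p - 1)"
  have "expectation ?F \<le> expectation ?Z" by (rule integral_mono[OF i iZ le])
  also have "\<dots> = 2 / l * (?c1 * expectation ?I1 + ?c2 * expectation ?I2 + ?c3 * expectation ?I3)"
    using o(1) sm(3) i3 by simp
  also have "\<dots> \<le> 2 / l * (?c1 * (2 powr (p + 5) * ?g * r powr (p + 3)) + ?c2 * (2 * (kc * (?g * r powr (p + 3)))) + ?c3 * (2 * A * p * ?g * r))"
  proof (intro mult_left_mono add_mono)
    have "e powr (p + 3) \<le> r powr (p + 3)" using e p_gt by (intro powr_mono2) auto
    then have "2 powr (p + 5) * ?g * e powr (p + 3) \<le> 2 powr (p + 5) * ?g * r powr (p + 3)"
      by (intro mult_left_mono) auto
    then show "expectation ?I1 \<le> 2 powr (p + 5) * ?g * r powr (p + 3)" using o(2) by linarith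
    show "expectation ?I2 \<le> 2 * (kc * (?g * r powr (p + 3)))" by (rule sm(4))
    have "expectation ?I3 = prob {\<omega> \<in> space M. g < rgt \<omega> \<and> rgt \<omega> \<le> g + e}" by simp
    also have "\<dots> \<le> 2 * A * p * ?g * e" by (rule survival_between[OF g(1) e(1)])
    also have "\<dots> \<le> 2 * A * p * ?g * r" using A_gt p_gt e by (intro mult_left_mono) auto
    finally show "expectation ?I3 \<le> 2 * A * p * ?g * r" .
  qed (use l K1_pos in auto)
  also have "\<dots> = K2 * ?g * r powr (p + 1) * h\<^sup>2"
  proof -
    have e1: "r powr (p + 3) = r\<^sup>2 * r powr (p + 1)"
      using r powr_add[of r 2 "p + 1"] by (simp add: add.commute)
    have e2: "l = 1 / (r * r powr (p + 1))"
      using r powr_add[of r 1 "p + 1"] powr_minus[of r "p + 2"] by (simp add: l_def inverse_eq_divide add.commute)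
    define R where "R = r powr (p + 1)"
    have R: "0 < R" using r by (simp add: R_def)
    show ?thesis
      unfolding K2_def kc_def e2 e1 R_def[symmetric] using r R h
      by (simp add: field_simps power2_eq_square)
  qed
  finally show "expectation ?F \<le> K2 * ?g * r powr (p + 1) * h\<^sup>2" .
qed

text \<open>The local time vanishes at the right end point, so its supremum is at most its total variation
  there, which is the limit of the variation of the averages over short intervals.\<close>

definition variation :: "real \<Rightarrow> real \<Rightarrow> nat \<Rightarrow> 'w \<Rightarrow> real" where
  "variation g e N \<omega> = (\<Sum>j<N. \<bar>occ (dipole (g + real j * (e / real N)) (e / real N)) \<omega>\<bar>) / (e / real N)"

lemma weight_dipole: "0 < h \<Longrightarrow> weight (dipole x h)"
  by (rule weightI[OF bounded_C11_measurable(2)[OF smooth_step_C11] abs_dipole_le])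

lemma variation_eventually_ge:
  assumes e: "0 < e" and x: "g < x" "x \<le> g + e" and "rgt \<omega> \<le> g + e" and a: "a < \<Lambda> x \<omega>"
  shows "eventually (\<lambda>n. a \<le> variation g e (Suc n) \<omega>) sequentially"
proof -
  have "isCont (\<lambda>y. \<Lambda> y \<omega>) x"
    using field_continuous by (simp add: continuous_on_eq_continuous_at)
  then have "eventually (\<lambda>y. a < \<Lambda> y \<omega>) (at x)"
    using a unfolding isCont_def by (rule order_tendstoD)
  then obtain d where d: "d > 0" "\<And>y. y \<noteq> x \<Longrightarrow> dist y x < d \<Longrightarrow> a < \<Lambda> y \<omega>"
    by (auto simp: eventually_at)
  have near: "a \<le> \<Lambda> y \<omega>" if "\<bar>y - x\<bar> < d" for y
    using d(2)[of y] a that by (cases "y = x") (auto simp: dist_real_def)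
  have "eventually (\<lambda>n. e / d < real (Suc n)) sequentially"
    using LIMSEQ_Suc filterlim_compose[OF filterlim_real_sequentially filterlim_Suc]
    by (simp add: filterlim_at_top_dense)
  then show ?thesis
  proof eventually_elim
    case (elim n)
    define N where "N = Suc n"
    define h where "h = e / real N"
    have N: "0 < real N" by (simp add: N_def)
    have h: "0 < h" using e N by (simp add: h_def)
    have hd: "h < d" using elim d N by (simp add: h_def N_def field_simps del: of_nat_Suc)
    have Nh: "real N * h = e" using N by (simp add: h_def)
    let ?I = "\<lambda>j. {g + real j * h<..g + real j * h + h}"
    have wI: "weight (indicator (?I j))" for j by (intro weight_indicator) auto
    define b where "b j = occ (indicator (?I j)) \<omega> / h" for j
    have dip: "dipole (g + real j * h) h = (\<lambda>y. indicator (?I j) y - indicator (?I (Suc j)) y)" for j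
      by (auto simp: dipole_def fun_eq_iff algebra_simps)
    have V: "variation g e N \<omega> = (\<Sum>j<N. \<bar>b j - b (Suc j)\<bar>)"
    proof -
      have "variation g e N \<omega> = (\<Sum>j<N. \<bar>occ (dipole (g + real j * h) h) \<omega>\<bar> / h)"
        unfolding variation_def h_def sum_divide_distrib ..
      also have "\<dots> = (\<Sum>j<N. \<bar>b j - b (Suc j)\<bar>)"
        unfolding dip using h by (intro sum.cong refl)
          (simp only: occ_diff[OF wI wI] b_def diff_divide_distrib[symmetric] abs_divide abs_of_pos)
      finally show ?thesis .
    qed
    \<comment> \<open>The interval with index N starts at g + e, beyond R; it is the anchor of the
      telescoping sum.\<close>
    have "b N = 0"
    proof -
      have "occ (indicator (?I N)) \<omega> = 0"
        using \<open>rgt \<omega> \<le> g + e\<close> by (intro occ_eq_0) (simp add: Nh)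
      then show ?thesis by (simp add: b_def)
    qed
    \<comment> \<open>The cells are open on the left and closed on the right, so the cell containing
      x has index ceiling minus 1.\<close>
    define i where "i = nat (\<lceil>(x - g) / h\<rceil> - 1)"
    have "0 < (x - g) / h" using x h by simp
    then have "0 < \<lceil>(x - g) / h\<rceil>" by linarith
    then have ri: "real i = real_of_int \<lceil>(x - g) / h\<rceil> - 1"
      by (simp add: i_def of_nat_nat)
    have "real i < (x - g) / h" "(x - g) / h \<le> real i + 1" unfolding ri by linarith+
    then have i: "real i * h < x - g" "x - g \<le> (real i + 1) * h"
      using h by (auto simp: field_simps)
    have "real i * h < real N * h" using i(1) x Nh by linarith
    then have "i < N" using h by simp
    have "a \<le> b i"
    proof -
      have "a * h = (\<integral>y. a * indicator (?I i) y \<partial>lborel)" using h by simp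
      also have "\<dots> \<le> (\<integral>y. indicator (?I i) y * \<Lambda> y \<omega> \<partial>lborel)"
      proof (rule integral_mono)
        show "integrable lborel (\<lambda>y. a * indicator (?I i) y)"
          by (intro integrable_mult_right integrable_real_indicator) (use h in auto)
        show "integrable lborel (\<lambda>y. indicator (?I i) y * \<Lambda> y \<omega>)" by (rule occ_integrable[OF wI])
        fix y
        show "a * indicator (?I i) y \<le> indicator (?I i) y * \<Lambda> y \<omega>"
        proof (cases "y \<in> ?I i")
          case True
          then have "\<bar>y - x\<bar> < d" using i hd by (auto simp: algebra_simps)
          from near[OF this] show ?thesis using True by simp
        qed simp
      qed
      finally show ?thesis using h by (simp add: b_def occ_def pos_le_divide_eq)
    qed
    also have "\<dots> \<le> variation g e N \<omega>"
      unfolding V using \<open>b N = 0\<close> \<open>i < N\<close> by (rule sum_differences_ge)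
    finally show ?case by (simp add: N_def)
  qed
qed

text \<open>There are e / h increments, each of order h^2, and the averages carry a factor 1 / h:
  the mesh cancels, and the bound is uniform in n.\<close>

lemma variation_expectation:
  assumes g: "0 < g" and e: "0 < e" "e \<le> r"
  shows "integrable M (\<lambda>\<omega>. indicator (near g e r) \<omega> * variation g e (Suc n) \<omega>)"
    and "expectation (\<lambda>\<omega>. indicator (near g e r) \<omega> * variation g e (Suc n) \<omega>)
      \<le> K2 * g powr (- p - 1) * r powr (p + 1) * e"
proof -
  define h where "h = e / real (Suc n)"
  have h: "0 < h" "h \<le> e" using e by (auto simp: h_def divide_le_eq mult_le_cancel_left1)
  have nh: "real (Suc n) * h = e" by (simp add: h_def del: of_nat_Suc)
  let ?G = "indicator (near g e r) :: 'w \<Rightarrow> real"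
  have eq: "?G \<omega> * variation g e (Suc n) \<omega> =
      (\<Sum>j<Suc n. ?G \<omega> * \<bar>occ (dipole (g + real j * h) h) \<omega>\<bar>) / h" for \<omega>
    by (simp only: variation_def h_def sum_distrib_left[symmetric] times_divide_eq_right)
  have "g \<le> g + real j * h" for j using h by simp
  note ib = increment_bound[OF g this e h]
  show "integrable M (\<lambda>\<omega>. ?G \<omega> * variation g e (Suc n) \<omega>)"
    unfolding eq by (intro integrable_divide Bochner_Integration.integrable_sum ib)
  have "expectation (\<lambda>\<omega>. ?G \<omega> * variation g e (Suc n) \<omega>)
    = (\<Sum>j<Suc n. expectation (\<lambda>\<omega>. ?G \<omega> * \<bar>occ (dipole (g + real j * h) h) \<omega>\<bar>)) / h"
    unfolding eq integral_divide_zero by (subst Bochner_Integration.integral_sum) (auto intro: ib)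
  also have "\<dots> \<le> (\<Sum>j<Suc n. K2 * g powr (- p - 1) * r powr (p + 1) * h\<^sup>2) / h"
    using h by (intro divide_right_mono sum_mono ib) auto
  also have "\<dots> = K2 * g powr (- p - 1) * r powr (p + 1) * (real (Suc n) * h)"
    using h by (simp add: power2_eq_square del: of_nat_Suc)
  finally show "expectation (\<lambda>\<omega>. ?G \<omega> * variation g e (Suc n) \<omega>)
      \<le> K2 * g powr (- p - 1) * r powr (p + 1) * e" unfolding nh .
qed

section \<open>From the mean variation to almost sure bounds\<close>

definition K3 where "K3 = K2 + 2 powr (p + 5)"

lemma K2_pos: "0 < K2"
  unfolding K2_def using K1_pos A_gt p_gt by (intro mult_pos_pos add_pos_pos) auto

text \<open>The exceptional set has two parts, each estimated by Markov's inequality: too much mass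
  in the window (first moment), and variation at least a on all fine grids (mean variation on
  \<open>near\<close>). Outside them a value above a in the window would be seen by every
  sufficiently fine grid.\<close>

lemma window_bound:
  assumes g: "0 < g" and e: "0 < e" "e \<le> r" and a: "0 < a"
  obtains B where "B \<in> events"
    "prob B \<le> K3 * g powr (- p - 1) * (e powr (p + 3) / r powr (p + 2) + r powr (p + 1) * e / a)"
    "\<And>\<omega> x. \<omega> \<in> space M - B \<Longrightarrow> g < rgt \<omega> \<Longrightarrow> rgt \<omega> \<le> g + e \<Longrightarrow> g < x \<Longrightarrow> x \<le> g + e \<Longrightarrow> \<Lambda> x \<omega> \<le> a"
proof -
  have r: "0 < r" using e by simp
  let ?g = "g powr (- p - 1)"
  let ?Y = "occ (indicator {g<..g + e})"
  have Y: "weight (indicator {g<..g + e})" by (intro weight_indicator) auto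
  have Y0: "0 \<le> ?Y \<omega>" for \<omega> by (rule occ_nonneg[OF Y]) simp
  have [measurable]: "?Y \<in> borel_measurable M" by (rule occ_measurable[OF Y])
  have [measurable]: "near g e r \<in> events" by (rule near_measurable)
  have [measurable]: "variation g e (Suc n) \<in> borel_measurable M" for n
    unfolding variation_def[abs_def] using e
    by (intro borel_measurable_divide borel_measurable_sum borel_measurable_abs occ_measurable weight_dipole) auto
  define B1 where "B1 = {\<omega> \<in> space M. rgt \<omega> \<le> g + e \<and> r powr (p + 2) < ?Y \<omega>}"
  define E where "E n = {\<omega> \<in> near g e r. a \<le> variation g e (Suc n) \<omega>}" for n
  have B1: "B1 \<in> events" unfolding B1_def by measurable
  have E: "E n \<in> events" for n
  proof -
    have "E n = {\<omega> \<in> space M. \<omega> \<in> near g e r \<and> a \<le> variation g e (Suc n) \<omega>}"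
      by (auto simp: E_def near_def)
    also have "\<dots> \<in> events" by measurable
    finally show ?thesis .
  qed
  note o = occupation_before_extinction[OF g e(1)]
  have pB1: "prob B1 \<le> 2 powr (p + 5) * ?g * e powr (p + 3) / r powr (p + 2)"
  proof -
    have "r powr (p + 2) * prob B1 = expectation (\<lambda>\<omega>. indicator B1 \<omega> * r powr (p + 2))"
      using B1 by simp
    also have "\<dots> \<le> expectation (\<lambda>\<omega>. indicator {\<omega> \<in> space M. rgt \<omega> \<le> g + e} \<omega> * ?Y \<omega>)"
    proof (rule integral_mono[OF _ o(1)])
      show "integrable M (\<lambda>\<omega>. indicator B1 \<omega> * r powr (p + 2))"
        using B1 by (intro integrable_mult_left integrable_real_indicator) (auto simp: less_top[symmetric])
    qed (use Y0 in \<open>auto simp: indicator_def B1_def\<close>)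
    also have "\<dots> \<le> 2 powr (p + 5) * ?g * e powr (p + 3)" by (rule o(2))
    finally show ?thesis using r by (simp add: pos_le_divide_eq mult.commute)
  qed
  have pE: "prob (E n) \<le> K2 * ?g * r powr (p + 1) * e / a" for n
  proof -
    have v0: "0 \<le> variation g e (Suc n) \<omega>" for \<omega>
      unfolding variation_def using e by (intro divide_nonneg_nonneg sum_nonneg) auto
    have "a * prob (E n) = expectation (\<lambda>\<omega>. indicator (E n) \<omega> * a)" using E by simp
    also have "\<dots> \<le> expectation (\<lambda>\<omega>. indicator (near g e r) \<omega> * variation g e (Suc n) \<omega>)"
    proof (rule integral_mono[OF _ variation_expectation(1)[OF g e]])
      show "integrable M (\<lambda>\<omega>. indicator (E n) \<omega> * a)"
        using E by (intro integrable_mult_left integrable_real_indicator) (auto simp: less_top[symmetric])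
    qed (use v0 in \<open>auto simp: indicator_def E_def\<close>)
    also have "\<dots> \<le> K2 * ?g * r powr (p + 1) * e" by (rule variation_expectation(2)[OF g e])
    finally show ?thesis using a by (simp add: pos_le_divide_eq mult.commute)
  qed
  define B where "B = B1 \<union> (\<Union>K. \<Inter>n\<in>{K..}. E n)"
  note F = prob_eventually_le[of E, OF E pE]
  show thesis
  proof (rule that)
    show "B \<in> events" unfolding B_def using B1 F(1) by auto
    have "prob B \<le> prob B1 + prob (\<Union>K. \<Inter>n\<in>{K..}. E n)"
      unfolding B_def using B1 F(1) by (intro measure_Un_le)
    also have "\<dots> \<le> 2 powr (p + 5) * (?g * (e powr (p + 3) / r powr (p + 2))) + K2 * (?g * (r powr (p + 1) * e / a))"
      using pB1 F(2) by (simp add: mult.assoc)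
    also have "\<dots> \<le> K3 * (?g * (e powr (p + 3) / r powr (p + 2))) + K3 * (?g * (r powr (p + 1) * e / a))"
      unfolding K3_def using K2_pos a e by (intro add_mono mult_right_mono) auto
    finally show "prob B \<le> K3 * ?g * (e powr (p + 3) / r powr (p + 2) + r powr (p + 1) * e / a)"
      by (simp only: distrib_left mult.assoc)
    fix \<omega> x
    assume \<omega>: "\<omega> \<in> space M - B" and *: "g < rgt \<omega>" "rgt \<omega> \<le> g + e" "g < x" "x \<le> g + e"
    show "\<Lambda> x \<omega> \<le> a"
    proof (rule ccontr)
      assume "\<not> \<Lambda> x \<omega> \<le> a"
      then have "eventually (\<lambda>n. a \<le> variation g e (Suc n) \<omega>) sequentially"
        using * e by (intro variation_eventually_ge[where x=x]) auto
      moreover have "\<omega> \<in> near g e r" using \<omega> * by (auto simp: B_def B1_def near_def)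
      ultimately have "\<omega> \<in> (\<Union>K. \<Inter>n\<in>{K..}. E n)"
        by (auto simp: eventually_sequentially E_def)
      with \<omega> show False unfolding B_def by blast
    qed
  qed
qed

text \<open>With \<open>r = e\<^bsup>1-s\<^esup>\<close> for a small \<open>s > 0\<close> the exceptional probability is of order \<open>e\<^bsup>1+s\<^esup>\<close>,
  which is summable over a grid of mesh \<open>e / 2\<close> and then over dyadic \<open>e\<close>.\<close>

lemma window_holder_bound:
  assumes \<gamma>: "0 < \<gamma>" "\<gamma> < p + 1" and g: "0 < c" "c \<le> g" and e: "0 < e" "e \<le> 1"
  defines "s \<equiv> (p + 1 - \<gamma>) / (p + 2)"
  obtains B where "B \<in> events" "prob B \<le> 2 * K3 * c powr (- p - 1) * e powr (1 + s)"
    "\<And>\<omega> x. \<omega> \<in> space M - B \<Longrightarrow> g < rgt \<omega> \<Longrightarrow> rgt \<omega> \<le> g + e \<Longrightarrow> g < x \<Longrightarrow> x \<le> g + e \<Longrightarrow> \<Lambda> x \<omega> \<le> e powr \<gamma>"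
proof -
  \<comment> \<open>This s makes the variation term exactly e^(1+s), because (1 - s) (p + 1) + 1 -
    \<gamma> = 1 + s; the mass term is e^(1 + s (p + 2)), which is smaller.\<close>
  have s: "0 < s" "s < 1" "s * (p + 2) = p + 1 - \<gamma>" using \<gamma> p_gt by (auto simp: s_def divide_less_eq)
  define r where "r = e powr (1 - s)"
  have "e powr 1 \<le> r" unfolding r_def using e s by (intro powr_mono') auto
  then have er: "e \<le> r" using e by simp
  have g0: "0 < g" using g by simp
  obtain B where B: "B \<in> events"
    "prob B \<le> K3 * g powr (- p - 1) * (e powr (p + 3) / r powr (p + 2) + r powr (p + 1) * e / e powr \<gamma>)"
    "\<And>\<omega> x. \<omega> \<in> space M - B \<Longrightarrow> g < rgt \<omega> \<Longrightarrow> rgt \<omega> \<le> g + e \<Longrightarrow> g < x \<Longrightarrow> x \<le> g + e \<Longrightarrow> \<Lambda> x \<omega> \<le> e powr \<gamma>"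
    using window_bound[OF g0 e(1) er, of "e powr \<gamma>"] e by auto
  have rp: "r powr q = e powr ((1 - s) * q)" for q by (simp only: r_def powr_powr)
  have "e powr (p + 3) / r powr (p + 2) = e powr (p + 3 - (1 - s) * (p + 2))"
    by (simp only: rp powr_diff)
  also have "p + 3 - (1 - s) * (p + 2) = 1 + s * (p + 2)" by (simp add: algebra_simps)
  also have "e powr (1 + s * (p + 2)) \<le> e powr (1 + s)"
  proof (rule powr_mono')
    have "s * 1 \<le> s * (p + 2)" using s(1) p_gt by (intro mult_left_mono) auto
    then show "1 + s \<le> 1 + s * (p + 2)" by simp
  qed (use e in auto)
  finally have 1: "e powr (p + 3) / r powr (p + 2) \<le> e powr (1 + s)" .
  have "r powr (p + 1) * e / e powr \<gamma> = e powr ((1 - s) * (p + 1) + 1 - \<gamma>)"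
  proof -
    have "r powr (p + 1) * e / e powr \<gamma> = e powr ((1 - s) * (p + 1)) * e powr 1 / e powr \<gamma>"
      unfolding rp using e by simp
    then show ?thesis by (simp only: powr_diff powr_add)
  qed
  also have "(1 - s) * (p + 1) + 1 - \<gamma> = 1 + s"
    using s(3) by (simp add: algebra_simps)
  finally have 2: "r powr (p + 1) * e / e powr \<gamma> = e powr (1 + s)" .
  have "prob B \<le> K3 * g powr (- p - 1) * (2 * e powr (1 + s))"
    using B(2) 1 2 K2_pos
    by (elim order_trans) (intro mult_left_mono, auto simp: K3_def)
  also have "\<dots> \<le> K3 * c powr (- p - 1) * (2 * e powr (1 + s))"
    using g p_gt K2_pos by (intro mult_right_mono mult_left_mono powr_mono2') (auto simp: K3_def)
  finally have "prob B \<le> 2 * K3 * c powr (- p - 1) * e powr (1 + s)" by (simp add: ac_simps)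
  then show thesis using that B by blast
qed

text \<open>Consecutive windows overlap by half, so that R lies in the right half of one of them,
  and this single window contains [R - e/2, R]. The grid starts at c = 1 / n since the window bounds
  degenerate like g^(-p-1) at 0; the condition 2 / n < R places R beyond the first window once e <
  c.\<close>

lemma AE_bound_near_rgt:
  assumes \<gamma>: "0 < \<gamma>" "\<gamma> < p + 1" and "0 < n"
  shows "AE \<omega> in M. 2 / real n < rgt \<omega> \<longrightarrow> rgt \<omega> < real n \<longrightarrow>
    eventually (\<lambda>k. \<forall>x. rgt \<omega> - (1/2) ^ k / 2 \<le> x \<longrightarrow> x \<le> rgt \<omega> \<longrightarrow> \<Lambda> x \<omega> \<le> ((1/2) ^ k) powr \<gamma>) sequentially"
proof -
  define s where "s = (p + 1 - \<gamma>) / (p + 2)"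
  have s: "0 < s" using \<gamma> p_gt by (simp add: s_def)
  define c where "c = 1 / real n"
  have c: "0 < c" using \<open>0 < n\<close> by (simp add: c_def)
  define e where "e k = (1/2 :: real) ^ k" for k :: nat
  have e: "0 < e k" "e k \<le> 1" for k by (auto simp: e_def power_le_one)
  define G where "G k j = c + real j * (e k / 2)" for k j :: nat
  have G: "c \<le> G k j" for k j using e[of k] by (simp add: G_def)
  have "\<exists>B. B \<in> events \<and> prob B \<le> 2 * K3 * c powr (- p - 1) * e k powr (1 + s) \<and>
    (\<forall>\<omega> x. \<omega> \<in> space M - B \<longrightarrow> G k j < rgt \<omega> \<longrightarrow> rgt \<omega> \<le> G k j + e k \<longrightarrow> G k j < x \<longrightarrow> x \<le> G k j + e k \<longrightarrow> \<Lambda> x \<omega> \<le> e k powr \<gamma>)" for k j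
    unfolding s_def by (rule window_holder_bound[OF \<gamma> c G e[of k]]) blast
  then obtain B where B: "\<And>k j. B k j \<in> events"
    "\<And>k j. prob (B k j) \<le> 2 * K3 * c powr (- p - 1) * e k powr (1 + s)"
    "\<And>k j \<omega> x. \<omega> \<in> space M - B k j \<Longrightarrow> G k j < rgt \<omega> \<Longrightarrow> rgt \<omega> \<le> G k j + e k \<Longrightarrow> G k j < x \<Longrightarrow> x \<le> G k j + e k \<Longrightarrow> \<Lambda> x \<omega> \<le> e k powr \<gamma>"
    by metis
  \<comment> \<open>With mesh e k / 2 and e k = 2^(-k), this many steps cover a length n. The union
    bound then leaves 2^k e^(1+s) = 2^(-s k), up to a constant.\<close>
  define Bad where "Bad k = (\<Union>j\<in>{..<2 * n * 2 ^ k}. B k j)" for k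
  have Bad: "Bad k \<in> events" for k unfolding Bad_def using B(1) by auto
  define C where "C = 2 * real n * (2 * K3 * c powr (- p - 1))"
  have pBad: "prob (Bad k) \<le> C * (1 / 2 powr s) ^ k" for k
  proof -
    have "prob (Bad k) \<le> (\<Sum>j<2 * n * 2 ^ k. prob (B k j))"
      unfolding Bad_def using B(1) by (intro finite_measure_subadditive_finite) auto
    also have "\<dots> \<le> (\<Sum>j<2 * n * 2 ^ k. 2 * K3 * c powr (- p - 1) * e k powr (1 + s))"
      by (intro sum_mono B(2))
    also have "\<dots> = C * (2 ^ k * e k powr (1 + s))" by (simp add: C_def)
    also have "2 ^ k * e k powr (1 + s) = (1 / 2 powr s) ^ k"
    proof -
      have "2 ^ k * e k powr (1 + s) = (2 ^ k * e k) * e k powr s"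
        using e[of k] by (simp add: powr_add)
      also have "2 ^ k * e k = 1" by (simp add: e_def power_mult_distrib[symmetric])
      also have "e k powr s = (1 / 2 powr s) ^ k"
      proof -
        have pr: "x ^ k = x powr real k" if "0 < x" for x :: real
          using that by (simp add: powr_realpow)
        have "e k powr s = ((1/2) powr s) ^ k"
          unfolding e_def by (subst pr, simp, subst pr, simp, simp only: powr_powr mult.commute)
        also have "(1/2) powr s = 1 / 2 powr s" by (simp add: powr_divide)
        finally show ?thesis .
      qed
      finally show ?thesis by simp
    qed
    finally show ?thesis .
  qed
  have "summable (\<lambda>k. prob (Bad k))"
  proof (rule summable_comparison_test)
    show "\<exists>N. \<forall>k\<ge>N. norm (prob (Bad k)) \<le> C * (1 / 2 powr s) ^ k" using pBad by auto
    have "1 < 2 powr s" using s by (intro gr_one_powr) auto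
    then show "summable (\<lambda>k. C * (1 / 2 powr s) ^ k)"
      by (intro summable_mult summable_geometric) auto
  qed
  then have "AE \<omega> in M. eventually (\<lambda>k. \<omega> \<in> space M - Bad k) sequentially"
    by (intro borel_cantelli_AE1 Bad) (auto simp: less_top[symmetric])
  then show ?thesis
  proof eventually_elim
    case (elim \<omega>)
    show ?case
    proof (intro impI)
      assume R: "2 / real n < rgt \<omega>" "rgt \<omega> < real n"
      have "eventually (\<lambda>k. e k < c) sequentially"
        using c by (intro order_tendstoD(2)[where y=0]) (auto simp: e_def[abs_def] intro!: LIMSEQ_power_zero)
      with elim have "eventually (\<lambda>k. \<forall>x. rgt \<omega> - e k / 2 \<le> x \<longrightarrow> x \<le> rgt \<omega> \<longrightarrow> \<Lambda> x \<omega> \<le> e k powr \<gamma>) sequentially"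
      proof eventually_elim
        case (elim k)
        \<comment> \<open>Rounding z up selects the first window whose right end reaches R; its left
          end is then below R - e k / 2.\<close>
        define z where "z = (rgt \<omega> - c - e k) / (e k / 2)"
        define j where "j = nat \<lceil>z\<rceil>"
        have "c + e k < rgt \<omega>" using R(1) elim(2) by (simp add: c_def)
        then have "0 < z" using e[of k] by (simp add: z_def)
        then have zj: "z \<le> real j" "real j < z + 1" unfolding j_def by linarith+
        have zz: "z * (e k / 2) = rgt \<omega> - c - e k" using e[of k] by (simp add: z_def)
        have "z * (e k / 2) \<le> real j * (e k / 2)" "real j * (e k / 2) < (z + 1) * (e k / 2)"
          using zj e[of k] by (auto intro: mult_right_mono mult_strict_right_mono)
        then have w: "rgt \<omega> \<le> G k j + e k" "G k j < rgt \<omega> - e k / 2"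
          unfolding G_def distrib_right zz by auto
        have "j < 2 * n * 2 ^ k"
        proof -
          have "2 ^ k * e k = 1" by (simp add: e_def power_mult_distrib[symmetric])
          then have "real (2 * n * 2 ^ k) * (e k / 2) = real n" by (simp add: mult.assoc)
          moreover have "real j * (e k / 2) < real n"
            using w(2) R(2) c e[of k] by (simp add: G_def)
          ultimately have "real j * (e k / 2) < real (2 * n * 2 ^ k) * (e k / 2)" by (simp only:)
          then have "real j < real (2 * n * 2 ^ k)"
            using e[of k] by (simp only: mult_less_cancel_right_pos half_gt_zero_iff)
          then show ?thesis by (simp only: of_nat_less_iff)
        qed
        then have "\<omega> \<in> space M - B k j" using elim(1) by (auto simp: Bad_def)
        from B(3)[OF this] w e[of k] show ?case by auto
      qed
      then show "eventually (\<lambda>k. \<forall>x. rgt \<omega> - (1/2) ^ k / 2 \<le> x \<longrightarrow> x \<le> rgt \<omega> \<longrightarrow> \<Lambda> x \<omega> \<le> ((1/2) ^ k) powr \<gamma>) sequentially"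
        by (simp add: e_def)
    qed
  qed
qed

lemma AE_holder_rgt:
  assumes \<gamma>: "0 < \<gamma>" "\<gamma> < 1 + 2 / \<beta>"
  shows "AE \<omega> in M. pointwise_holder \<gamma> (\<lambda>x. \<Lambda> x \<omega>) (rgt \<omega>)"
proof -
  have "\<gamma> < p + 1" using \<gamma> by (simp add: p_def)
  then have "AE \<omega> in M. \<forall>n::nat. 0 < n \<longrightarrow> 2 / real n < rgt \<omega> \<longrightarrow> rgt \<omega> < real n \<longrightarrow>
    eventually (\<lambda>k. \<forall>x. rgt \<omega> - (1/2) ^ k / 2 \<le> x \<longrightarrow> x \<le> rgt \<omega> \<longrightarrow> \<Lambda> x \<omega> \<le> ((1/2) ^ k) powr \<gamma>) sequentially"
    using AE_bound_near_rgt[OF \<gamma>(1)] by (subst AE_all_countable) auto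
  with field_positive show ?thesis
  proof eventually_elim
    case (elim \<omega>)
    let ?R = "rgt \<omega>"
    \<comment> \<open>The bound holds simultaneously for all n, so the outcome may choose an n with
      2 / n < R < n.\<close>
    obtain n :: nat where n: "max (2 / ?R) ?R < real n" using reals_Archimedean2 by blast
    then have "0 < n" "2 / real n < ?R" "?R < real n"
      using elim(1) by (auto simp: field_simps dest: order.strict_trans)
    with elim(2) obtain k0 where k0: "\<And>k x. k0 \<le> k \<Longrightarrow> ?R - (1/2) ^ k / 2 \<le> x \<Longrightarrow> x \<le> ?R \<Longrightarrow> \<Lambda> x \<omega> \<le> ((1/2) ^ k) powr \<gamma>"
      unfolding eventually_sequentially by blast
    have zero: "\<Lambda> y \<omega> = 0" if "?R \<le> y" for y using field_support[of y \<omega>] that by fastforce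
    show ?case unfolding pointwise_holder_def
    proof (intro exI conjI allI impI)
      show "0 < (1/2 :: real) ^ k0 / 2" by simp
      show "0 < (4 :: real) powr \<gamma>" by simp
      fix y assume y: "\<bar>y - ?R\<bar> < (1/2) ^ k0 / 2"
      show "\<bar>\<Lambda> y \<omega> - \<Lambda> ?R \<omega>\<bar> \<le> 4 powr \<gamma> * \<bar>y - ?R\<bar> powr \<gamma>"
      proof (cases "?R \<le> y")
        case True then show ?thesis using zero by simp
      next
        case False
        then have z: "0 < 2 * (?R - y)" "2 * (?R - y) \<le> (1/2) ^ k0" using y by auto
        \<comment> \<open>The bound at level k reaches only (1/2)^k / 2 to the left of R, hence the
          dyadic scale is matched with 2 (R - y); it is below 4 (R - y), which gives the constant
          4^\<gamma>.\<close>
        obtain k where k: "k0 \<le> k" "2 * (?R - y) \<le> (1/2) ^ k" "(1/2) ^ k < 2 * (2 * (?R - y))"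
          by (rule dyadic_scale[OF z])
        have "\<Lambda> y \<omega> \<le> ((1/2) ^ k) powr \<gamma>" using k False by (intro k0) auto
        also have "\<dots> \<le> (4 * (?R - y)) powr \<gamma>" using k \<gamma> by (intro powr_mono2) auto
        also have "\<dots> = 4 powr \<gamma> * (?R - y) powr \<gamma>" by (rule powr_mult)
        finally show ?thesis using False zero[of ?R] field_nonneg[of y \<omega>] by simp
      qed
    qed
  qed
qed

end

section \<open>Reflection and the conclusion for both end points\<close>

lemma pointwise_holder_reflect:
  "pointwise_holder \<gamma> (\<lambda>x. f (- x)) x \<Longrightarrow> pointwise_holder \<gamma> f (- x)"
  unfolding pointwise_holder_def
proof (elim exE conjE)
  fix d c assume *: "0 < d" "0 < c" "\<forall>y. \<bar>y - x\<bar> < d \<longrightarrow> \<bar>f (- y) - f (- x)\<bar> \<le> c * \<bar>y - x\<bar> powr \<gamma>"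
  show "\<exists>\<delta>>0. \<exists>c>0. \<forall>y. \<bar>y - - x\<bar> < \<delta> \<longrightarrow> \<bar>f y - f (- x)\<bar> \<le> c * \<bar>y - - x\<bar> powr \<gamma>"
  proof (intro exI conjI allI impI)
    fix y assume "\<bar>y - - x\<bar> < d"
    moreover have "\<bar>- y - x\<bar> = \<bar>y - - x\<bar>" by simp
    ultimately show "\<bar>f y - f (- x)\<bar> \<le> c * \<bar>y - - x\<bar> powr \<gamma>" using *(3)[rule_format, of "- y"] by simp
  qed (use * in auto)
qed

text \<open>The second derivative commutes with y -> - y, so the potential of the reflected U is the
  reflected potential, and the starting point 0, at which U is evaluated in the Laplace functional,
  is fixed.\<close>

lemma occupation_field_reflect:
  assumes "occupation_field M \<beta> \<Lambda> lft rgt" and lft: "lft \<in> borel_measurable M"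
  shows "occupation_field M \<beta> (\<lambda>x. \<Lambda> (- x)) (\<lambda>\<omega>. - rgt \<omega>) (\<lambda>\<omega>. - lft \<omega>)"
proof -
  interpret occupation_field M \<beta> \<Lambda> lft rgt by (rule assms)
  show ?thesis
  proof
    show "0 < \<beta>" "\<beta> < 1" by (fact beta)+
    show "\<Lambda> (- x) \<in> borel_measurable M" for x by (rule field_measurable)
    show "continuous_on UNIV (\<lambda>x. \<Lambda> (- x) \<omega>)" for \<omega>
      by (rule continuous_on_compose2[OF field_continuous]) (auto intro: continuous_intros)
    show "0 \<le> \<Lambda> (- x) \<omega>" for x \<omega> by (rule field_nonneg)
    show "- rgt \<omega> < x \<and> x < - lft \<omega>" if "\<Lambda> (- x) \<omega> \<noteq> 0" for x \<omega>
      using field_support[OF that] by auto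
    show "(\<lambda>\<omega>. - lft \<omega>) \<in> borel_measurable M" using lft by measurable
    show "AE \<omega> in M. - rgt \<omega> < 0 \<and> 0 < - lft \<omega> \<and> (\<forall>x. - rgt \<omega> < x \<longrightarrow> x < - lft \<omega> \<longrightarrow> 0 < \<Lambda> (- x) \<omega>)"
      using field_positive by eventually_elim auto
    fix U U2 assume U: "bounded_C11 U U2" "\<And>y. 0 \<le> U y" "\<And>y. 0 \<le> potential \<beta> U U2 y"
    have "(\<integral>y. potential \<beta> U U2 y * \<Lambda> (- y) \<omega> \<partial>lborel) =
      (\<integral>y. potential \<beta> (\<lambda>y. U (- y)) (\<lambda>y. U2 (- y)) y * \<Lambda> y \<omega> \<partial>lborel)" for \<omega>
      using lborel_integral_real_affine[of "- 1" "\<lambda>y. potential \<beta> U U2 y * \<Lambda> (- y) \<omega>" 0]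
      by (simp add: potential_def)
    moreover have "(\<integral>\<omega>. exp (- (\<integral>y. potential \<beta> (\<lambda>y. U (- y)) (\<lambda>y. U2 (- y)) y * \<Lambda> y \<omega> \<partial>lborel)) \<partial>M) = exp (- U (- 0))"
      using U(2,3) by (intro laplace bounded_C11_reflect[OF U(1)]) (auto simp: potential_def)
    ultimately show "(\<integral>\<omega>. exp (- (\<integral>y. potential \<beta> U U2 y * \<Lambda> (- y) \<omega> \<partial>lborel)) \<partial>M) = exp (- U 0)"
      by simp
  qed
qed

theorem theorem1p4:
  fixes \<beta> \<gamma> :: real
    and \<Omega> :: "'w measure"
    and X :: "real \<Rightarrow> 'w \<Rightarrow> real measure"
    and P :: "real measure \<Rightarrow> 'w measure"
    and L :: "real \<Rightarrow> real \<Rightarrow> 'w \<Rightarrow> real"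
    and lft rgt :: "'w \<Rightarrow> real"
  assumes "0 < \<beta>" "\<beta> < 1"
    and "super_brownian_motion \<beta> \<Omega> X P"
    and "local_time (P (return borel 0)) X L"
    and "lft \<in> borel_measurable (P (return borel 0))"
    and "rgt \<in> borel_measurable (P (return borel 0))"
    and "AE \<omega> in P (return borel 0). lft \<omega> < 0 \<and> 0 < rgt \<omega> \<and>
           {x. total_local_time X L \<omega> x > 0} = {lft \<omega> <..< rgt \<omega>}"
    and "0 < \<gamma>" "\<gamma> < 1 + 2 / \<beta>"
  shows "AE \<omega> in P (return borel 0).
           pointwise_holder \<gamma> (total_local_time X L \<omega>) (lft \<omega>) \<and>
           pointwise_holder \<gamma> (total_local_time X L \<omega>) (rgt \<omega>)"
proof -
  interpret super_brownian \<beta> \<Omega> X P by unfold_locales (use assms in auto)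
  define \<mu> where "\<mu> = (return borel 0 :: real measure)"
  have \<mu>: "\<mu> \<in> space finite_measures"
    using prob_space_return[of 0 "borel :: real measure"]
    by (auto simp: \<mu>_def space_finite_measures prob_space_def)
  interpret prob_space "P \<mu>" by (rule prob_space_P[OF \<mu>])
  note ass = assms[folded \<mu>_def]
  have supp: "AE \<omega> in P \<mu>. {x. total_local_time X L \<omega> x > 0} = {lft \<omega> <..< rgt \<omega>}"
    using ass(7) by eventually_elim simp
  obtain \<Lambda> where \<Lambda>: "\<And>x. \<Lambda> x \<in> borel_measurable (P \<mu>)" "\<And>\<omega>. continuous_on UNIV (\<lambda>x. \<Lambda> x \<omega>)"
    "\<And>\<omega> x. 0 \<le> \<Lambda> x \<omega>" "\<And>\<omega> x. \<Lambda> x \<omega> \<noteq> 0 \<Longrightarrow> lft \<omega> < x \<and> x < rgt \<omega>"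
    and eq: "AE \<omega> in P \<mu>. (\<lambda>x. \<Lambda> x \<omega>) = total_local_time X L \<omega>"
    and occ: "AE \<omega> in P \<mu>. eventually (\<lambda>n::nat. mass (real n) \<omega> = 0 \<and>
      (\<forall>f K. f \<in> borel_measurable borel \<longrightarrow> (\<forall>x. 0 \<le> f x \<and> f x \<le> K) \<longrightarrow>
        (LBINT s:{0..real n}. \<integral>x. f x \<partial>X s \<omega>) = (\<integral>x. f x * \<Lambda> x \<omega> \<partial>lborel))) sequentially"
    using total_local_time_version[OF \<mu> ass(4) supp] by blast
  have field: "occupation_field (P \<mu>) \<beta> \<Lambda> lft rgt"
  proof
    show "0 < \<beta>" "\<beta> < 1" "rgt \<in> borel_measurable (P \<mu>)" by (fact ass)+
    show "AE \<omega> in P \<mu>. lft \<omega> < 0 \<and> 0 < rgt \<omega> \<and> (\<forall>x. lft \<omega> < x \<longrightarrow> x < rgt \<omega> \<longrightarrow> 0 < \<Lambda> x \<omega>)"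
      using ass(7) eq
    proof eventually_elim
      case (elim \<omega>)
      have "x \<in> {x. total_local_time X L \<omega> x > 0}" if "lft \<omega> < x" "x < rgt \<omega>" for x
        using elim(1) that by simp
      then show ?case using elim(1) unfolding elim(2)[symmetric] by auto
    qed
    show "(\<integral>\<omega>. exp (- (\<integral>y. potential \<beta> U U2 y * \<Lambda> y \<omega> \<partial>lborel)) \<partial>P \<mu>) = exp (- U 0)"
      if U: "bounded_C11 U U2" "\<And>y. 0 \<le> U y" "\<And>y. 0 \<le> potential \<beta> U U2 y" for U U2
    proof -
      have "(\<integral>y. U y \<partial>\<mu>) = U 0"
        unfolding \<mu>_def using bounded_C11_measurable(1)[OF U(1)] by (intro integral_return) auto
      then show ?thesis using total_local_time_laplace[OF \<mu> \<Lambda>(1,2) occ U] by simp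
    qed
  qed (use \<Lambda> in auto)
  interpret right: occupation_field "P \<mu>" \<beta> \<Lambda> lft rgt by (rule field)
  interpret left: occupation_field "P \<mu>" \<beta> "\<lambda>x. \<Lambda> (- x)" "\<lambda>\<omega>. - rgt \<omega>" "\<lambda>\<omega>. - lft \<omega>"
    by (rule occupation_field_reflect[OF field ass(5)])
  have "AE \<omega> in P \<mu>. pointwise_holder \<gamma> (total_local_time X L \<omega>) (lft \<omega>) \<and>
           pointwise_holder \<gamma> (total_local_time X L \<omega>) (rgt \<omega>)"
    using right.AE_holder_rgt[OF ass(8,9)] left.AE_holder_rgt[OF ass(8,9)] eq
  proof eventually_elim
    case (elim \<omega>)
    have "pointwise_holder \<gamma> (\<lambda>x. \<Lambda> x \<omega>) (- (- lft \<omega>))"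
      using elim(2) by (rule pointwise_holder_reflect)
    then show ?case using elim(1) unfolding elim(3) by simp
  qed
  then show ?thesis by (simp only: \<mu>_def)
qed

end
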